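(* Let $(\mathcal{C},\mathcal{N})$ be a homological category and consider a commutative diagram in $\mathcal{C}$ with rows $A\xrightarrow{f}B\xrightarrow{g}C$ and $A'\xrightarrow{f'}B'\xrightarrow{g'}C'$ and vertical morphisms $a:A\to A'$, $b:B\to B'$, $c:C\to C'$ (so $bf=f'a$, $cg=g'b$), where $gf$ and $g'f'$ are null and $b$ is an exact morphism. Let $S$ be the left-hand and $T$ the right-hand square, let $h:H\to H'$ be the induced morphism of the homologies of the rows, and consider Nomura's null sequence (with all morphisms as described in the context) $$H\bigl(\operatorname{Ker}(bf)\to\operatorname{Ker}b\to\operatorname{Ker}c\bigr)\xrightarrow{\alpha}\operatorname{Ker}h\xrightarrow{\beta}\operatorname{Im}S\xrightarrow{\Lambda}\operatorname{Ker}T\xrightarrow{\beta'}\operatorname{Coker}h\xrightarrow{\alpha'}H\bigl(\operatorname{Coker}a\to\operatorname{Coker}b\to\operatorname{Coker}(g'b)\bigr).$$ Then: (i) If $f$ is exact, then $\alpha$ is an $\mathcal{N}$-monomorphism. If in addition $(\operatorname{coker}f)\ker b$ is exact, then $\alpha=\ker\beta$ and the sequence is exact at $\operatorname{Ker}h$. (ii) If $g$ and $\eta$ are exact, then the sequence is exact at $\operatorname{Im}S$ and $\Lambda$ is an exact morphism. (i$'$) If $g'$ is exact, then $\alpha'$ is an $\mathcal{N}$-epimorphism. If in addition $(\operatorname{coker}b)\ker g'$ is exact, then $\alpha'=\operatorname{coker}\beta'$ and the sequence is exact at $\operatorname{Coker}h$. (ii$'$) If $f'$ and $\eta'$ are exact,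 then the sequence is exact at $\operatorname{Ker}T$ and $\Lambda$ is an exact morphism.
   Context: **Homological categories.** An ideal in a category $\mathcal{C}$ is a class $\mathcal{N}$ of morphisms such that every legitimate composite $hfg$ with $f\in\mathcal{N}$ lies in $\mathcal{N}$; morphisms in $\mathcal{N}$ are called null, and an object $A$ is null if $\mathrm{id}_A\in\mathcal{N}$. The ideal is closed if every null morphism factors through a null object. A kernel of $f:A\to B$ is a morphism $\ker f:\operatorname{Ker}f\to A$ with $f\ker f\in\mathcal{N}$ such that every $x$ with $fx\in\mathcal{N}$ factors uniquely as $x=(\ker f)x'$; the cokernel $\operatorname{coker}f:B\to\operatorname{Coker}f$ is defined dually. (Equalities between kernels, or between cokernels, are up to canonical isomorphism.) $(\mathcal{C},\mathcal{N})$ is semiexact if $\mathcal{N}$ is a closed ideal and every morphism has a kernel and a cokernel. It is homological (in the sense of Grandis) if moreover kernels and cokernels are each closed under composition, and for every kernel $i:A\to B$ and cokernel $q:B\to C$ with $(\operatorname{coker}i)(\ker q)\in\mathcal{N}$ there exist a cokernel $\pi:A\to H$ and a kernel $\iota:H\to C$ with $qi=\iota\pi$. A morphism $f$ is an $\mathcal{N}$-monomorphism if $fx$ null implies $x$ null, and an $\mathcal{N}$-epimorphism if $yf$ null implies $y$ null. Put $\operatorname{im}f=\ker(\operatorname{coker}f):\operatorname{Im}f\to B$ and $\operatorname{coim}f=\operatorname{coker}(\ker f):A\to\operatorname{Coim}f$. Every $f$ factors uniquely as $f=(\operatorname{im}f)\,\overline f\,\operatorname{coim}f$; the morphism $f$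 is exact if $\overline f$ is an isomorphism (then $\operatorname{Coim}f$ is identified with $\operatorname{Im}f$). A sequence $X\xrightarrow{f}Y\xrightarrow{g}Z$ is exact at $Y$ if $\operatorname{im}f=\ker g$. **Homology.** For a null sequence $X\xrightarrow{f}Y\xrightarrow{g}Z$ ($gf$ null), its homology $H(f,g)$, also written $H(X\to Y\to Z)$, is $\operatorname{Coker}(X\to\operatorname{Ker}g)$, canonically isomorphic (in a homological category) to $\operatorname{Ker}(\operatorname{Coker}f\to Z)$, where $X\to\operatorname{Ker}g$ and $\operatorname{Coker}f\to Z$ are induced by $f$ and $g$; the canonical isomorphism $m$ is the one with $\ker(\operatorname{Coker}f\to Z)\,m\,\operatorname{coker}(X\to\operatorname{Ker}g)=(\operatorname{coker}f)\ker g$. **Lambek invariants.** For a commutative square $S$ with top $f:A\to B$, left $a:A\to C$, right $b:B\to D$, bottom $g:C\to D$: let $M$ be the pullback of $\operatorname{im}b$ and $\operatorname{im}g$, with projection $l_S:M\to\operatorname{Im}b$, and $\lambda_S:A\to M$ the morphism induced by $\overline b(\operatorname{coim}b)f:A\to\operatorname{Im}b$ and $\overline g(\operatorname{coim}g)a:A\to\operatorname{Im}g$; put $\operatorname{Im}S=\operatorname{Coker}\lambda_S$. Let $N$ be the pushout of $\operatorname{coim}a$ and $\operatorname{coim}f$, with coprojection $r_S:\operatorname{Coim}a\to N$, and $\rho_S:N\to D$ the morphism induced by $g(\operatorname{im}a)\overline a:\operatorname{Coim}a\to D$ and $b(\operatorname{im}f)\overline f:\operatorname{Coim}f\to D$;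 put $\operatorname{Ker}S=\operatorname{Ker}\rho_S$. These objects do not change if the square is transposed. If $S,T$ are consecutive squares (as in the claim) with null rows and with exact common vertical morphism $b$, the Lambek morphism $\Lambda_{S,T}:\operatorname{Im}S\to\operatorname{Ker}T$ is the unique morphism with $r_T\,l_S=(\ker\rho_T)\,\Lambda_{S,T}\operatorname{coker}\lambda_S$ (with $\operatorname{Coim}b=\operatorname{Im}b$ via $\overline b$). It is known to be an isomorphism if in addition both rows are exact at the middle. The same applies to two squares stacked vertically, with columns in place of rows and the common horizontal morphism exact. Put $\Lambda=\Lambda_{S,T}$. **The diagram.** Let $g^\flat:\operatorname{Coker}f\to C$ satisfy $g^\flat\operatorname{coker}f=g$, and let $f^\sharp:A\to\operatorname{Ker}g$, $f'^\sharp:A'\to\operatorname{Ker}g'$ satisfy $(\ker g)f^\sharp=f$, $(\ker g')f'^\sharp=f'$. Let $\widehat b:\operatorname{Ker}g\to\operatorname{Ker}g'$ and $\check b:\operatorname{Coker}f\to\operatorname{Coker}f'$ be induced by $b$. The morphism $h:H=\operatorname{Coker}f^\sharp\to H'=\operatorname{Coker}f'^\sharp$ is induced by $\widehat b$ (equivalently, it is induced by $\check b$ on right homologies). Let $\xi:\operatorname{Ker}b\to\operatorname{Ker}\check b$ and $\eta:\operatorname{Ker}\check b\to\operatorname{Ker}c$ be given by $(\ker\check b)\xi=(\operatorname{coker}f)\ker b$ and $(\ker c)\eta=g^\flat\ker\check b$. Then $\operatorname{Ker}h=\operatorname{Ker}\eta$ canonically (as subobjects of $\operatorname{Coker}f$,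 via $H=\operatorname{Ker}g^\flat$). Dually, $\eta':\operatorname{Coker}a\to\operatorname{Coker}\widehat b$ and $\xi':\operatorname{Coker}\widehat b\to\operatorname{Coker}b$ are given by $\eta'\operatorname{coker}a=(\operatorname{coker}\widehat b)f'^\sharp$ and $\xi'\operatorname{coker}\widehat b=(\operatorname{coker}b)\ker g'$, and $\operatorname{Coker}h=\operatorname{Coker}\eta'$ canonically. **$\alpha$.** Let $k:\operatorname{Ker}(bf)\to\operatorname{Ker}b$ satisfy $(\ker b)k=f\ker(bf)$. The first homology object is that of $\operatorname{Ker}(bf)\xrightarrow{k}\operatorname{Ker}b\xrightarrow{\eta\xi}\operatorname{Ker}c$, realized as $\operatorname{Coker}k'$ with $k':\operatorname{Ker}(bf)\to\operatorname{Ker}(\eta\xi)$, $\ker(\eta\xi)k'=k$. Let $v:\operatorname{Ker}(\eta\xi)\to\operatorname{Ker}\eta$ satisfy $(\ker\eta)v=\xi\ker(\eta\xi)$. Then $\alpha$ is the unique morphism with $\alpha\operatorname{coker}k'=v$. **$\beta$.** Let $S_1$ be the square with top $\operatorname{coker}f$, left $b$, right $\check b$, bottom $\operatorname{coker}f'$, and $S_2$ the square with top $\xi$, left $\ker b$, right $\ker\check b$, bottom $\operatorname{coker}f$; one has $\operatorname{Im}S_2=\operatorname{Coker}\xi$. By Lambek's theorem, $\Lambda_{S,S_1}:\operatorname{Im}S\to\operatorname{Ker}S_1$ and (vertically) $\Lambda_{S_2,S_1}:\operatorname{Im}S_2\to\operatorname{Ker}S_1$ are isomorphisms. Then $\beta=\Lambda_{S,S_1}^{-1}\Lambda_{S_2,S_1}(\operatorname{coker}\xi)\ker\eta$.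 **$\beta'$.** Let $T_1$ be the square with top $\ker g$, left $\widehat b$, right $b$, bottom $\ker g'$, and $T_2$ the square with top $\ker g'$, left $\operatorname{coker}\widehat b$, right $\operatorname{coker}b$, bottom $\xi'$; one has $\operatorname{Ker}T_2=\operatorname{Ker}\xi'$. The morphisms $\Lambda_{T_1,T}:\operatorname{Im}T_1\to\operatorname{Ker}T$ and (vertically) $\Lambda_{T_1,T_2}:\operatorname{Im}T_1\to\operatorname{Ker}T_2$ are isomorphisms, and $\beta'=(\operatorname{coker}\eta')(\ker\xi')\Lambda_{T_1,T_2}\Lambda_{T_1,T}^{-1}$. **$\alpha'$.** Let $l:\operatorname{Coker}b\to\operatorname{Coker}(g'b)$ satisfy $l\operatorname{coker}b=\operatorname{coker}(g'b)\,g'$. The last homology object is that of $\operatorname{Coker}a\xrightarrow{\xi'\eta'}\operatorname{Coker}b\xrightarrow{l}\operatorname{Coker}(g'b)$, realized as $\operatorname{Ker}l'$ with $l':\operatorname{Coker}(\xi'\eta')\to\operatorname{Coker}(g'b)$, $l'\operatorname{coker}(\xi'\eta')=l$. Let $u:\operatorname{Coker}\eta'\to\operatorname{Coker}(\xi'\eta')$ satisfy $u\operatorname{coker}\eta'=\operatorname{coker}(\xi'\eta')\,\xi'$. Then $\alpha'$ is the unique morphism with $(\ker l')\alpha'=u$. *)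

theory Defs
  imports Main
begin

text \<open>A category with a distinguished class of null morphisms. Composition is written in the
  usual order (\<open>g \<cdot> f\<close> is \<open>f\<close> followed by \<open>g\<close>) and is only meaningful on composable pairs.\<close>

record ('o, 'm) nullcat =
  obj :: "'o set"
  arr :: "'m set"
  source :: "'m \<Rightarrow> 'o"
  target :: "'m \<Rightarrow> 'o"
  ident :: "'o \<Rightarrow> 'm"
  comp :: "'m \<Rightarrow> 'm \<Rightarrow> 'm" (infixl "\<cdot>\<index>" 70)
  null :: "'m set"

text \<open>Top \<open>A \<rightarrow> B\<close>, left \<open>A \<rightarrow> C\<close>, right \<open>B \<rightarrow> D\<close>, bottom \<open>C \<rightarrow> D\<close>.\<close>

record 'm square =
  sq_top :: 'm
  sq_left :: 'm
  sq_right :: 'm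
  sq_bottom :: 'm

text \<open>Rows \<open>f, g\<close> and \<open>f', g'\<close>, columns \<open>a, b, c\<close>.\<close>

record 'm two_rows =
  row_f :: 'm
  row_g :: 'm
  row_f' :: 'm
  row_g' :: 'm
  col_a :: 'm
  col_b :: 'm
  col_c :: 'm

text \<open>The locales \<open>nullcat\<close> and \<open>nomura\<close> carry no assumptions; the axioms are in
  \<open>category\<close>, \<open>semiexact_category\<close> and \<open>homological_category\<close>.\<close>

locale nullcat =
  fixes C :: "('o, 'm) nullcat" (structure)
begin

definition hom :: "'o \<Rightarrow> 'o \<Rightarrow> 'm set" where
  "hom A B = {x \<in> arr C. source C x = A \<and> target C x = B}"

definition is_iso :: "'m \<Rightarrow> bool" where
  "is_iso x \<longleftrightarrow> x \<in> arr C \<and>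
     (\<exists>y \<in> hom (target C x) (source C x).
        y \<cdot> x = ident C (source C x) \<and> x \<cdot> y = ident C (target C x))"

definition inv_arr :: "'m \<Rightarrow> 'm" where
  "inv_arr x = (THE y. y \<in> hom (target C x) (source C x) \<and>
     y \<cdot> x = ident C (source C x) \<and> x \<cdot> y = ident C (target C x))"

definition null_obj :: "'o \<Rightarrow> bool" where
  "null_obj Z \<longleftrightarrow> Z \<in> obj C \<and> ident C Z \<in> null C"

definition is_kernel :: "'m \<Rightarrow> 'm \<Rightarrow> bool" where
  "is_kernel k f \<longleftrightarrow> f \<in> arr C \<and> k \<in> arr C \<and> target C k = source C f \<and> f \<cdot> k \<in> null C \<and>
     (\<forall>x \<in> arr C. target C x = source C f \<and> f \<cdot> x \<in> null C \<longrightarrow>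
        (\<exists>!x'. x' \<in> hom (source C x) (source C k) \<and> k \<cdot> x' = x))"

definition is_cokernel :: "'m \<Rightarrow> 'm \<Rightarrow> bool" where
  "is_cokernel q f \<longleftrightarrow> f \<in> arr C \<and> q \<in> arr C \<and> source C q = target C f \<and> q \<cdot> f \<in> null C \<and>
     (\<forall>y \<in> arr C. source C y = target C f \<and> y \<cdot> f \<in> null C \<longrightarrow>
        (\<exists>!y'. y' \<in> hom (target C q) (target C y) \<and> y' \<cdot> q = y))"

definition N_mono :: "'m \<Rightarrow> bool" where
  "N_mono f \<longleftrightarrow> f \<in> arr C \<and>
     (\<forall>x \<in> arr C. target C x = source C f \<and> f \<cdot> x \<in> null C \<longrightarrow> x \<in> null C)"

definition N_epi :: "'m \<Rightarrow> bool" where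
  "N_epi f \<longleftrightarrow> f \<in> arr C \<and>
     (\<forall>y \<in> arr C. source C y = target C f \<and> y \<cdot> f \<in> null C \<longrightarrow> y \<in> null C)"

definition is_pullback :: "'m \<Rightarrow> 'm \<Rightarrow> 'm \<times> 'm \<Rightarrow> bool" where
  "is_pullback i j pq \<longleftrightarrow> (case pq of (p, q) \<Rightarrow>
     p \<in> arr C \<and> q \<in> arr C \<and> source C p = source C q \<and>
     target C p = source C i \<and> target C q = source C j \<and> i \<cdot> p = j \<cdot> q \<and>
     (\<forall>x \<in> arr C. \<forall>y \<in> arr C. source C x = source C y \<and>
        target C x = source C i \<and> target C y = source C j \<and> i \<cdot> x = j \<cdot> y \<longrightarrow>
        (\<exists>!z. z \<in> hom (source C x) (source C p) \<and> p \<cdot> z = x \<and> q \<cdot> z = y)))"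

definition is_pushout :: "'m \<Rightarrow> 'm \<Rightarrow> 'm \<times> 'm \<Rightarrow> bool" where
  "is_pushout i j pq \<longleftrightarrow> (case pq of (p, q) \<Rightarrow>
     p \<in> arr C \<and> q \<in> arr C \<and> target C p = target C q \<and>
     source C p = target C i \<and> source C q = target C j \<and> p \<cdot> i = q \<cdot> j \<and>
     (\<forall>x \<in> arr C. \<forall>y \<in> arr C. target C x = target C y \<and>
        source C x = target C i \<and> source C y = target C j \<and> x \<cdot> i = y \<cdot> j \<longrightarrow>
        (\<exists>!z. z \<in> hom (target C p) (target C x) \<and> z \<cdot> p = x \<and> z \<cdot> q = y)))"

text \<open>Chosen (co)kernels, pullbacks and pushouts; the objects \<open>Ker f\<close>, \<open>Coker f\<close>, \<open>Im f\<close>,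
  \<open>Coim f\<close> are the sources, respectively targets, of the corresponding morphisms.\<close>

definition ker :: "'m \<Rightarrow> 'm" where
  "ker f = (SOME k. is_kernel k f)"

definition coker :: "'m \<Rightarrow> 'm" where
  "coker f = (SOME q. is_cokernel q f)"

definition pb :: "'m \<Rightarrow> 'm \<Rightarrow> 'm \<times> 'm" where
  "pb i j = (SOME pq. is_pullback i j pq)"

definition po :: "'m \<Rightarrow> 'm \<Rightarrow> 'm \<times> 'm" where
  "po i j = (SOME pq. is_pushout i j pq)"

definition im :: "'m \<Rightarrow> 'm" where
  "im f = ker (coker f)"

definition coim :: "'m \<Rightarrow> 'm" where
  "coim f = coker (ker f)"

definition bar :: "'m \<Rightarrow> 'm" where
  "bar f = (THE x. x \<in> hom (target C (coim f)) (source C (im f)) \<and> im f \<cdot> x \<cdot> coim f = f)"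

definition exact_mor :: "'m \<Rightarrow> bool" where
  "exact_mor f \<longleftrightarrow> f \<in> arr C \<and> is_iso (bar f)"

text \<open>Equality of kernels is meant up to canonical isomorphism, so \<open>im f = ker g\<close> says that
  \<open>im f\<close> is a kernel of \<open>g\<close>.\<close>

definition exact_at :: "'m \<Rightarrow> 'm \<Rightarrow> bool" where
  "exact_at f g \<longleftrightarrow> f \<in> arr C \<and> g \<in> arr C \<and> target C f = source C g \<and> is_kernel (im f) g"

text \<open>The unique \<open>x\<close> with \<open>k \<cdot> x = y\<close>, and the unique \<open>x\<close> with \<open>x \<cdot> q = y\<close>.\<close>

definition lift :: "'m \<Rightarrow> 'm \<Rightarrow> 'm" where
  "lift k y = (THE x. x \<in> hom (source C y) (source C k) \<and> k \<cdot> x = y)"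

definition colift :: "'m \<Rightarrow> 'm \<Rightarrow> 'm" where
  "colift q y = (THE x. x \<in> hom (target C q) (target C y) \<and> x \<cdot> q = y)"

text \<open>For a null sequence \<open>f, g\<close>: the projection of \<open>Ker g\<close> onto the (left) homology
  \<open>Coker (X \<rightarrow> Ker g)\<close>, the inclusion of the (right) homology \<open>Ker (Coker f \<rightarrow> Z)\<close> into
  \<open>Coker f\<close>, and the canonical isomorphism from the former object to the latter.\<close>

definition lhom :: "'m \<Rightarrow> 'm \<Rightarrow> 'm" where
  "lhom f g = coker (lift (ker g) f)"

definition rhom :: "'m \<Rightarrow> 'm \<Rightarrow> 'm" where
  "rhom f g = ker (colift (coker f) g)"

definition lr_iso :: "'m \<Rightarrow> 'm \<Rightarrow> 'm" where
  "lr_iso f g = (THE m. m \<in> hom (target C (lhom f g)) (source C (rhom f g)) \<and>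
     rhom f g \<cdot> m \<cdot> lhom f g = coker f \<cdot> ker g)"

text \<open>Lambek invariants. \<open>lproj S\<close> and \<open>lproj_v S\<close> are the two projections of the pullback,
  to the images of the right and of the bottom side; \<open>rinj S\<close> and \<open>rinj_v S\<close> are the two
  coprojections to the pushout, from the coimages of the left and of the top side. The second
  ones play the role of the first ones when the square is transposed.\<close>

definition lproj :: "'m square \<Rightarrow> 'm" where
  "lproj S = fst (pb (im (sq_right S)) (im (sq_bottom S)))"

definition lproj_v :: "'m square \<Rightarrow> 'm" where
  "lproj_v S = snd (pb (im (sq_right S)) (im (sq_bottom S)))"

definition lam :: "'m square \<Rightarrow> 'm" where
  "lam S = (THE x. x \<in> hom (source C (sq_top S)) (source C (lproj S)) \<and>
     lproj S \<cdot> x = bar (sq_right S) \<cdot> coim (sq_right S) \<cdot> sq_top S \<and>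
     lproj_v S \<cdot> x = bar (sq_bottom S) \<cdot> coim (sq_bottom S) \<cdot> sq_left S)"

definition ImS :: "'m square \<Rightarrow> 'o" where
  "ImS S = target C (coker (lam S))"

definition rinj :: "'m square \<Rightarrow> 'm" where
  "rinj S = fst (po (coim (sq_left S)) (coim (sq_top S)))"

definition rinj_v :: "'m square \<Rightarrow> 'm" where
  "rinj_v S = snd (po (coim (sq_left S)) (coim (sq_top S)))"

definition rho :: "'m square \<Rightarrow> 'm" where
  "rho S = (THE x. x \<in> hom (target C (rinj S)) (target C (sq_bottom S)) \<and>
     x \<cdot> rinj S = sq_bottom S \<cdot> im (sq_left S) \<cdot> bar (sq_left S) \<and>
     x \<cdot> rinj_v S = sq_right S \<cdot> im (sq_top S) \<cdot> bar (sq_top S))"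

definition KerS :: "'m square \<Rightarrow> 'o" where
  "KerS S = source C (ker (rho S))"

text \<open>\<open>Lambek S T\<close> is for \<open>T\<close> to the right of \<open>S\<close>, \<open>Lambek_v S T\<close> for \<open>T\<close> below \<open>S\<close>. The
  common side \<open>e\<close> is exact, and \<open>Coim e\<close> is identified with \<open>Im e\<close> by means of \<open>bar e\<close>.\<close>

definition Lambek :: "'m square \<Rightarrow> 'm square \<Rightarrow> 'm" where
  "Lambek S T = (THE x. x \<in> hom (ImS S) (KerS T) \<and>
     ker (rho T) \<cdot> x \<cdot> coker (lam S) = rinj T \<cdot> inv_arr (bar (sq_right S)) \<cdot> lproj S)"

definition Lambek_v :: "'m square \<Rightarrow> 'm square \<Rightarrow> 'm" where
  "Lambek_v S T = (THE x. x \<in> hom (ImS S) (KerS T) \<and>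
     ker (rho T) \<cdot> x \<cdot> coker (lam S) = rinj_v T \<cdot> inv_arr (bar (sq_bottom S)) \<cdot> lproj_v S)"

end

locale category = nullcat +
  assumes source_obj: "x \<in> arr C \<Longrightarrow> source C x \<in> obj C"
    and target_obj: "x \<in> arr C \<Longrightarrow> target C x \<in> obj C"
    and ident_hom: "A \<in> obj C \<Longrightarrow> ident C A \<in> hom A A"
    and comp_hom: "\<lbrakk>x \<in> hom A B; y \<in> hom B D\<rbrakk> \<Longrightarrow> y \<cdot> x \<in> hom A D"
    and comp_assoc: "\<lbrakk>x \<in> hom A B; y \<in> hom B D; z \<in> hom D E\<rbrakk> \<Longrightarrow> z \<cdot> (y \<cdot> x) = z \<cdot> y \<cdot> x"
    and comp_ident_right: "x \<in> hom A B \<Longrightarrow> x \<cdot> ident C A = x"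
    and comp_ident_left: "x \<in> hom A B \<Longrightarrow> ident C B \<cdot> x = x"

locale semiexact_category = category +
  assumes null_arr: "null C \<subseteq> arr C"
    and null_ideal: "\<lbrakk>g \<in> hom A B; f \<in> hom B D; h \<in> hom D E; f \<in> null C\<rbrakk> \<Longrightarrow> h \<cdot> f \<cdot> g \<in> null C"
    and null_closed: "f \<in> null C \<Longrightarrow>
      \<exists>Z u v. null_obj Z \<and> u \<in> hom (source C f) Z \<and> v \<in> hom Z (target C f) \<and> f = v \<cdot> u"
    and ex_kernel: "f \<in> arr C \<Longrightarrow> \<exists>k. is_kernel k f"
    and ex_cokernel: "f \<in> arr C \<Longrightarrow> \<exists>q. is_cokernel q f"

locale homological_category = semiexact_category +
  assumes kernel_comp: "\<lbrakk>is_kernel i f; is_kernel j g; target C i = source C j\<rbrakk>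
      \<Longrightarrow> \<exists>f'. is_kernel (j \<cdot> i) f'"
    and cokernel_comp: "\<lbrakk>is_cokernel p f; is_cokernel q g; target C p = source C q\<rbrakk>
      \<Longrightarrow> \<exists>f'. is_cokernel (q \<cdot> p) f'"
    and subquotient: "\<lbrakk>is_kernel i f; is_cokernel q g; target C i = source C q;
        coker i \<cdot> ker q \<in> null C\<rbrakk>
      \<Longrightarrow> \<exists>H p j f' g'. p \<in> hom (source C i) H \<and> j \<in> hom H (target C q) \<and>
            is_cokernel p f' \<and> is_kernel j g' \<and> q \<cdot> i = j \<cdot> p"

locale nomura = nullcat C for C :: "('o, 'm) nullcat" (structure) +
  fixes D :: "'m two_rows"
begin

abbreviation "f \<equiv> row_f D"
abbreviation "g \<equiv> row_g D"
abbreviation "f' \<equiv> row_f' D"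
abbreviation "g' \<equiv> row_g' D"
abbreviation "a \<equiv> col_a D"
abbreviation "b \<equiv> col_b D"
abbreviation "c \<equiv> col_c D"

definition S :: "'m square" where
  "S = \<lparr>sq_top = f, sq_left = a, sq_right = b, sq_bottom = f'\<rparr>"

definition T :: "'m square" where
  "T = \<lparr>sq_top = g, sq_left = b, sq_right = c, sq_bottom = g'\<rparr>"

definition b_hat :: 'm where
  "b_hat = lift (ker g') (b \<cdot> ker g)"

definition b_check :: 'm where
  "b_check = colift (coker f) (coker f' \<cdot> b)"

definition g_flat :: 'm where
  "g_flat = colift (coker f) g"

definition f'_sharp :: 'm where
  "f'_sharp = lift (ker g') f'"

definition h :: 'm where
  "h = colift (lhom f g) (lhom f' g' \<cdot> b_hat)"

definition xi :: 'm where
  "xi = lift (ker b_check) (coker f \<cdot> ker b)"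

definition eta :: 'm where
  "eta = lift (ker c) (g_flat \<cdot> ker b_check)"

definition eta' :: 'm where
  "eta' = colift (coker a) (coker b_hat \<cdot> f'_sharp)"

definition xi' :: 'm where
  "xi' = colift (coker b_hat) (coker b \<cdot> ker g')"

text \<open>The canonical isomorphism \<open>Ker h \<rightarrow> Ker \<eta>\<close> of subobjects of \<open>Coker f\<close>, where \<open>H\<close> is
  embedded in \<open>Coker f\<close> as the right homology, and dually the canonical isomorphism
  \<open>Coker \<eta>' \<rightarrow> Coker h\<close> of quotients of \<open>Ker g'\<close>.\<close>

definition theta :: 'm where
  "theta = lift (ker b_check \<cdot> ker eta) (rhom f g \<cdot> lr_iso f g \<cdot> ker h)"

definition theta' :: 'm where
  "theta' = colift (coker eta' \<cdot> coker b_hat) (coker h \<cdot> lhom f' g')"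

definition k :: 'm where
  "k = lift (ker b) (f \<cdot> ker (b \<cdot> f))"

definition v :: 'm where
  "v = lift (ker eta) (xi \<cdot> ker (eta \<cdot> xi))"

definition alpha :: 'm where
  "alpha = inv_arr theta \<cdot> colift (lhom k (eta \<cdot> xi)) v"

definition S1 :: "'m square" where
  "S1 = \<lparr>sq_top = coker f, sq_left = b, sq_right = b_check, sq_bottom = coker f'\<rparr>"

definition S2 :: "'m square" where
  "S2 = \<lparr>sq_top = xi, sq_left = ker b, sq_right = ker b_check, sq_bottom = coker f\<rparr>"

text \<open>The identification of \<open>Coker \<xi>\<close> with \<open>Im S2\<close>. As \<open>coker f\<close> has image \<open>Coker f\<close>, the
  pullback defining \<open>Im S2\<close> is canonically \<open>Ker b_check\<close>, compatibly with the maps to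
  \<open>Coker f\<close>; the inner lift is this isomorphism, and it carries \<open>\<xi>\<close> to \<open>lam S2\<close>.\<close>

definition sigma :: 'm where
  "sigma = colift (coker xi)
     (coker (lam S2) \<cdot> lift (im (sq_right S2) \<cdot> lproj S2) (ker b_check))"

definition beta :: 'm where
  "beta = inv_arr (Lambek S S1) \<cdot> Lambek_v S2 S1 \<cdot> sigma \<cdot> coker xi \<cdot> ker eta \<cdot> theta"

definition Lam :: 'm where
  "Lam = Lambek S T"

definition T1 :: "'m square" where
  "T1 = \<lparr>sq_top = ker g, sq_left = b_hat, sq_right = b, sq_bottom = ker g'\<rparr>"

definition T2 :: "'m square" where
  "T2 = \<lparr>sq_top = ker g', sq_left = coker b_hat, sq_right = coker b, sq_bottom = xi'\<rparr>"

text \<open>Dually, the identification of \<open>Ker T2\<close> with \<open>Ker \<xi>'\<close>.\<close>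

definition sigma' :: 'm where
  "sigma' = lift (ker xi')
     (colift (rinj T2 \<cdot> coim (sq_left T2)) (coker b_hat) \<cdot> ker (rho T2))"

definition beta' :: 'm where
  "beta' = theta' \<cdot> coker eta' \<cdot> ker xi' \<cdot> sigma' \<cdot> Lambek_v T1 T2 \<cdot> inv_arr (Lambek T1 T)"

definition l :: 'm where
  "l = colift (coker b) (coker (g' \<cdot> b) \<cdot> g')"

definition u :: 'm where
  "u = colift (coker eta') (coker (xi' \<cdot> eta') \<cdot> xi')"

definition alpha' :: 'm where
  "alpha' = lift (rhom (xi' \<cdot> eta') l) u \<cdot> inv_arr theta'"

end

end

theory Submission
  imports Defs
begin

text \<open>Write \<open>b = i p\<close> with a cokernel \<open>p : B \<rightarrow> I\<close> and a kernel \<open>i : I \<rightarrow> B'\<close>. Then \<open>Im S\<close> and \<open>Ker T\<close> are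
  subquotients of \<open>I\<close>, namely \<open>i\<^sup>*(Im f') / p\<^sub>*(Im f)\<close> and \<open>i\<^sup>*(Ker g') / p\<^sub>*(Ker g)\<close>, the Lambek morphism
  being induced by the identity of \<open>I\<close>, and \<open>Ker h\<close> is the subobject \<open>Ker eta\<close> of \<open>Coker f\<close>, which \<open>beta\<close>
  maps by the morphism induced by \<open>p\<close>. A cokernel restricts to a cokernel from the preimage of a normal
  subobject onto that subobject; this yields the isomorphism of the left and the right homology, of
  which Lambek's isomorphisms are instances. For (i), if \<open>coker f \<cdot> ker b\<close> is exact with kernel part
  \<open>J\<close>, then \<open>J\<close> is the kernel of the morphism \<open>pbar\<close> induced by \<open>p\<close> on \<open>Coker f\<close>, and both \<open>alpha\<close> and
  \<open>ker beta\<close> are the intersection of \<open>J\<close> with \<open>Ker eta\<close>. For (ii), exactness of \<open>g\<close> and \<open>eta\<close> makes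
  \<open>Ker b_check \<rightarrow> Coim g \<rightarrow> B / (Ker g \<or> Ker b)\<close> a cokernel followed by a kernel, and this composite
  factors through \<open>Lam\<close>. The statements (i') and (ii') follow in the opposite category.\<close>

text \<open>There is no additive structure, and pullbacks and pushouts are available only for normal
  subobjects and quotients, so elementwise diagram chases are replaced by factorizations through
  kernels and cokernels. Two kinds of cancellation must be kept apart. Equations are cancelled along
  monic or epic arrows, whereas nullity is cancelled along N-monomorphisms and N-epimorphisms, which
  need not be monic or epic. Kernels and cokernels have both properties, and this is why exactness
  hypotheses are used by splitting a morphism into a cokernel followed by a kernel.

  The subquotient axiom acts only through the restriction of a cokernel to a preimage. Every later
  interchange of "subobject, then quotient" with "quotient, then subobject" goes back to it.

  Objects such as \<open>Ker h\<close> and \<open>Im S\<close> come from arbitrary choices. The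
  morphisms of the sequence are therefore computed by embedding them into a common quotient of
  \<open>B\<close> or of \<open>Im b\<close>, where the chosen isomorphisms cancel.\<close>

context nullcat
begin

section \<open>Monic, epic and normal morphisms; elimination rules\<close>

definition monic :: "'m \<Rightarrow> bool" where
  "monic k \<longleftrightarrow> k \<in> arr C \<and> (\<forall>x \<in> arr C. \<forall>y \<in> arr C.
     target C x = source C k \<and> target C y = source C k \<and> k \<cdot> x = k \<cdot> y \<longrightarrow> x = y)"

definition epic :: "'m \<Rightarrow> bool" where
  "epic q \<longleftrightarrow> q \<in> arr C \<and> (\<forall>x \<in> arr C. \<forall>y \<in> arr C.
     source C x = target C q \<and> source C y = target C q \<and> x \<cdot> q = y \<cdot> q \<longrightarrow> x = y)"

definition normal_mono :: "'m \<Rightarrow> bool" where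
  "normal_mono k \<longleftrightarrow> (\<exists>f. is_kernel k f)"

definition normal_epi :: "'m \<Rightarrow> bool" where
  "normal_epi q \<longleftrightarrow> (\<exists>f. is_cokernel q f)"

lemma homD:
  assumes "x \<in> hom A B"
  shows "x \<in> arr C" "source C x = A" "target C x = B"
  using assms by (auto simp: hom_def)

lemma homI: "\<lbrakk>x \<in> arr C; source C x = A; target C x = B\<rbrakk> \<Longrightarrow> x \<in> hom A B"
  by (auto simp: hom_def)

lemma kernelD:
  assumes "is_kernel k f"
  shows "f \<in> arr C" "k \<in> arr C" "target C k = source C f" "f \<cdot> k \<in> null C"
  using assms by (auto simp: is_kernel_def)

lemma cokernelD:
  assumes "is_cokernel q f"
  shows "f \<in> arr C" "q \<in> arr C" "source C q = target C f" "q \<cdot> f \<in> null C"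
  using assms by (auto simp: is_cokernel_def)

lemma kernel_lift:
  assumes "is_kernel k f" "x \<in> arr C" "target C x = source C f" "f \<cdot> x \<in> null C"
  obtains x' where "x' \<in> arr C" "source C x' = source C x" "target C x' = source C k" "k \<cdot> x' = x"
proof -
  from assms have "\<exists>!x'. x' \<in> hom (source C x) (source C k) \<and> k \<cdot> x' = x"
    unfolding is_kernel_def by blast
  then obtain z where z: "z \<in> hom (source C x) (source C k)" "k \<cdot> z = x" by (elim ex1E conjE)
  show thesis by (rule that[OF homD[OF z(1)] z(2)])
qed

lemma cokernel_colift:
  assumes "is_cokernel q f" "y \<in> arr C" "source C y = target C f" "y \<cdot> f \<in> null C"
  obtains y' where "y' \<in> arr C" "source C y' = target C q" "target C y' = target C y" "y' \<cdot> q = y"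
proof -
  from assms have "\<exists>!y'. y' \<in> hom (target C q) (target C y) \<and> y' \<cdot> q = y"
    unfolding is_cokernel_def by blast
  then obtain z where z: "z \<in> hom (target C q) (target C y)" "z \<cdot> q = y" by (elim ex1E conjE)
  show thesis by (rule that[OF homD[OF z(1)] z(2)])
qed

lemma kernel_ex:
  assumes "is_kernel k f" "x \<in> arr C" "target C x = source C f" "f \<cdot> x \<in> null C"
  shows "\<exists>x' \<in> arr C. target C x' = source C k \<and> k \<cdot> x' = x"
  using kernel_lift[OF assms] by blast

lemma monicD: "\<lbrakk>monic k; k \<cdot> x = k \<cdot> y; x \<in> arr C; y \<in> arr C; target C x = source C k;
    target C y = source C k\<rbrakk> \<Longrightarrow> x = y"
  by (auto simp: monic_def)

lemma epicD: "\<lbrakk>epic q; x \<cdot> q = y \<cdot> q; x \<in> arr C; y \<in> arr C; source C x = target C q;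
    source C y = target C q\<rbrakk> \<Longrightarrow> x = y"
  by (auto simp: epic_def)

lemma N_monoD: "\<lbrakk>N_mono f; f \<cdot> x \<in> null C; x \<in> arr C; target C x = source C f\<rbrakk> \<Longrightarrow> x \<in> null C"
  by (auto simp: N_mono_def)

lemma N_epiD: "\<lbrakk>N_epi f; x \<cdot> f \<in> null C; x \<in> arr C; source C x = target C f\<rbrakk> \<Longrightarrow> x \<in> null C"
  by (auto simp: N_epi_def)

end

section \<open>Composition and isomorphisms in a category\<close>

context category
begin

lemma comp_typing [simp]:
  assumes "y \<in> arr C" "x \<in> arr C" "source C y = target C x"
  shows "y \<cdot> x \<in> arr C" "source C (y \<cdot> x) = source C x" "target C (y \<cdot> x) = target C y"
  using comp_hom[of x "source C x" "target C x" y "target C y"] assms by (auto simp: hom_def)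

lemma assoc [simp]:
  assumes "z \<in> arr C" "y \<in> arr C" "x \<in> arr C" "source C z = target C y" "source C y = target C x"
  shows "z \<cdot> y \<cdot> x = z \<cdot> (y \<cdot> x)"
  using comp_assoc[of x "source C x" "target C x" y "target C y" z "target C z"] assms
  by (auto simp: hom_def)

text \<open>The simplifier associates composites to the right, so an equation between composites has to be
  extended by a further factor before it can rewrite inside a longer one.\<close>

lemma reassoc:
  assumes "y \<cdot> x = w" "y \<in> arr C" "x \<in> arr C" "source C y = target C x"
    "z \<in> arr C" "source C x = target C z"
  shows "y \<cdot> (x \<cdot> z) = w \<cdot> z"
  using assms assoc[of y x z] by auto

lemma reassoc3:
  assumes "x \<cdot> (y \<cdot> z) = w" "x \<in> arr C" "y \<in> arr C" "z \<in> arr C" "source C x = target C y"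
    "source C y = target C z" "t \<in> arr C" "source C z = target C t"
  shows "x \<cdot> (y \<cdot> (z \<cdot> t)) = w \<cdot> t"
  using reassoc[of x "y \<cdot> z" w t] assms by simp

lemma ident_typing [simp]:
  assumes "A \<in> obj C"
  shows "ident C A \<in> arr C" "source C (ident C A) = A" "target C (ident C A) = A"
  using ident_hom[OF assms] by (auto simp: hom_def)

lemma obj_typing [simp]:
  assumes "x \<in> arr C" shows "source C x \<in> obj C" "target C x \<in> obj C"
  using assms source_obj target_obj by auto

lemma ident_right [simp]: "\<lbrakk>x \<in> arr C; source C x = A\<rbrakk> \<Longrightarrow> x \<cdot> ident C A = x"
  using comp_ident_right[of x A "target C x"] by (auto simp: hom_def)

lemma ident_left [simp]: "\<lbrakk>x \<in> arr C; target C x = A\<rbrakk> \<Longrightarrow> ident C A \<cdot> x = x"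
  using comp_ident_left[of x "source C x" A] by (auto simp: hom_def)

lemma iso_inverse:
  assumes "is_iso x"
  obtains y where "x \<in> arr C" "y \<in> arr C" "source C y = target C x" "target C y = source C x"
    "y \<cdot> x = ident C (source C x)" "x \<cdot> y = ident C (target C x)"
  using assms by (auto simp: is_iso_def hom_def)

lemma isoI:
  assumes "x \<in> arr C" "y \<in> arr C" "source C y = target C x" "target C y = source C x"
    "y \<cdot> x = ident C (source C x)" "x \<cdot> y = ident C (target C x)"
  shows "is_iso x"
  using assms by (auto simp: is_iso_def hom_def)

lemma inv_arr_unique:
  assumes "x \<in> arr C" "y \<in> arr C" "source C y = target C x" "target C y = source C x"
    "y \<cdot> x = ident C (source C x)" "x \<cdot> y = ident C (target C x)"
  shows "inv_arr x = y"
  unfolding inv_arr_def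
proof (rule the_equality)
  fix z assume z: "z \<in> hom (target C x) (source C x) \<and> z \<cdot> x = ident C (source C x)
    \<and> x \<cdot> z = ident C (target C x)"
  note [simp] = assms(1-4)
  have [simp]: "z \<in> arr C" "source C z = target C x" "target C z = source C x"
    using z by (auto simp: hom_def)
  have "z = z \<cdot> (x \<cdot> y)" using assms(6) by simp
  also have "\<dots> = (z \<cdot> x) \<cdot> y" by simp
  also have "\<dots> = y" using z by simp
  finally show "z = y" .
qed (use assms in \<open>auto simp: hom_def\<close>)

lemma inv_arr_props:
  assumes "is_iso x"
  shows "x \<in> arr C" "inv_arr x \<in> arr C" "source C (inv_arr x) = target C x"
    "target C (inv_arr x) = source C x"
    "inv_arr x \<cdot> x = ident C (source C x)" "x \<cdot> inv_arr x = ident C (target C x)"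
proof -
  from assms obtain y where y: "x \<in> arr C" "y \<in> arr C" "source C y = target C x"
    "target C y = source C x" "y \<cdot> x = ident C (source C x)" "x \<cdot> y = ident C (target C x)"
    by (rule iso_inverse)
  from inv_arr_unique[OF this] y
  show "x \<in> arr C" "inv_arr x \<in> arr C" "source C (inv_arr x) = target C x"
    "target C (inv_arr x) = source C x"
    "inv_arr x \<cdot> x = ident C (source C x)" "x \<cdot> inv_arr x = ident C (target C x)" by auto
qed

lemma inv_arr_cancel:
  assumes "is_iso x" "z \<in> arr C"
  shows "target C z = source C x \<Longrightarrow> inv_arr x \<cdot> (x \<cdot> z) = z"
    "target C z = target C x \<Longrightarrow> x \<cdot> (inv_arr x \<cdot> z) = z"
  using reassoc[OF inv_arr_props(5)[OF assms(1)], of z] reassoc[OF inv_arr_props(6)[OF assms(1)], of z]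
    inv_arr_props[OF assms(1)] assms(2)
  by auto

lemma iso_inv_arr: "is_iso x \<Longrightarrow> is_iso (inv_arr x)"
  using inv_arr_props[of x] by (intro isoI[where y = x]) auto

lemma iso_comp:
  assumes "is_iso x" "is_iso y" "source C y = target C x"
  shows "is_iso (y \<cdot> x)"
proof -
  note [simp] = inv_arr_props[OF assms(1)] inv_arr_props[OF assms(2)] assms(3)
    inv_arr_cancel[OF assms(1)] inv_arr_cancel[OF assms(2)]
  show ?thesis by (rule isoI[where y = "inv_arr x \<cdot> inv_arr y"]) simp_all
qed

lemma iso_monic:
  assumes "is_iso x" shows "monic x"
proof -
  note [simp] = inv_arr_props[OF assms]
  show ?thesis unfolding monic_def
  proof (intro conjI ballI impI)
    fix y z assume *: "y \<in> arr C" "z \<in> arr C"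
      "target C y = source C x \<and> target C z = source C x \<and> x \<cdot> y = x \<cdot> z"
    have "y = inv_arr x \<cdot> (x \<cdot> y)" using * inv_arr_cancel(1)[OF assms, of y] by simp
    also have "\<dots> = z" using * inv_arr_cancel(1)[OF assms, of z] by simp
    finally show "y = z" .
  qed simp
qed

end

section \<open>Null morphisms and the universal property of kernels\<close>

context semiexact_category
begin

lemma null_comp_left [simp]:
  assumes "x \<in> null C" "y \<in> arr C" "source C y = target C x"
  shows "y \<cdot> x \<in> null C"
proof -
  have x: "x \<in> arr C" using null_arr assms(1) by auto
  have "y \<cdot> x \<cdot> ident C (source C x) \<in> null C"
    using assms x by (intro null_ideal[where A = "source C x" and B = "source C x"
          and D = "target C x" and E = "target C y"]) (auto intro: homI)
  then show ?thesis using assms x by simp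
qed

lemma null_comp_right [simp]:
  assumes "x \<in> null C" "y \<in> arr C" "target C y = source C x"
  shows "x \<cdot> y \<in> null C"
proof -
  have x: "x \<in> arr C" using null_arr assms(1) by auto
  have "ident C (target C x) \<cdot> x \<cdot> y \<in> null C"
    using assms x by (intro null_ideal[where A = "source C y" and B = "source C x"
          and D = "target C x" and E = "target C x"]) (auto intro: homI)
  then show ?thesis using assms x by simp
qed

lemma null_reassoc:
  assumes "y \<cdot> x \<in> null C" "y \<in> arr C" "x \<in> arr C" "source C y = target C x"
    "z \<in> arr C" "source C x = target C z"
  shows "y \<cdot> (x \<cdot> z) \<in> null C"
  using null_comp_right[OF assms(1), of z] assms by simp

lemma kernel_monic:
  assumes k: "is_kernel k f"
  shows "monic k"
  unfolding monic_def
proof (intro conjI ballI impI)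
  note [simp] = kernelD[OF k]
  show "k \<in> arr C" by simp
  fix x y assume [simp]: "x \<in> arr C" "y \<in> arr C"
    and a: "target C x = source C k \<and> target C y = source C k \<and> k \<cdot> x = k \<cdot> y"
  then have tx [simp]: "target C x = source C k" and ty [simp]: "target C y = source C k"
    and e: "k \<cdot> x = k \<cdot> y" by auto
  have s: "source C y = source C x"
    using arg_cong[OF e, of "source C"] by simp
  have "f \<cdot> (k \<cdot> y) \<in> null C" by (rule null_reassoc) simp_all
  then have "\<exists>!x'. x' \<in> hom (source C (k \<cdot> y)) (source C k) \<and> k \<cdot> x' = k \<cdot> y"
    using k unfolding is_kernel_def by (elim conjE ballE[where x = "k \<cdot> y"]) simp_all
  then obtain w where w: "\<forall>u. u \<in> hom (source C (k \<cdot> y)) (source C k) \<and> k \<cdot> u = k \<cdot> y \<longrightarrow> u = w"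
    by (elim ex1E)
  have "x = w" using w[rule_format, of x] e s by (simp add: hom_def)
  moreover have "y = w" using w[rule_format, of y] by (simp add: hom_def)
  ultimately show "x = y" by simp
qed

text \<open>For monic \<open>k\<close> the existence of a factorization is enough: uniqueness
  follows by cancellation, and the equation \<open>k \<cdot> x' = x\<close> forces the source of
  \<open>x'\<close>.\<close>

lemma kernelI:
  assumes "f \<in> arr C" "monic k" "target C k = source C f" "f \<cdot> k \<in> null C"
    and ex: "\<And>x. \<lbrakk>x \<in> arr C; target C x = source C f; f \<cdot> x \<in> null C\<rbrakk>
      \<Longrightarrow> \<exists>x' \<in> arr C. target C x' = source C k \<and> k \<cdot> x' = x"
  shows "is_kernel k f"
  unfolding is_kernel_def
proof (intro conjI ballI impI)
  show [simp]: "k \<in> arr C" using assms by (simp add: monic_def)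
  fix x assume [simp]: "x \<in> arr C" and x: "target C x = source C f \<and> f \<cdot> x \<in> null C"
  then obtain x' where [simp]: "x' \<in> arr C" and x': "target C x' = source C k" "k \<cdot> x' = x"
    using ex by blast
  then have s: "source C x' = source C x" by auto
  show "\<exists>!x'. x' \<in> hom (source C x) (source C k) \<and> k \<cdot> x' = x"
  proof (rule ex1I[of _ x'])
    show "x' \<in> hom (source C x) (source C k) \<and> k \<cdot> x' = x"
      using x' s by (simp add: hom_def)
    fix y assume "y \<in> hom (source C x) (source C k) \<and> k \<cdot> y = x"
    then show "y = x'" using x' monicD[OF assms(2), of y x'] by (simp add: hom_def)
  qed
qed (use assms in auto)

lemma ker_kernel: "f \<in> arr C \<Longrightarrow> is_kernel (ker f) f"
  unfolding ker_def by (rule someI_ex) (rule ex_kernel)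

lemma coker_cokernel: "f \<in> arr C \<Longrightarrow> is_cokernel (coker f) f"
  unfolding coker_def by (rule someI_ex) (rule ex_cokernel)

text \<open>Monicity alone makes the definite description unique, so the rule also evaluates lifts
  along composites of kernels, as in \<open>theta\<close> and \<open>sigma\<close>.\<close>

lemma lift_eqI:
  assumes "monic k" "x \<in> arr C" "target C x = source C k" "k \<cdot> x = y"
  shows "lift k y = x"
  unfolding lift_def
proof (rule the_equality)
  have [simp]: "k \<in> arr C" using assms by (simp add: monic_def)
  show "x \<in> hom (source C y) (source C k) \<and> k \<cdot> x = y"
    using assms by (auto simp: hom_def)
  fix z assume "z \<in> hom (source C y) (source C k) \<and> k \<cdot> z = y"
  then show "z = x" using assms monicD[OF assms(1), of z x] by (auto simp: hom_def)
qed

lemma lift_kernel: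
  assumes k: "is_kernel k f" and x: "x \<in> arr C" "target C x = source C f" "f \<cdot> x \<in> null C"
  shows "lift k x \<in> arr C" "source C (lift k x) = source C x" "target C (lift k x) = source C k"
    "k \<cdot> lift k x = x"
proof -
  obtain y where y: "y \<in> arr C" "source C y = source C x" "target C y = source C k" "k \<cdot> y = x"
    using kernel_lift[OF assms] .
  then have "lift k x = y" using kernel_monic[OF k] by (intro lift_eqI)
  then show "lift k x \<in> arr C" "source C (lift k x) = source C x"
    "target C (lift k x) = source C k" "k \<cdot> lift k x = x" using y by auto
qed

text \<open>A null composite with a kernel factors through a null object, and so does the other factor.\<close>

lemma kernel_N_mono:
  assumes k: "is_kernel k f"
  shows "N_mono k"
  unfolding N_mono_def
proof (intro conjI ballI impI)
  note [simp] = kernelD[OF k]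
  show "k \<in> arr C" by simp
  fix x assume [simp]: "x \<in> arr C" and x: "target C x = source C k \<and> k \<cdot> x \<in> null C"
  then have [simp]: "target C x = source C k" by simp
  obtain Z u v where Z: "null_obj Z" "u \<in> hom (source C (k \<cdot> x)) Z" "v \<in> hom Z (target C (k \<cdot> x))"
    and e: "k \<cdot> x = v \<cdot> u"
    using null_closed[OF x[THEN conjunct2]] by (elim exE conjE)
  note [simp] = homD[OF Z(2), simplified] homD[OF Z(3), simplified]
  have idZ: "ident C Z \<in> null C" "Z \<in> obj C" using Z(1) by (auto simp: null_obj_def)
  have n: "v \<in> null C" "u \<in> null C"
    using null_comp_left[OF idZ(1), of v] null_comp_right[OF idZ(1), of u] idZ(2) by simp_all
  have "f \<cdot> v \<in> null C" using n by simp
  then obtain w where [simp]: "w \<in> arr C" "source C w = Z" "target C w = source C k" and w: "k \<cdot> w = v"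
    using kernel_lift[OF k, of v] by auto
  have "k \<cdot> x = k \<cdot> (w \<cdot> u)" using e reassoc[OF w, of u] by simp
  then have "x = w \<cdot> u" by (rule monicD[OF kernel_monic[OF k]]) simp_all
  then show "x \<in> null C" using n by simp
qed

end

section \<open>The opposite category\<close>

text \<open>Because the category is a record, its dual is a record of the same type. A locale lemma
  is dualized by instantiating it here and rewriting back with
  \<open>opposite_simps\<close>.\<close>

definition opposite :: "('o, 'm) nullcat \<Rightarrow> ('o, 'm) nullcat" where
  "opposite C = \<lparr>obj = obj C, arr = arr C, source = target C, target = source C, ident = ident C,
     comp = (\<lambda>x y. comp C y x), null = null C\<rparr>"

lemma opposite_sel [simp]:
  "obj (opposite C) = obj C" "arr (opposite C) = arr C" "source (opposite C) = target C"
  "target (opposite C) = source C" "ident (opposite C) = ident C"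
  "comp (opposite C) x y = comp C y x" "null (opposite C) = null C"
  by (simp_all add: opposite_def)

context nullcat
begin

lemma opposite_hom: "nullcat.hom (opposite C) A B = hom B A"
  by (auto simp: nullcat.hom_def)

lemma opposite_is_iso: "nullcat.is_iso (opposite C) x = is_iso x"
  by (auto simp: nullcat.is_iso_def opposite_hom)

lemma opposite_inv_arr: "nullcat.inv_arr (opposite C) x = inv_arr x"
  unfolding nullcat.inv_arr_def opposite_hom by (rule arg_cong[where f = The]) auto

lemma opposite_null_obj: "nullcat.null_obj (opposite C) Z = null_obj Z"
  by (auto simp: nullcat.null_obj_def)

lemma opposite_is_kernel: "nullcat.is_kernel (opposite C) k f = is_cokernel k f"
  by (simp add: nullcat.is_kernel_def nullcat.is_cokernel_def opposite_hom)

lemma opposite_is_cokernel: "nullcat.is_cokernel (opposite C) q f = is_kernel q f"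
  by (simp add: nullcat.is_kernel_def nullcat.is_cokernel_def opposite_hom)

lemma opposite_N_mono: "nullcat.N_mono (opposite C) f = N_epi f"
  by (simp add: nullcat.N_mono_def nullcat.N_epi_def)

lemma opposite_N_epi: "nullcat.N_epi (opposite C) f = N_mono f"
  by (simp add: nullcat.N_mono_def nullcat.N_epi_def)

lemma opposite_monic: "nullcat.monic (opposite C) f = epic f"
  by (simp add: nullcat.monic_def nullcat.epic_def)

lemma opposite_epic: "nullcat.epic (opposite C) f = monic f"
  by (simp add: nullcat.monic_def nullcat.epic_def)

lemma opposite_normal_mono: "nullcat.normal_mono (opposite C) f = normal_epi f"
  by (simp add: nullcat.normal_mono_def nullcat.normal_epi_def opposite_is_kernel)

lemma opposite_normal_epi: "nullcat.normal_epi (opposite C) f = normal_mono f"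
  by (simp add: nullcat.normal_mono_def nullcat.normal_epi_def opposite_is_cokernel)

lemma opposite_is_pullback: "nullcat.is_pullback (opposite C) i j pq = is_pushout i j pq"
  by (simp add: nullcat.is_pullback_def nullcat.is_pushout_def opposite_hom)

lemma opposite_is_pushout: "nullcat.is_pushout (opposite C) i j pq = is_pullback i j pq"
  by (simp add: nullcat.is_pullback_def nullcat.is_pushout_def opposite_hom)

lemma opposite_ker: "nullcat.ker (opposite C) f = coker f"
  by (simp add: nullcat.ker_def nullcat.coker_def opposite_is_kernel)

lemma opposite_coker: "nullcat.coker (opposite C) f = ker f"
  by (simp add: nullcat.ker_def nullcat.coker_def opposite_is_cokernel)

lemma opposite_pb: "nullcat.pb (opposite C) i j = po i j"
  by (simp add: nullcat.pb_def nullcat.po_def opposite_is_pullback)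

lemma opposite_po: "nullcat.po (opposite C) i j = pb i j"
  by (simp add: nullcat.pb_def nullcat.po_def opposite_is_pushout)

lemma opposite_im: "nullcat.im (opposite C) f = coim f"
  by (simp add: nullcat.im_def nullcat.coim_def opposite_ker opposite_coker)

lemma opposite_coim: "nullcat.coim (opposite C) f = im f"
  by (simp add: nullcat.im_def nullcat.coim_def opposite_ker opposite_coker)

lemma opposite_lift: "nullcat.lift (opposite C) k y = colift k y"
  by (simp add: nullcat.lift_def nullcat.colift_def opposite_hom)

lemma opposite_colift: "nullcat.colift (opposite C) q y = lift q y"
  by (simp add: nullcat.lift_def nullcat.colift_def opposite_hom)

lemma opposite_lhom: "nullcat.lhom (opposite C) x y = rhom y x"
  by (simp add: nullcat.lhom_def nullcat.rhom_def opposite_ker opposite_coker opposite_lift)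

lemma opposite_rhom: "nullcat.rhom (opposite C) x y = lhom y x"
  by (simp add: nullcat.lhom_def nullcat.rhom_def opposite_ker opposite_coker opposite_colift)

lemmas opposite_simps = opposite_sel opposite_hom opposite_is_iso opposite_inv_arr opposite_null_obj
  opposite_is_kernel opposite_is_cokernel opposite_N_mono opposite_N_epi opposite_monic opposite_epic
  opposite_normal_mono opposite_normal_epi opposite_is_pullback opposite_is_pushout
  opposite_ker opposite_coker opposite_pb opposite_po opposite_im opposite_coim opposite_lift
  opposite_colift opposite_lhom opposite_rhom

end

lemma (in category) opposite_category: "category (opposite C)"
proof (unfold_locales, unfold opposite_simps)
  fix x y z A B D E
  assume "x \<in> hom B A" "y \<in> hom D B" "z \<in> hom E D"
  then show "x \<cdot> y \<cdot> z = x \<cdot> (y \<cdot> z)" by (simp add: hom_def)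
qed (simp_all add: ident_hom comp_hom comp_ident_left comp_ident_right)

lemma (in semiexact_category) opposite_semiexact: "semiexact_category (opposite C)"
proof -
  interpret op: category "opposite C" by (rule opposite_category)
  show ?thesis
  proof (unfold_locales, unfold opposite_simps)
    show "null C \<subseteq> arr C" by (rule null_arr)
  next
    fix g f h A B D E
    assume "g \<in> hom B A" "f \<in> hom D B" "h \<in> hom E D" "f \<in> null C"
    then show "g \<cdot> (f \<cdot> h) \<in> null C" by (simp add: hom_def)
  next
    fix f assume "f \<in> null C"
    from null_closed[OF this] 
    show "\<exists>Z u v. null_obj Z \<and> u \<in> hom Z (target C f) \<and> v \<in> hom (source C f) Z \<and> f = u \<cdot> v"
      by blast
  qed (simp_all add: ex_kernel ex_cokernel)
qed

context semiexact_category
begin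

lemmas cokernel_epic = semiexact_category.kernel_monic[OF opposite_semiexact, unfolded opposite_simps]
lemmas cokernelI = semiexact_category.kernelI[OF opposite_semiexact, unfolded opposite_simps]
lemmas colift_eqI = semiexact_category.lift_eqI[OF opposite_semiexact, unfolded opposite_simps]
lemmas colift_cokernel = semiexact_category.lift_kernel[OF opposite_semiexact, unfolded opposite_simps]
lemmas cokernel_N_epi = semiexact_category.kernel_N_mono[OF opposite_semiexact, unfolded opposite_simps]

end

text \<open>The subquotient axiom is self-dual: reversal exchanges the given kernel with the given
  cokernel, preserves the null composite of a cokernel with a kernel, and reads the factorization
  backwards.\<close>

lemma (in homological_category) opposite_homological: "homological_category (opposite C)"
proof -
  interpret op: semiexact_category "opposite C" by (rule opposite_semiexact)
  show ?thesis
  proof (unfold_locales, unfold opposite_simps)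
    fix i f q g
    assume a: "is_cokernel i f" "is_kernel q g" "source C i = target C q" "coker q \<cdot> ker i \<in> null C"
    from subquotient[OF a(2,1) a(3)[symmetric] a(4)]
    obtain H p j f' g' where "p \<in> hom (source C q) H" "j \<in> hom H (target C i)"
      "is_cokernel p f'" "is_kernel j g'" "i \<cdot> q = j \<cdot> p" by (elim exE conjE)
    then show "\<exists>H p j f' g'. p \<in> hom H (target C i) \<and> j \<in> hom (source C q) H \<and>
        is_kernel p f' \<and> is_cokernel j g' \<and> i \<cdot> q = p \<cdot> j"
      by (intro exI conjI)
  qed (use kernel_comp cokernel_comp in metis)+
qed

section \<open>Calculus of kernels and cokernels\<close>

context semiexact_category
begin

lemma monic_comp:
  assumes "monic x" "monic y" "source C y = target C x"
  shows "monic (y \<cdot> x)"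
proof -
  have [simp]: "x \<in> arr C" "y \<in> arr C" "source C y = target C x"
    using assms by (auto simp: monic_def)
  show ?thesis unfolding monic_def
  proof (intro conjI ballI impI)
    fix u v assume [simp]: "u \<in> arr C" "v \<in> arr C"
      and a: "target C u = source C (y \<cdot> x) \<and> target C v = source C (y \<cdot> x) \<and> y \<cdot> x \<cdot> u = y \<cdot> x \<cdot> v"
    then have [simp]: "target C u = source C x" "target C v = source C x" by simp_all
    have "y \<cdot> (x \<cdot> u) = y \<cdot> (x \<cdot> v)" using a by simp
    then have "x \<cdot> u = x \<cdot> v" by (rule monicD[OF assms(2)]) simp_all
    then show "u = v" by (rule monicD[OF assms(1)]) simp_all
  qed simp
qed

lemma monic_cancel:
  assumes "monic (y \<cdot> x)" "x \<in> arr C" "y \<in> arr C" "source C y = target C x"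
  shows "monic x"
  unfolding monic_def
proof (intro conjI ballI impI)
  note [simp] = assms(2-4)
  fix u v assume [simp]: "u \<in> arr C" "v \<in> arr C"
    and a: "target C u = source C x \<and> target C v = source C x \<and> x \<cdot> u = x \<cdot> v"
  then have [simp]: "target C u = source C x" "target C v = source C x" and e: "x \<cdot> u = x \<cdot> v"
    by simp_all
  have "y \<cdot> x \<cdot> u = y \<cdot> x \<cdot> v" using e by simp
  then show "u = v" by (rule monicD[OF assms(1)]) simp_all
qed (rule assms)

text \<open>Kernels depend only on which composites are null, and an N-monomorphism on the left does
  not change that. With its converse below, this moves kernels along embeddings.\<close>

lemma kernel_comp_N_mono:
  assumes k: "is_kernel k f" and m: "N_mono m" "source C m = target C f"
  shows "is_kernel k (m \<cdot> f)"
proof -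
  have [simp]: "m \<in> arr C" "source C m = target C f" using m by (auto simp: N_mono_def)
  note [simp] = kernelD[OF k]
  show ?thesis
  proof (rule kernelI)
    fix x assume [simp]: "x \<in> arr C" and x: "target C x = source C (m \<cdot> f)" "m \<cdot> f \<cdot> x \<in> null C"
    then have [simp]: "target C x = source C f" by simp
    have "f \<cdot> x \<in> null C" by (rule N_monoD[OF m(1)]) (use x in simp_all)
    then show "\<exists>x' \<in> arr C. target C x' = source C k \<and> k \<cdot> x' = x"
      by (intro kernel_ex[OF k]) simp_all
  qed (simp_all add: kernel_monic[OF k])
qed

lemma kernel_N_mono_cancel:
  assumes k: "is_kernel k (m \<cdot> f)" and m: "N_mono m" "source C m = target C f" "f \<in> arr C"
  shows "is_kernel k f"
proof -
  have [simp]: "m \<in> arr C" "source C m = target C f" "f \<in> arr C" using m by (auto simp: N_mono_def)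
  note [simp] = kernelD[OF k, simplified]
  show ?thesis
  proof (rule kernelI)
    show "f \<cdot> k \<in> null C" by (rule N_monoD[OF m(1)]) simp_all
    fix x assume [simp]: "x \<in> arr C" "target C x = source C f" "f \<cdot> x \<in> null C"
    have "m \<cdot> f \<cdot> x \<in> null C" by simp
    then show "\<exists>x' \<in> arr C. target C x' = source C k \<and> k \<cdot> x' = x"
      by (intro kernel_ex[OF k]) simp_all
  qed (simp_all add: kernel_monic[OF k])
qed

text \<open>A subobject of \<open>k\<close> that is normal in the larger object is normal in
  \<open>k\<close> too: whatever \<open>f \<cdot> k\<close> kills becomes, after \<open>k\<close>, a
  morphism through \<open>k \<cdot> x\<close>, and \<open>k\<close> cancels.\<close>

lemma kernel_cancel_left:
  assumes k: "is_kernel (k \<cdot> x) f" and m: "monic k" "x \<in> arr C" "source C k = target C x"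
  shows "is_kernel x (f \<cdot> k)"
proof -
  have [simp]: "k \<in> arr C" "source C k = target C x" "x \<in> arr C" using m by (auto simp: monic_def)
  note [simp] = kernelD[OF k, simplified]
  show ?thesis
  proof (rule kernelI)
    show "monic x" by (rule monic_cancel[OF kernel_monic[OF k]]) simp_all
    fix y assume [simp]: "y \<in> arr C" and y: "target C y = source C (f \<cdot> k)" "f \<cdot> k \<cdot> y \<in> null C"
    then have [simp]: "target C y = target C x" by simp
    have "f \<cdot> (k \<cdot> y) \<in> null C" using y by simp
    with kernel_ex[OF k, of "k \<cdot> y"] obtain z where
      z [simp]: "z \<in> arr C" "target C z = source C x" and e: "k \<cdot> x \<cdot> z = k \<cdot> y" by auto
    have "k \<cdot> (x \<cdot> z) = k \<cdot> y" using e by simp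
    then have "x \<cdot> z = y" by (rule monicD[OF m(1)]) simp_all
    then show "\<exists>x' \<in> arr C. target C x' = source C x \<and> x \<cdot> x' = y"
      by (intro bexI[of _ z]) simp_all
  qed simp_all
qed

lemma kernel_of_cokernel:
  assumes k: "is_kernel k f" and q: "is_cokernel q k"
  shows "is_kernel k q"
proof -
  note [simp] = kernelD[OF k] cokernelD[OF q]
  obtain y where [simp]: "y \<in> arr C" "source C y = target C q" and y: "y \<cdot> q = f"
    using cokernel_colift[OF q, of f] by auto
  show ?thesis
  proof (rule kernelI)
    fix x assume [simp]: "x \<in> arr C" "target C x = source C q" "q \<cdot> x \<in> null C"
    have "f \<cdot> x \<in> null C" unfolding y[symmetric] by simp
    then show "\<exists>x' \<in> arr C. target C x' = source C k \<and> k \<cdot> x' = x"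
      by (intro kernel_ex[OF k]) simp_all
  qed (simp_all add: kernel_monic[OF k])
qed

lemma kernel_compare:
  assumes k: "is_kernel k f" and k': "is_kernel k' f"
  obtains t where "is_iso t" "source C t = source C k'" "target C t = source C k" "k \<cdot> t = k'"
proof -
  note [simp] = kernelD[OF k] kernelD[OF k']
  obtain t where [simp]: "t \<in> arr C" "source C t = source C k'" "target C t = source C k"
    and t: "k \<cdot> t = k'" using kernel_lift[OF k, of k'] by auto
  obtain u where [simp]: "u \<in> arr C" "source C u = source C k" "target C u = source C k'"
    and u: "k' \<cdot> u = k" using kernel_lift[OF k', of k] by auto
  have "k \<cdot> (t \<cdot> u) = k \<cdot> ident C (source C k)" using reassoc[OF t, of u] u by simp
  then have 1: "t \<cdot> u = ident C (source C k)" by (rule monicD[OF kernel_monic[OF k]]) simp_all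
  have "k' \<cdot> (u \<cdot> t) = k' \<cdot> ident C (source C k')" using reassoc[OF u, of t] t by simp
  then have 2: "u \<cdot> t = ident C (source C k')" by (rule monicD[OF kernel_monic[OF k']]) simp_all
  have "is_iso t" by (rule isoI[where y = u]) (simp_all add: 1 2)
  then show thesis using that t by simp
qed

lemma kernel_comp_iso:
  assumes k: "is_kernel k f" and t: "is_iso t" "target C t = source C k"
  shows "is_kernel (k \<cdot> t) f"
proof -
  note [simp] = kernelD[OF k] inv_arr_props[OF t(1)] t(2)
  show ?thesis
  proof (rule kernelI)
    show "monic (k \<cdot> t)" by (rule monic_comp[OF iso_monic[OF t(1)] kernel_monic[OF k]]) simp
    show "f \<cdot> (k \<cdot> t) \<in> null C" by (rule null_reassoc) simp_all
    fix x assume [simp]: "x \<in> arr C" "target C x = source C f" "f \<cdot> x \<in> null C"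
    obtain y where [simp]: "y \<in> arr C" "target C y = source C k" and y: "k \<cdot> y = x"
      using kernel_lift[OF k, of x] by auto
    show "\<exists>x' \<in> arr C. target C x' = source C (k \<cdot> t) \<and> k \<cdot> t \<cdot> x' = x"
      by (rule bexI[of _ "inv_arr t \<cdot> y"]) (simp_all add: inv_arr_cancel[OF t(1)] y)
  qed simp_all
qed

lemma kernel_precomp_iso:
  assumes k: "is_kernel (t \<cdot> k) f" and t: "is_iso t" "k \<in> arr C" "source C t = target C k"
  shows "is_kernel k (f \<cdot> t)"
  by (rule kernel_cancel_left[OF k iso_monic[OF t(1)] t(2,3)])

lemma normal_mono_kernel:
  assumes "normal_mono k" "is_cokernel q k"
  shows "is_kernel k q"
  using assms kernel_of_cokernel by (auto simp: normal_mono_def)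

lemma normal_monoD:
  assumes "normal_mono k"
  shows "k \<in> arr C" "monic k" "N_mono k"
  using assms kernel_monic kernel_N_mono kernelD by (auto simp: normal_mono_def)

lemma normal_mono_cancel_left:
  assumes "normal_mono (k \<cdot> x)" "monic k" "x \<in> arr C" "source C k = target C x"
  shows "normal_mono x"
  using assms kernel_cancel_left unfolding normal_mono_def by blast

lemma im_props:
  assumes "f \<in> arr C"
  shows "is_kernel (im f) (coker f)" "im f \<in> arr C" "target C (im f) = target C f"
  using ker_kernel[of "coker f"] coker_cokernel[OF assms] kernelD cokernelD
  by (auto simp: im_def)

text \<open>Nullity of \<open>s \<cdot> x\<close> means that \<open>x\<close> factors through
  \<open>J\<close>. Hence the preimage of \<open>J\<close> under \<open>P\<close> does not depend on
  which morphism presents \<open>J\<close> as a kernel.\<close>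

lemma kernel_replace:
  assumes J: "is_kernel J s" "is_kernel J s0" and z: "is_kernel z (s \<cdot> P)"
    and P: "P \<in> arr C" "target C P = source C s"
  shows "is_kernel z (s0 \<cdot> P)"
proof -
  have [simp]: "P \<in> arr C" "source C s0 = source C s" using P kernelD[OF J(1)] kernelD[OF J(2)] by auto
  note [simp] = kernelD[OF J(1)] kernelD(1,4)[OF J(2)] P(2)
  have iff: "s \<cdot> x \<in> null C \<longleftrightarrow> s0 \<cdot> x \<in> null C"
    if [simp]: "x \<in> arr C" "target C x = source C s" for x
  proof
    assume "s \<cdot> x \<in> null C"
    with kernel_ex[OF J(1), of x] obtain y where [simp]: "y \<in> arr C" "target C y = source C J"
      and y: "x = J \<cdot> y" by auto
    show "s0 \<cdot> x \<in> null C" unfolding y by (rule null_reassoc) simp_all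
  next
    assume "s0 \<cdot> x \<in> null C"
    with kernel_ex[OF J(2), of x] obtain y where [simp]: "y \<in> arr C" "target C y = source C J"
      and y: "x = J \<cdot> y" by auto
    show "s \<cdot> x \<in> null C" unfolding y by (rule null_reassoc) simp_all
  qed
  note [simp] = kernelD[OF z, simplified]
  show ?thesis
  proof (rule kernelI)
    show "s0 \<cdot> P \<cdot> z \<in> null C" using iff[of "P \<cdot> z"] by simp
    fix x assume [simp]: "x \<in> arr C" and x: "target C x = source C (s0 \<cdot> P)" "s0 \<cdot> P \<cdot> x \<in> null C"
    then have [simp]: "target C x = source C P" by simp
    have "s0 \<cdot> (P \<cdot> x) \<in> null C" using x by simp
    then have "s \<cdot> (P \<cdot> x) \<in> null C" using iff[of "P \<cdot> x"] by simp
    then show "\<exists>x' \<in> arr C. target C x' = source C z \<and> z \<cdot> x' = x"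
      by (intro kernel_ex[OF z]) simp_all
  qed (simp_all add: kernel_monic[OF z])
qed

lemmas epic_comp = semiexact_category.monic_comp[OF opposite_semiexact, unfolded opposite_simps]
lemmas epic_cancel = semiexact_category.monic_cancel[OF opposite_semiexact, unfolded opposite_simps]
lemmas cokernel_ex = nullcat.kernel_ex[where C = "opposite C", unfolded opposite_simps]
lemmas cokernel_comp_N_epi =
  semiexact_category.kernel_comp_N_mono[OF opposite_semiexact, unfolded opposite_simps]
lemmas cokernel_N_epi_cancel =
  semiexact_category.kernel_N_mono_cancel[OF opposite_semiexact, unfolded opposite_simps]
lemmas cokernel_of_kernel =
  semiexact_category.kernel_of_cokernel[OF opposite_semiexact, unfolded opposite_simps]
lemmas cokernel_compare =
  semiexact_category.kernel_compare[OF opposite_semiexact, unfolded opposite_simps]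
lemmas cokernel_comp_iso =
  semiexact_category.kernel_comp_iso[OF opposite_semiexact, unfolded opposite_simps]
lemmas cokernel_precomp_iso =
  semiexact_category.kernel_precomp_iso[OF opposite_semiexact, unfolded opposite_simps]
lemmas normal_epi_cokernel =
  semiexact_category.normal_mono_kernel[OF opposite_semiexact, unfolded opposite_simps]
lemmas normal_epiD = semiexact_category.normal_monoD[OF opposite_semiexact, unfolded opposite_simps]
lemmas coim_props = semiexact_category.im_props[OF opposite_semiexact, unfolded opposite_simps]
lemmas cokernel_replace =
  semiexact_category.kernel_replace[OF opposite_semiexact, unfolded opposite_simps]

lemma normal_monoI: "is_kernel k f \<Longrightarrow> normal_mono k"
  by (auto simp: normal_mono_def)

lemma normal_epiI: "is_cokernel q f \<Longrightarrow> normal_epi q"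
  by (auto simp: normal_epi_def)

lemma bar_eqI:
  assumes f: "f \<in> arr C" and x: "x \<in> arr C" "source C x = target C (coim f)"
    "target C x = source C (im f)" "im f \<cdot> (x \<cdot> coim f) = f"
  shows "bar f = x"
  unfolding bar_def
proof (rule the_equality)
  note [simp] = f x(1-3) im_props(2,3)[OF f] coim_props(2,3)[OF f]
  show "x \<in> hom (target C (coim f)) (source C (im f)) \<and> im f \<cdot> x \<cdot> coim f = f"
    using x by (simp add: hom_def)
  fix y assume "y \<in> hom (target C (coim f)) (source C (im f)) \<and> im f \<cdot> y \<cdot> coim f = f"
  then have [simp]: "y \<in> arr C" "source C y = target C (coim f)" "target C y = source C (im f)"
    and y: "im f \<cdot> y \<cdot> coim f = f" by (auto simp: hom_def)
  have "im f \<cdot> (y \<cdot> coim f) = im f \<cdot> (x \<cdot> coim f)" using y x(4) by simp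
  then have "y \<cdot> coim f = x \<cdot> coim f"
    by (rule monicD[OF kernel_monic[OF im_props(1)[OF f]]]) simp_all
  then show "y = x" by (rule epicD[OF cokernel_epic[OF coim_props(1)[OF f]]]) simp_all
qed

lemma bar_props:
  assumes f: "f \<in> arr C"
  shows "bar f \<in> arr C" "source C (bar f) = target C (coim f)" "target C (bar f) = source C (im f)"
    "im f \<cdot> (bar f \<cdot> coim f) = f"
proof -
  note [simp] = f im_props(2,3)[OF f] coim_props(2,3)[OF f] kernelD[OF ker_kernel[OF f]]
    cokernelD[OF coker_cokernel[OF f]]
  obtain w where [simp]: "w \<in> arr C" "source C w = source C f" "target C w = source C (im f)"
    and w: "im f \<cdot> w = f"
    using kernel_lift[OF im_props(1)[OF f] f] by auto
  \<comment> \<open>As \<open>im f\<close> is an N-monomorphism, \<open>w\<close> kills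
    \<open>ker f\<close> because \<open>f\<close> does, and so descends to
    \<open>Coim f\<close>.\<close>
  have "w \<cdot> ker f \<in> null C"
    by (rule N_monoD[OF kernel_N_mono[OF im_props(1)[OF f]]])
      (simp_all add: reassoc[OF w])
  then obtain x where x: "x \<in> arr C" "source C x = target C (coim f)"
    "target C x = source C (im f)" "x \<cdot> coim f = w"
    using cokernel_colift[OF coim_props(1)[OF f], of w] by auto
  have "bar f = x" by (rule bar_eqI[OF f x(1-3)]) (simp add: x(4) w)
  then show "bar f \<in> arr C" "source C (bar f) = target C (coim f)" "target C (bar f) = source C (im f)"
    "im f \<cdot> (bar f \<cdot> coim f) = f" using x w by simp_all
qed

lemma exact_mor_factor:
  assumes "exact_mor f"
  shows "is_kernel (im f) (coker f)" "is_cokernel (bar f \<cdot> coim f) (ker f)"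
    "source C (im f) = target C (bar f \<cdot> coim f)" "im f \<cdot> (bar f \<cdot> coim f) = f"
proof -
  have f: "f \<in> arr C" and b: "is_iso (bar f)" using assms by (auto simp: exact_mor_def)
  note [simp] = f im_props(2,3)[OF f] coim_props(2,3)[OF f] bar_props[OF f]
  show "is_kernel (im f) (coker f)" using im_props(1)[OF f] .
  show "is_cokernel (bar f \<cdot> coim f) (ker f)"
    by (rule cokernel_comp_iso[OF coim_props(1)[OF f] b]) simp
qed (use assms bar_props coim_props in \<open>auto simp: exact_mor_def\<close>)

text \<open>Since \<open>q\<close> is an N-epimorphism, \<open>coker (j \<cdot> q)\<close> is a
  cokernel of \<open>j\<close>, so \<open>j\<close> agrees with the image up to an isomorphism
  \<open>t\<close>. Dually \<open>q\<close> agrees with the coimage up to \<open>u\<close>, and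
  \<open>bar\<close> is the composite of \<open>t\<close> and \<open>u\<close>.\<close>

lemma exact_mor_comp:
  assumes j: "normal_mono j" and q: "normal_epi q" and c: "source C j = target C q"
  shows "exact_mor (j \<cdot> q)"
proof -
  note [simp] = normal_monoD(1)[OF j] normal_epiD(1)[OF q] c
  let ?f = "j \<cdot> q"
  have f: "?f \<in> arr C" by simp
  note [simp] = im_props(2,3)[OF f] coim_props(2,3)[OF f]
  have "is_cokernel (coker ?f) j"
    by (rule cokernel_N_epi_cancel[OF coker_cokernel[OF f] normal_epiD(3)[OF q]]) simp_all
  then have "is_kernel j (coker ?f)" by (rule normal_mono_kernel[OF j])
  from kernel_compare[OF im_props(1)[OF f] this] obtain t where
    t: "is_iso t" "source C t = source C j" "target C t = source C (im ?f)" "im ?f \<cdot> t = j" .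
  have "is_kernel (ker ?f) q"
    by (rule kernel_N_mono_cancel[OF ker_kernel[OF f] normal_monoD(3)[OF j]]) simp_all
  then have "is_cokernel q (ker ?f)" by (rule normal_epi_cokernel[OF q])
  from cokernel_compare[OF coim_props(1)[OF f] this] obtain u where
    u: "is_iso u" "target C u = target C q" "source C u = target C (coim ?f)" "u \<cdot> coim ?f = q" .
  note [simp] = inv_arr_props(1)[OF t(1)] inv_arr_props(1)[OF u(1)] t(2,3) u(2,3)
  have "im ?f \<cdot> (t \<cdot> u \<cdot> coim ?f) = j \<cdot> q"
    using reassoc[OF t(4), of "u \<cdot> coim ?f"] u(4) by simp
  then have "bar ?f = t \<cdot> u" by (intro bar_eqI[OF f]) simp_all
  then show ?thesis using f iso_comp[OF u(1) t(1)] by (simp add: exact_mor_def)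
qed

lemma exact_morE:
  assumes "exact_mor f"
  obtains j q where "normal_mono j" "normal_epi q" "source C j = target C q" "f = j \<cdot> q"
  using exact_mor_factor[OF assms] by (metis normal_monoI normal_epiI)

end

section \<open>Restriction of cokernels and the comparison of homologies\<close>

context homological_category
begin

lemma normal_mono_comp:
  "\<lbrakk>normal_mono i; normal_mono j; target C i = source C j\<rbrakk> \<Longrightarrow> normal_mono (j \<cdot> i)"
  using kernel_comp unfolding normal_mono_def by blast

lemma normal_epi_comp:
  "\<lbrakk>normal_epi p; normal_epi q; target C p = source C q\<rbrakk> \<Longrightarrow> normal_epi (q \<cdot> p)"
  using cokernel_comp unfolding normal_epi_def by blast

text \<open>As \<open>coker J \<cdot> P\<close> is again a cokernel, it is the cokernel of \<open>z\<close>. Hence the kernel part of the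
  factorization of \<open>P \<cdot> z\<close> provided by the axiom \<open>subquotient\<close> is \<open>J\<close>.\<close>

lemma normal_epi_restrict:
  assumes P: "normal_epi P" and J: "is_kernel J s" and z: "is_kernel z (s \<cdot> P)"
    and c: "target C P = source C s"
  obtains P' where "normal_epi P'" "source C P' = source C z" "target C P' = source C J"
    "J \<cdot> P' = P \<cdot> z"
proof -
  note [simp] = kernelD[OF J] normal_epiD(1)[OF P] c kernelD[OF z, simplified]
  define r where "r = coker J"
  have cJ: "is_cokernel r J" unfolding r_def by (rule coker_cokernel) simp
  note [simp] = cokernelD[OF cJ]
  have Jr: "is_kernel J r" by (rule kernel_of_cokernel[OF J cJ])
  have zr: "is_kernel z (r \<cdot> P)" by (rule kernel_replace[OF J Jr z]) simp_all
  have "normal_epi (r \<cdot> P)" by (rule normal_epi_comp[OF P normal_epiI[OF cJ]]) simp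
  then have rz: "is_cokernel (r \<cdot> P) z" using zr by (rule normal_epi_cokernel)
  note [simp] = kernelD(4)[OF zr, simplified] kernelD(3)[OF zr, simplified]
  obtain t where t: "is_cokernel P t" using P by (auto simp: normal_epi_def)
  have kP: "is_kernel (ker P) P" by (rule ker_kernel) simp
  note [simp] = kernelD[OF kP]
  have cz: "is_cokernel (coker z) z" by (rule coker_cokernel) simp
  note [simp] = cokernelD[OF cz]
  \<comment> \<open>The side condition of \<open>subquotient\<close>: the preimage \<open>z\<close>
    contains \<open>ker P\<close>.\<close>
  have "coker z \<cdot> ker P \<in> null C"
  proof -
    obtain y where [simp]: "y \<in> arr C" "target C y = source C z" and y: "ker P = z \<cdot> y"
      using kernel_ex[OF zr, of "ker P"] by auto
    show ?thesis unfolding y by (rule null_reassoc) simp_all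
  qed
  have "target C z = source C P" by simp
  from subquotient[OF zr t this \<open>coker z \<cdot> ker P \<in> null C\<close>] obtain H p j f' g' where
    H: "p \<in> hom (source C z) H" "j \<in> hom H (target C P)" "is_cokernel p f'" "is_kernel j g'"
    and e: "P \<cdot> z = j \<cdot> p" by (elim exE conjE)
  note [simp] = homD[OF H(1)] homD[OF H(2)]
  define d where "d = coker j"
  have cj: "is_cokernel d j" unfolding d_def by (rule coker_cokernel) simp
  note [simp] = cokernelD[OF cj]
  have jd: "is_kernel j d" by (rule kernel_of_cokernel[OF H(4) cj])
  \<comment> \<open>The image \<open>j\<close> is not smaller than \<open>J\<close>: as
    \<open>d\<close> kills \<open>P \<cdot> z\<close>, the morphism \<open>d \<cdot> P\<close>
    factors through the cokernel \<open>r \<cdot> P\<close> of \<open>z\<close>; cancelling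
    \<open>P\<close> shows that \<open>d\<close> factors through \<open>r\<close>, which kills
    \<open>J\<close>.\<close>
  have "d \<cdot> J \<in> null C"
  proof -
    have "d \<cdot> P \<cdot> z \<in> null C" using null_reassoc[of d j p] by (simp add: e)
    then obtain d' where [simp]: "d' \<in> arr C" "source C d' = target C r" and d': "d' \<cdot> (r \<cdot> P) = d \<cdot> P"
      using cokernel_ex[OF rz, of "d \<cdot> P"] by auto
    have "d' \<cdot> r \<cdot> P = d \<cdot> P" using d' by simp
    then have "d' \<cdot> r = d" by (rule epicD[OF normal_epiD(2)[OF P]]) simp_all
    then show ?thesis by (auto simp flip: \<open>d' \<cdot> r = d\<close>)
  qed
  then obtain y where [simp]: "y \<in> arr C" "target C y = H" and y: "J = j \<cdot> y"
    using kernel_ex[OF jd, of J] by auto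
  have jr: "is_kernel j r"
  proof (rule kernelI)
    have "r \<cdot> j \<cdot> p \<in> null C" using kernelD(4)[OF zr] by (simp add: e)
    then show "r \<cdot> j \<in> null C" by (rule N_epiD[OF cokernel_N_epi[OF H(3)]]) simp_all
    fix x assume [simp]: "x \<in> arr C" "target C x = source C r" "r \<cdot> x \<in> null C"
    obtain w where [simp]: "w \<in> arr C" "target C w = source C J" and w: "J \<cdot> w = x"
      using kernel_ex[OF Jr, of x] by auto
    have [simp]: "source C y = source C J" by (simp add: y)
    show "\<exists>x' \<in> arr C. target C x' = source C j \<and> j \<cdot> x' = x"
      by (rule bexI[of _ "y \<cdot> w"]) (simp_all flip: w add: reassoc[OF y[symmetric], of w])
  qed (simp_all add: kernel_monic[OF H(4)])
  from kernel_compare[OF Jr this] obtain w where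
    w: "is_iso w" "source C w = source C j" "target C w = source C J" "J \<cdot> w = j" .
  note [simp] = inv_arr_props(1)[OF w(1)] w(2,3)
  have "is_cokernel (w \<cdot> p) f'" by (rule cokernel_comp_iso[OF H(3) w(1)]) simp
  then show thesis
    by (intro that[of "w \<cdot> p"]) (simp_all add: normal_epiI reassoc[OF w(4), of p] e)
qed

text \<open>Restricting \<open>n\<close> to the preimage \<open>x\<close> of \<open>j\<close> gives
  a cokernel \<open>P\<close> with \<open>j \<cdot> P = n \<cdot> x\<close>. It remains to recognize
  \<open>P\<close> as a cokernel of \<open>t'\<close>; then \<open>P\<close> and \<open>q\<close>
  differ by an isomorphism.\<close>

lemma homology_iso:
  assumes x: "is_kernel x s" and n: "is_cokernel n t" and st: "s \<cdot> t \<in> null C"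
    and t': "t' \<in> arr C" "target C t' = source C x" "x \<cdot> t' = t"
    and s': "s' \<in> arr C" "source C s' = target C n" "s' \<cdot> n = s"
    and q: "is_cokernel q t'" and j: "is_kernel j s'"
  obtains m where "is_iso m" "source C m = target C q" "target C m = source C j"
    "j \<cdot> (m \<cdot> q) = n \<cdot> x"
proof -
  note [simp] = kernelD[OF x] cokernelD[OF n] t'(1,2) s'(1,2) cokernelD[OF q] kernelD[OF j]
  have [simp]: "source C t' = source C t" using arg_cong[OF t'(3), of "source C"] by simp
  have [simp]: "target C t = source C s" using arg_cong[OF t'(3), of "target C"] by simp
  obtain P where P: "normal_epi P" "source C P = source C x" "target C P = source C j"
    "j \<cdot> P = n \<cdot> x"
    using normal_epi_restrict[OF normal_epiI[OF n] j, of x] x s' by auto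
  note [simp] = normal_epiD(1)[OF P(1)] P(2,3)
  have "is_cokernel P t'"
  proof (rule cokernelI)
    have "j \<cdot> (P \<cdot> t') \<in> null C" using reassoc[OF P(4), of t'] by (simp add: t'(3))
    then show "P \<cdot> t' \<in> null C" by (rule N_monoD[OF kernel_N_mono[OF j]]) simp_all
    fix y assume [simp]: "y \<in> arr C" "source C y = target C t'" and y: "y \<cdot> t' \<in> null C"
    \<comment> \<open>The goal is that \<open>y\<close> kills the kernel \<open>\<kappa>\<close> of
      \<open>P\<close>. The composite \<open>x \<cdot> i\<close> is again a kernel, and its cokernel
      \<open>d\<close> kills \<open>t\<close>, so \<open>d\<close> factors through \<open>n\<close>
      and kills \<open>x \<cdot> \<kappa>\<close>. Thus \<open>\<kappa>\<close> factors through
      \<open>i\<close>, which \<open>y\<close> kills because \<open>y\<close> factors through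
      \<open>q\<close>.\<close>
    define i where "i = ker q"
    have i: "is_kernel i q" unfolding i_def by (rule ker_kernel) simp
    note [simp] = kernelD[OF i]
    have xi: "normal_mono (x \<cdot> i)"
      by (rule normal_mono_comp[OF normal_monoI[OF i] normal_monoI[OF x]]) simp
    define d where "d = coker (x \<cdot> i)"
    have d: "is_cokernel d (x \<cdot> i)" unfolding d_def by (rule coker_cokernel) simp
    note [simp] = cokernelD[OF d, simplified]
    have kd: "is_kernel (x \<cdot> i) d" by (rule normal_mono_kernel[OF xi d])
    obtain t'' where [simp]: "t'' \<in> arr C" "target C t'' = source C i" and t'': "i \<cdot> t'' = t'"
      using kernel_ex[OF i, of t'] by auto
    have "d \<cdot> t \<in> null C"
      using null_comp_right[OF cokernelD(4)[OF d], of t''] by (simp add: t'' t'(3))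
    then obtain d' where [simp]: "d' \<in> arr C" "source C d' = target C n" and d': "d' \<cdot> n = d"
      using cokernel_ex[OF n, of d] by auto
    define \<kappa> where "\<kappa> = ker P"
    have \<kappa>: "is_kernel \<kappa> P" unfolding \<kappa>_def by (rule ker_kernel) simp
    note [simp] = kernelD[OF \<kappa>]
    have "n \<cdot> (x \<cdot> \<kappa>) = j \<cdot> (P \<cdot> \<kappa>)" using reassoc[OF P(4), of \<kappa>] by simp
    then have "d' \<cdot> (n \<cdot> (x \<cdot> \<kappa>)) \<in> null C" by simp
    then have "d \<cdot> (x \<cdot> \<kappa>) \<in> null C" using reassoc[OF d', of "x \<cdot> \<kappa>"] by simp
    then obtain w where [simp]: "w \<in> arr C" "target C w = source C i" and w: "x \<cdot> i \<cdot> w = x \<cdot> \<kappa>"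
      using kernel_ex[OF kd, of "x \<cdot> \<kappa>"] by auto
    have "x \<cdot> (i \<cdot> w) = x \<cdot> \<kappa>" using w by simp
    then have iw: "i \<cdot> w = \<kappa>" by (rule monicD[OF kernel_monic[OF x]]) simp_all
    obtain y' where [simp]: "y' \<in> arr C" "source C y' = target C q" and y': "y' \<cdot> q = y"
      using cokernel_ex[OF q, of y] y by auto
    have "y \<cdot> i \<in> null C" unfolding y'[symmetric] by simp
    then have "y \<cdot> (i \<cdot> w) \<in> null C" by (rule null_reassoc) simp_all
    then have y\<kappa>: "y \<cdot> \<kappa> \<in> null C" by (simp add: iw)
    have "is_cokernel P \<kappa>" by (rule normal_epi_cokernel[OF P(1) \<kappa>])
    from cokernel_ex[OF this, of y] y\<kappa>
    show "\<exists>x' \<in> arr C. source C x' = target C P \<and> x' \<cdot> P = y" by simp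
  qed (simp_all add: normal_epiD(2)[OF P(1)])
  from cokernel_compare[OF this q] obtain u where
    u: "is_iso u" "target C u = target C q" "source C u = target C P" "u \<cdot> P = q" .
  note [simp] = inv_arr_props(1-4)[OF u(1)] u(2,3)
  have "inv_arr u \<cdot> q = P" using inv_arr_cancel(1)[OF u(1), of P] by (simp add: u(4))
  then show thesis
    using that[OF iso_inv_arr[OF u(1)]] P(4) by simp
qed

text \<open>With \<open>f = j \<cdot> p\<close>, the subobject \<open>m \<cdot> \<kappa>\<close> is
  the intersection of \<open>Ker b\<close> with \<open>Im f\<close>, and \<open>w\<close> is its
  preimage under the cokernel \<open>p\<close>. The morphism \<open>r\<close> is the restriction of
  \<open>p\<close>.\<close>

lemma exact_restrict:
  assumes f: "exact_mor f" and q: "is_cokernel q f" and m: "is_kernel m b"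
    and b: "source C b = target C f"
    and w: "is_kernel w (b \<cdot> f)" and k: "k \<in> arr C" "target C k = source C m" "m \<cdot> k = f \<cdot> w"
    and \<kappa>: "is_kernel \<kappa> (q \<cdot> m)"
  obtains r where "normal_epi r" "source C r = source C k" "target C r = source C \<kappa>" "\<kappa> \<cdot> r = k"
proof -
  from f obtain j p where jp: "normal_mono j" "normal_epi p" "source C j = target C p" "f = j \<cdot> p"
    by (rule exact_morE)
  note [simp] = normal_monoD(1)[OF jp(1)] normal_epiD(1)[OF jp(2)] jp(3)
  have [simp]: "f \<in> arr C" "target C f = target C j" "source C f = source C p" by (simp_all add: jp(4))
  note [simp] = cokernelD[OF q] kernelD[OF m] b k(1,2)
  note [simp] = kernelD[OF w, simplified] kernelD[OF \<kappa>, simplified]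
  have [simp]: "source C k = source C w" using arg_cong[OF k(3), of "source C"] by simp
  have "is_cokernel q j"
    by (rule cokernel_N_epi_cancel[OF _ normal_epiD(3)[OF jp(2)]]) (use q jp(4) in simp_all)
  then have j: "is_kernel j q" by (rule normal_mono_kernel[OF jp(1)])
  obtain y where [simp]: "y \<in> arr C" "target C y = source C j" and y: "j \<cdot> y = m \<cdot> \<kappa>"
    using kernel_ex[OF j, of "m \<cdot> \<kappa>"] by auto
  have [simp]: "source C y = source C \<kappa>" using arg_cong[OF y, of "source C"] by simp
  \<comment> \<open>The same intersection, now seen as a subobject of \<open>Im f\<close>.\<close>
  have ky: "is_kernel y (b \<cdot> j)"
  proof (rule kernelI)
    have "monic (j \<cdot> y)" unfolding y by (rule monic_comp[OF kernel_monic[OF \<kappa>] kernel_monic[OF m]]) simp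
    then show "monic y" by (rule monic_cancel) simp_all
    have "b \<cdot> (m \<cdot> \<kappa>) \<in> null C" by (rule null_reassoc) simp_all
    then show "b \<cdot> j \<cdot> y \<in> null C" by (simp add: y)
    fix x assume [simp]: "x \<in> arr C" and x: "target C x = source C (b \<cdot> j)" "b \<cdot> j \<cdot> x \<in> null C"
    then have [simp]: "target C x = target C p" by simp
    obtain x' where [simp]: "x' \<in> arr C" "target C x' = source C m" and x': "m \<cdot> x' = j \<cdot> x"
      using kernel_ex[OF m, of "j \<cdot> x"] x by auto
    have "q \<cdot> (j \<cdot> x) \<in> null C" using kernelD(4)[OF j] by (rule null_reassoc) simp_all
    then obtain x'' where [simp]: "x'' \<in> arr C" "target C x'' = source C \<kappa>" and x'': "\<kappa> \<cdot> x'' = x'"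
      using kernel_ex[OF \<kappa>, of x'] by (auto simp flip: x')
    have "j \<cdot> (y \<cdot> x'') = j \<cdot> x" using reassoc[OF y, of x''] by (simp add: x'' x')
    then have "y \<cdot> x'' = x" by (rule monicD[OF kernel_monic[OF j]]) simp_all
    then show "\<exists>x' \<in> arr C. target C x' = source C y \<and> y \<cdot> x' = x"
      by (intro bexI[of _ x'']) simp_all
  qed simp_all
  have "is_kernel w (b \<cdot> j \<cdot> p)" using w by (simp add: jp(4))
  from normal_epi_restrict[OF jp(2) ky this] obtain r where
    r: "normal_epi r" "source C r = source C w" "target C r = source C y" "y \<cdot> r = p \<cdot> w" by auto
  note [simp] = normal_epiD(1)[OF r(1)] r(2,3)
  have "m \<cdot> (\<kappa> \<cdot> r) = j \<cdot> (y \<cdot> r)" using reassoc[OF y, of r] by simp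
  also have "\<dots> = m \<cdot> k" by (simp add: r(4) k(3) jp(4))
  finally have "\<kappa> \<cdot> r = k" by (rule monicD[OF kernel_monic[OF m]]) simp_all
  then show thesis using that[OF r(1)] by simp
qed

text \<open>The cokernel \<open>c\<close> restricts to a cokernel from \<open>Ker v\<close> onto
  \<open>Ker x\<close>. But \<open>Ker v\<close> is \<open>\<kappa>\<close>, which \<open>c\<close>
  kills, so the inclusion of \<open>Ker x\<close> is null.\<close>

lemma N_mono_induced:
  assumes \<kappa>: "is_kernel \<kappa> v" and c: "is_cokernel c \<kappa>" and x: "x \<in> arr C" "source C x = target C c"
    "x \<cdot> c = v"
  shows "N_mono x"
  unfolding N_mono_def
proof (intro conjI ballI impI)
  note [simp] = kernelD[OF \<kappa>] cokernelD[OF c] x(1,2)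
  have [simp]: "target C v = target C x" using arg_cong[OF x(3), of "target C"] by simp
  show "x \<in> arr C" by simp
  fix u assume [simp]: "u \<in> arr C" and u: "target C u = source C x \<and> x \<cdot> u \<in> null C"
  define z where "z = ker x"
  have z: "is_kernel z x" unfolding z_def by (rule ker_kernel) simp
  note [simp] = kernelD[OF z]
  define z' where "z' = ker v"
  have z': "is_kernel z' v" unfolding z'_def by (rule ker_kernel) simp
  note [simp] = kernelD[OF z']
  from normal_epi_restrict[OF normal_epiI[OF c] z, of z'] z' obtain p where
    p: "normal_epi p" "source C p = source C z'" "target C p = source C z" "z \<cdot> p = c \<cdot> z'"
    by (auto simp: x(3))
  note [simp] = normal_epiD(1)[OF p(1)] p(2,3)
  obtain w where [simp]: "w \<in> arr C" "target C w = source C \<kappa>" and w: "\<kappa> \<cdot> w = z'"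
    using kernel_ex[OF \<kappa>, of z'] by auto
  have "c \<cdot> (\<kappa> \<cdot> w) \<in> null C" by (rule null_reassoc) simp_all
  then have "z \<cdot> p \<in> null C" by (simp add: w p(4))
  then have [simp]: "z \<in> null C" by (rule N_epiD[OF normal_epiD(3)[OF p(1)]]) simp_all
  obtain u' where [simp]: "u' \<in> arr C" "target C u' = source C z" and u': "u = z \<cdot> u'"
    using kernel_ex[OF z, of u] u by auto
  show "u \<in> null C" unfolding u' by simp
qed

end

section \<open>Squares and their Lambek invariants\<close>

text \<open>The half turn puts the new initial corner at the top left. It matches the pullback of
  images with the pushout of coimages, first projection with first coprojection and second with
  second.\<close>

definition opposite_square :: "'m square \<Rightarrow> 'm square" where
  "opposite_square Q = \<lparr>sq_top = sq_bottom Q, sq_left = sq_right Q, sq_right = sq_left Q,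
     sq_bottom = sq_top Q\<rparr>"

lemma opposite_square_sel [simp]:
  "sq_top (opposite_square Q) = sq_bottom Q" "sq_left (opposite_square Q) = sq_right Q"
  "sq_right (opposite_square Q) = sq_left Q" "sq_bottom (opposite_square Q) = sq_top Q"
  by (simp_all add: opposite_square_def)

context nullcat
begin

definition commuting :: "'m square \<Rightarrow> bool" where
  "commuting Q \<longleftrightarrow> sq_top Q \<in> arr C \<and> sq_left Q \<in> arr C \<and> sq_right Q \<in> arr C \<and> sq_bottom Q \<in> arr C \<and>
     source C (sq_top Q) = source C (sq_left Q) \<and> target C (sq_top Q) = source C (sq_right Q) \<and>
     source C (sq_bottom Q) = target C (sq_left Q) \<and> target C (sq_bottom Q) = target C (sq_right Q) \<and>
     sq_right Q \<cdot> sq_top Q = sq_bottom Q \<cdot> sq_left Q"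

lemma commutingD:
  assumes "commuting Q"
  shows "sq_top Q \<in> arr C" "sq_left Q \<in> arr C" "sq_right Q \<in> arr C" "sq_bottom Q \<in> arr C"
    "source C (sq_top Q) = source C (sq_left Q)" "target C (sq_top Q) = source C (sq_right Q)"
    "source C (sq_bottom Q) = target C (sq_left Q)" "target C (sq_bottom Q) = target C (sq_right Q)"
    "sq_right Q \<cdot> sq_top Q = sq_bottom Q \<cdot> sq_left Q"
  using assms by (auto simp: commuting_def)

lemma opposite_commuting: "nullcat.commuting (opposite C) (opposite_square Q) = commuting Q"
  by (auto simp: nullcat.commuting_def)

lemma pullbackD:
  assumes "is_pullback i j (p, q)"
  shows "p \<in> arr C" "q \<in> arr C" "source C q = source C p" "target C p = source C i"
    "target C q = source C j" "i \<cdot> p = j \<cdot> q"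
  using assms by (auto simp: is_pullback_def)

lemma pullback_ex:
  assumes "is_pullback i j (p, q)" "x \<in> arr C" "y \<in> arr C" "source C x = source C y"
    "target C x = source C i" "target C y = source C j" "i \<cdot> x = j \<cdot> y"
  obtains z where "z \<in> arr C" "source C z = source C x" "target C z = source C p"
    "p \<cdot> z = x" "q \<cdot> z = y"
proof -
  from assms have "\<exists>!z. z \<in> hom (source C x) (source C p) \<and> p \<cdot> z = x \<and> q \<cdot> z = y"
    unfolding is_pullback_def prod.case by blast
  then obtain z where z: "z \<in> hom (source C x) (source C p)" "p \<cdot> z = x" "q \<cdot> z = y"
    by (elim ex1E conjE)
  show thesis by (rule that[OF homD[OF z(1)] z(2,3)])
qed

lemma pullback_unique:
  assumes "is_pullback i j (p, q)" "x \<in> arr C" "y \<in> arr C" "source C x = source C y"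
    "target C x = source C i" "target C y = source C j" "i \<cdot> x = j \<cdot> y"
    "z \<in> hom (source C x) (source C p)" "p \<cdot> z = x" "q \<cdot> z = y"
    "z' \<in> hom (source C x) (source C p)" "p \<cdot> z' = x" "q \<cdot> z' = y"
  shows "z = z'"
proof -
  from assms(1-7) have "\<exists>!z. z \<in> hom (source C x) (source C p) \<and> p \<cdot> z = x \<and> q \<cdot> z = y"
    unfolding is_pullback_def prod.case by blast
  then show ?thesis using assms(8-) by blast
qed

end

context semiexact_category
begin

text \<open>The preimage of \<open>j\<close> under \<open>i\<close> is the kernel of
  \<open>coker j \<cdot> i\<close>. Existence has to be shown because \<open>pb\<close> is a choice
  and means nothing without it.\<close>

lemma normal_pullback_ex:
  assumes i: "normal_mono i" and j: "normal_mono j" and c: "target C i = target C j"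
  shows "\<exists>pq. is_pullback i j pq"
proof -
  note [simp] = normal_monoD(1)[OF i] normal_monoD(1)[OF j] c
  define d where "d = coker j"
  have cd: "is_cokernel d j" unfolding d_def by (rule coker_cokernel) simp
  note [simp] = cokernelD[OF cd]
  have jd: "is_kernel j d" by (rule normal_mono_kernel[OF j cd])
  define p where "p = ker (d \<cdot> i)"
  have p: "is_kernel p (d \<cdot> i)" unfolding p_def by (rule ker_kernel) simp
  note [simp] = kernelD[OF p, simplified]
  obtain q where [simp]: "q \<in> arr C" "target C q = source C j" and q: "j \<cdot> q = i \<cdot> p"
    using kernel_ex[OF jd, of "i \<cdot> p"] by auto
  have [simp]: "source C q = source C p" using arg_cong[OF q, of "source C"] by simp
  have "is_pullback i j (p, q)"
    unfolding is_pullback_def prod.case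
  proof (intro conjI ballI impI)
    fix x y assume [simp]: "x \<in> arr C" "y \<in> arr C"
      and a: "source C x = source C y \<and> target C x = source C i \<and> target C y = source C j \<and> i \<cdot> x = j \<cdot> y"
    then have [simp]: "source C x = source C y" "target C x = source C i" "target C y = source C j"
      and e: "i \<cdot> x = j \<cdot> y" by auto
    have "d \<cdot> (i \<cdot> x) \<in> null C" unfolding e by (rule null_reassoc) simp_all
    then obtain z where [simp]: "z \<in> arr C" "target C z = source C p" and z: "p \<cdot> z = x"
      using kernel_ex[OF p, of x] by auto
    have [simp]: "source C z = source C y" using arg_cong[OF z, of "source C"] by simp
    have "j \<cdot> (q \<cdot> z) = j \<cdot> y" using reassoc[OF q, of z] by (simp add: z e)
    then have qz: "q \<cdot> z = y" by (rule monicD[OF normal_monoD(2)[OF j]]) simp_all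
    show "\<exists>!z. z \<in> hom (source C x) (source C p) \<and> p \<cdot> z = x \<and> q \<cdot> z = y"
    proof (rule ex1I[of _ z])
      fix w assume "w \<in> hom (source C x) (source C p) \<and> p \<cdot> w = x \<and> q \<cdot> w = y"
      then show "w = z" by - (rule monicD[OF kernel_monic[OF p]], use z in \<open>simp_all add: hom_def\<close>)
    qed (simp add: hom_def z qz)
  qed (simp_all add: q)
  then show ?thesis by blast
qed

lemma pullback_kernel:
  assumes pb: "is_pullback i j (p, q)" and j: "is_kernel j d" and i: "i \<in> arr C" "target C i = source C d"
  shows "is_kernel p (d \<cdot> i)"
proof -
  note [simp] = pullbackD(1-5)[OF pb] kernelD[OF j] i
  note e = pullbackD(6)[OF pb]
  show ?thesis
  proof (rule kernelI)
    have "d \<cdot> (i \<cdot> p) \<in> null C" unfolding e by (rule null_reassoc) simp_all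
    then show "d \<cdot> i \<cdot> p \<in> null C" by simp
    fix x assume [simp]: "x \<in> arr C" and x: "target C x = source C (d \<cdot> i)" "d \<cdot> i \<cdot> x \<in> null C"
    then have [simp]: "target C x = source C i" by simp
    obtain y where [simp]: "y \<in> arr C" "source C y = source C x" "target C y = source C j"
      and y: "j \<cdot> y = i \<cdot> x" using kernel_lift[OF j, of "i \<cdot> x"] x by auto
    from pullback_ex[OF pb, of x y] obtain z where "z \<in> arr C" "target C z = source C p" "p \<cdot> z = x"
      by (auto simp: y)
    then show "\<exists>x' \<in> arr C. target C x' = source C p \<and> p \<cdot> x' = x" by auto
  next
    show "monic p" unfolding monic_def
    proof (intro conjI ballI impI)
      fix x y assume [simp]: "x \<in> arr C" "y \<in> arr C"
        and a: "target C x = source C p \<and> target C y = source C p \<and> p \<cdot> x = p \<cdot> y"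
      then have [simp]: "target C x = source C p" "target C y = source C p" and xy: "p \<cdot> x = p \<cdot> y"
        by auto
      have [simp]: "source C x = source C y" using arg_cong[OF xy, of "source C"] by simp
      \<comment> \<open>The first components determine the second ones because \<open>j\<close> is
        monic, and uniqueness in the pullback then applies.\<close>
      have "j \<cdot> (q \<cdot> x) = j \<cdot> (q \<cdot> y)"
        using reassoc[OF e, of x] reassoc[OF e, of y] by (simp add: xy)
      then have q: "q \<cdot> x = q \<cdot> y" by (rule monicD[OF kernel_monic[OF j]]) simp_all
      show "x = y"
        by (rule pullback_unique[OF pb, of "p \<cdot> y" "q \<cdot> y"])
          (simp_all add: hom_def xy q reassoc[OF e, of y])
    qed simp
  qed simp_all
qed

lemma pullback_swap: "is_pullback i j (p, q) \<Longrightarrow> is_pullback j i (q, p)"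
  unfolding is_pullback_def prod.case by (metis (no_types, lifting))

text \<open>The dual definition brackets the threefold composite the other way. The typing of
  \<open>im f\<close> and \<open>coim f\<close>, which needs \<open>f\<close> to be an arrow, makes
  the two bracketings agree.\<close>

lemma opposite_bar: "f \<in> arr C \<Longrightarrow> nullcat.bar (opposite C) f = bar f"
  unfolding nullcat.bar_def opposite_simps
  by (rule arg_cong[where f = The])
    (auto simp: fun_eq_iff hom_def im_props coim_props)

lemma opposite_exact_mor: "nullcat.exact_mor (opposite C) f = exact_mor f"
  by (auto simp: nullcat.exact_mor_def opposite_simps opposite_bar)

lemma lproj_pullback:
  assumes "commuting Q"
  shows "is_pullback (im (sq_right Q)) (im (sq_bottom Q)) (lproj Q, lproj_v Q)"
proof -
  note [simp] = commutingD[OF assms]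
  have "\<exists>pq. is_pullback (im (sq_right Q)) (im (sq_bottom Q)) pq"
    by (rule normal_pullback_ex) (auto intro!: normal_monoI im_props(1) simp: im_props)
  then have "is_pullback (im (sq_right Q)) (im (sq_bottom Q)) (pb (im (sq_right Q)) (im (sq_bottom Q)))"
    unfolding pb_def by (rule someI_ex)
  then show ?thesis by (simp add: lproj_def lproj_v_def)
qed

lemma lproj_props:
  assumes Q: "commuting Q"
  shows "is_kernel (lproj Q) (coker (sq_bottom Q) \<cdot> im (sq_right Q))"
    "is_kernel (lproj_v Q) (coker (sq_right Q) \<cdot> im (sq_bottom Q))"
    "lproj Q \<in> arr C" "lproj_v Q \<in> arr C" "source C (lproj_v Q) = source C (lproj Q)"
    "target C (lproj Q) = source C (im (sq_right Q))" "target C (lproj_v Q) = source C (im (sq_bottom Q))"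
    "im (sq_right Q) \<cdot> lproj Q = im (sq_bottom Q) \<cdot> lproj_v Q"
proof -
  note [simp] = commutingD[OF Q]
  note pb = lproj_pullback[OF Q]
  note r = im_props[of "sq_right Q", simplified] and b = im_props[of "sq_bottom Q", simplified]
  note [simp] = cokernelD[OF coker_cokernel]
  show "is_kernel (lproj Q) (coker (sq_bottom Q) \<cdot> im (sq_right Q))"
    by (rule pullback_kernel[OF pb b(1)]) (simp_all add: r b)
  show "is_kernel (lproj_v Q) (coker (sq_right Q) \<cdot> im (sq_bottom Q))"
    by (rule pullback_kernel[OF pullback_swap[OF pb] r(1)]) (simp_all add: r b)
qed (use pullbackD[OF lproj_pullback[OF Q]] in simp_all)

lemma lam_props:
  assumes Q: "commuting Q"
  shows "lam Q \<in> arr C" "source C (lam Q) = source C (sq_top Q)" "target C (lam Q) = source C (lproj Q)"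
    "lproj Q \<cdot> lam Q = bar (sq_right Q) \<cdot> (coim (sq_right Q) \<cdot> sq_top Q)"
    "lproj_v Q \<cdot> lam Q = bar (sq_bottom Q) \<cdot> (coim (sq_bottom Q) \<cdot> sq_left Q)"
proof -
  note [simp] = commutingD[OF Q]
  note [simp] = im_props(2,3)[of "sq_right Q"] coim_props(2,3)[of "sq_right Q"]
    bar_props(1-3)[of "sq_right Q"] im_props(2,3)[of "sq_bottom Q"] coim_props(2,3)[of "sq_bottom Q"]
    bar_props(1-3)[of "sq_bottom Q"] lproj_props(3-7)[OF Q]
  let ?x = "bar (sq_right Q) \<cdot> (coim (sq_right Q) \<cdot> sq_top Q)"
  let ?y = "bar (sq_bottom Q) \<cdot> (coim (sq_bottom Q) \<cdot> sq_left Q)"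
  have e: "im (sq_right Q) \<cdot> ?x = im (sq_bottom Q) \<cdot> ?y"
    using reassoc[OF bar_props(4)[of "sq_right Q"], of "sq_top Q"]
      reassoc[OF bar_props(4)[of "sq_bottom Q"], of "sq_left Q"] by simp
  obtain z where z: "z \<in> arr C" "source C z = source C ?x" "target C z = source C (lproj Q)"
    "lproj Q \<cdot> z = ?x" "lproj_v Q \<cdot> z = ?y"
    by (rule pullback_ex[OF lproj_pullback[OF Q] _ _ _ _ _ e]) simp_all
  have "lam Q = z" unfolding lam_def
  proof (rule the_equality)
    show "z \<in> hom (source C (sq_top Q)) (source C (lproj Q)) \<and>
      lproj Q \<cdot> z = bar (sq_right Q) \<cdot> coim (sq_right Q) \<cdot> sq_top Q \<and>
      lproj_v Q \<cdot> z = bar (sq_bottom Q) \<cdot> coim (sq_bottom Q) \<cdot> sq_left Q"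
      using z by (simp add: hom_def)
    fix w assume "w \<in> hom (source C (sq_top Q)) (source C (lproj Q)) \<and>
      lproj Q \<cdot> w = bar (sq_right Q) \<cdot> coim (sq_right Q) \<cdot> sq_top Q \<and>
      lproj_v Q \<cdot> w = bar (sq_bottom Q) \<cdot> coim (sq_bottom Q) \<cdot> sq_left Q"
    then show "w = z"
      by - (rule monicD[OF kernel_monic[OF lproj_props(1)[OF Q]]], use z in \<open>simp_all add: hom_def\<close>)
  qed
  then show "lam Q \<in> arr C" "source C (lam Q) = source C (sq_top Q)"
    "target C (lam Q) = source C (lproj Q)" "lproj Q \<cdot> lam Q = ?x" "lproj_v Q \<cdot> lam Q = ?y"
    using z by simp_all
qed

end

context nullcat
begin

lemma opposite_lproj: "nullcat.lproj (opposite C) (opposite_square Q) = rinj Q"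
  by (simp add: nullcat.lproj_def nullcat.rinj_def opposite_simps)

lemma opposite_lproj_v: "nullcat.lproj_v (opposite C) (opposite_square Q) = rinj_v Q"
  by (simp add: nullcat.lproj_v_def nullcat.rinj_v_def opposite_simps)

lemma opposite_rinj: "nullcat.rinj (opposite C) (opposite_square Q) = lproj Q"
  by (simp add: nullcat.lproj_def nullcat.rinj_def opposite_simps)

lemma opposite_rinj_v: "nullcat.rinj_v (opposite C) (opposite_square Q) = lproj_v Q"
  by (simp add: nullcat.lproj_v_def nullcat.rinj_v_def opposite_simps)

end

context semiexact_category
begin

lemma rinj_props:
  assumes Q: "commuting Q"
  shows "is_cokernel (rinj Q) (coim (sq_left Q) \<cdot> ker (sq_top Q))"
    "is_cokernel (rinj_v Q) (coim (sq_top Q) \<cdot> ker (sq_left Q))"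
    "rinj Q \<in> arr C" "rinj_v Q \<in> arr C" "target C (rinj_v Q) = target C (rinj Q)"
    "source C (rinj Q) = target C (coim (sq_left Q))" "source C (rinj_v Q) = target C (coim (sq_top Q))"
    "rinj Q \<cdot> coim (sq_left Q) = rinj_v Q \<cdot> coim (sq_top Q)"
  using semiexact_category.lproj_props[OF opposite_semiexact, of "opposite_square Q"] Q
  by (simp_all add: opposite_simps opposite_commuting opposite_lproj opposite_lproj_v)

lemma opposite_lam:
  assumes Q: "commuting Q"
  shows "nullcat.lam (opposite C) (opposite_square Q) = rho Q"
proof -
  note [simp] = commutingD[OF Q] im_props(2,3) bar_props(1-3) opposite_bar
  show ?thesis
    unfolding nullcat.lam_def rho_def opposite_lproj opposite_lproj_v opposite_simps opposite_square_sel
    by (simp only: opposite_bar assoc im_props(2,3) bar_props(1-3) commutingD[OF Q])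
qed

lemma rho_props:
  assumes Q: "commuting Q"
  shows "rho Q \<in> arr C" "target C (rho Q) = target C (sq_bottom Q)" "source C (rho Q) = target C (rinj Q)"
    "rho Q \<cdot> rinj Q = sq_bottom Q \<cdot> (im (sq_left Q) \<cdot> bar (sq_left Q))"
    "rho Q \<cdot> rinj_v Q = sq_right Q \<cdot> (im (sq_top Q) \<cdot> bar (sq_top Q))"
  using semiexact_category.lam_props[OF opposite_semiexact, of "opposite_square Q"] Q
  by (simp_all add: opposite_simps opposite_commuting opposite_lproj opposite_lproj_v opposite_lam
      opposite_bar commutingD[OF Q] im_props(2,3) bar_props(1-3))

lemma opposite_rho:
  assumes Q: "commuting Q"
  shows "nullcat.rho (opposite C) (opposite_square Q) = lam Q"
proof -
  note [simp] = commutingD[OF Q]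
  show ?thesis
    unfolding nullcat.rho_def lam_def opposite_rinj opposite_rinj_v opposite_simps opposite_square_sel
    by (simp only: opposite_bar assoc coim_props(2,3) bar_props(1-3) commutingD[OF Q])
qed

text \<open>The common shape of the Lambek morphisms and of the comparison of the two homologies.\<close>

lemma the_middle_eqI:
  assumes "monic j" "epic q" "m \<in> arr C" "source C m = target C q" "target C m = source C j"
    "j \<cdot> (m \<cdot> q) = y"
  shows "(THE x. x \<in> hom (target C q) (source C j) \<and> j \<cdot> x \<cdot> q = y) = m"
proof (rule the_equality)
  have [simp]: "j \<in> arr C" "q \<in> arr C" using assms by (auto simp: monic_def epic_def)
  note [simp] = assms(3-5)
  show "m \<in> hom (target C q) (source C j) \<and> j \<cdot> m \<cdot> q = y" using assms(6) by (simp add: hom_def)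
  fix x assume "x \<in> hom (target C q) (source C j) \<and> j \<cdot> x \<cdot> q = y"
  then have [simp]: "x \<in> arr C" "source C x = target C q" "target C x = source C j"
    and x: "j \<cdot> (x \<cdot> q) = y" by (auto simp: hom_def)
  have "x \<cdot> q = m \<cdot> q" by (rule monicD[OF assms(1)]) (simp_all add: x assms(6))
  then show "x = m" by (rule epicD[OF assms(2)]) simp_all
qed

text \<open>As \<open>s\<close> kills \<open>y\<close>, it factors through \<open>j\<close>; this
  factor kills \<open>t\<close> because \<open>j\<close> is an N-monomorphism, and so it descends
  along \<open>q\<close>.\<close>

lemma the_middle_props:
  assumes q: "is_cokernel q t" and j: "is_kernel j s"
    and y: "y \<in> arr C" "source C y = target C t" "target C y = source C s" "y \<cdot> t \<in> null C" "s \<cdot> y \<in> null C"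
    and m: "m = (THE x. x \<in> hom (target C q) (source C j) \<and> j \<cdot> x \<cdot> q = y)"
  shows "m \<in> arr C" "source C m = target C q" "target C m = source C j" "j \<cdot> (m \<cdot> q) = y"
proof -
  note [simp] = cokernelD[OF q] kernelD[OF j] y
  obtain w where [simp]: "w \<in> arr C" "source C w = source C y" "target C w = source C j"
    and w: "j \<cdot> w = y" using kernel_lift[OF j, of y] by auto
  have "j \<cdot> (w \<cdot> t) \<in> null C" using reassoc[OF w, of t] by simp
  then have "w \<cdot> t \<in> null C" by (rule N_monoD[OF kernel_N_mono[OF j]]) simp_all
  then obtain x where x: "x \<in> arr C" "source C x = target C q" "target C x = target C w" "x \<cdot> q = w"
    using cokernel_colift[OF q, of w] by auto
  have "m = x" unfolding m
    by (rule the_middle_eqI[OF kernel_monic[OF j] cokernel_epic[OF q] x(1,2)]) (simp_all add: x w)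
  then show "m \<in> arr C" "source C m = target C q" "target C m = source C j" "j \<cdot> (m \<cdot> q) = y"
    using x w by simp_all
qed

section \<open>Lambek morphisms under duality\<close>

lemma opposite_ImS: "commuting Q \<Longrightarrow> nullcat.ImS (opposite C) (opposite_square Q) = KerS Q"
  by (simp add: nullcat.ImS_def KerS_def opposite_simps opposite_lam)

lemma opposite_KerS: "commuting Q \<Longrightarrow> nullcat.KerS (opposite C) (opposite_square Q) = ImS Q"
  by (simp add: nullcat.KerS_def ImS_def opposite_simps opposite_rho)

text \<open>The defining equation is self-dual up to bracketing. Exactness of the common side makes
  \<open>inv_arr (bar (sq_right P))\<close> an actual arrow, as reassociation requires.\<close>

lemma opposite_Lambek:
  assumes P: "commuting P" and Q: "commuting Q" and c: "sq_left Q = sq_right P" "exact_mor (sq_right P)"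
  shows "nullcat.Lambek (opposite C) (opposite_square Q) (opposite_square P) = Lambek P Q"
proof -
  have i: "is_iso (bar (sq_right P))" using c(2) by (simp add: exact_mor_def)
  note [simp] = commutingD[OF P] im_props(2,3) coim_props(2,3) bar_props(1-3) inv_arr_props[OF i]
    lam_props(1-3)[OF P] rho_props(1-3)[OF Q] rinj_props(3,6)[OF Q] lproj_props(3,6)[OF P]
    cokernelD[OF coker_cokernel] kernelD[OF ker_kernel]
  have *: "ker (rho Q) \<cdot> x \<cdot> coker (lam P) = ker (rho Q) \<cdot> (x \<cdot> coker (lam P))"
    if "x \<in> hom (ImS P) (KerS Q)" for x
    using that by (simp add: hom_def ImS_def KerS_def)
  have **: "rinj Q \<cdot> inv_arr (bar (sq_right P)) \<cdot> lproj P = rinj Q \<cdot> (inv_arr (bar (sq_right P)) \<cdot> lproj P)"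
    by (simp add: c(1))
  show ?thesis
    unfolding nullcat.Lambek_def opposite_simps opposite_lam[OF Q] opposite_rho[OF P]
      opposite_ImS[OF Q] opposite_KerS[OF P] opposite_rinj opposite_lproj opposite_square_sel **
    by (rule arg_cong[where f = The]) (auto simp: fun_eq_iff * c(1) opposite_bar)
qed

lemma opposite_Lambek_v:
  assumes P: "commuting P" and Q: "commuting Q" and c: "sq_top Q = sq_bottom P" "exact_mor (sq_bottom P)"
  shows "nullcat.Lambek_v (opposite C) (opposite_square Q) (opposite_square P) = Lambek_v P Q"
proof -
  have i: "is_iso (bar (sq_bottom P))" using c(2) by (simp add: exact_mor_def)
  note [simp] = commutingD[OF P] im_props(2,3) coim_props(2,3) bar_props(1-3) inv_arr_props[OF i]
    lam_props(1-3)[OF P] rho_props(1-3)[OF Q] rinj_props(4,7)[OF Q] lproj_props(4,7)[OF P]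
    cokernelD[OF coker_cokernel] kernelD[OF ker_kernel]
  have *: "ker (rho Q) \<cdot> x \<cdot> coker (lam P) = ker (rho Q) \<cdot> (x \<cdot> coker (lam P))"
    if "x \<in> hom (ImS P) (KerS Q)" for x
    using that by (simp add: hom_def ImS_def KerS_def)
  have **: "rinj_v Q \<cdot> inv_arr (bar (sq_bottom P)) \<cdot> lproj_v P
      = rinj_v Q \<cdot> (inv_arr (bar (sq_bottom P)) \<cdot> lproj_v P)"
    by (simp add: c(1))
  show ?thesis
    unfolding nullcat.Lambek_v_def opposite_simps opposite_lam[OF Q] opposite_rho[OF P]
      opposite_ImS[OF Q] opposite_KerS[OF P] opposite_rinj_v opposite_lproj_v opposite_square_sel **
    by (rule arg_cong[where f = The]) (auto simp: fun_eq_iff * c(1) opposite_bar)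
qed

section \<open>Cancellation rules and changes of presentation\<close>

lemma ker_typing [simp]:
  assumes "x \<in> arr C"
  shows "ker x \<in> arr C" "target C (ker x) = source C x" "x \<cdot> ker x \<in> null C"
  using kernelD[OF ker_kernel[OF assms]] by auto

lemma coker_typing [simp]:
  assumes "x \<in> arr C"
  shows "coker x \<in> arr C" "source C (coker x) = target C x" "coker x \<cdot> x \<in> null C"
  using cokernelD[OF coker_cokernel[OF assms]] by auto

declare im_props(2,3) [simp] coim_props(2,3) [simp] bar_props(1-3) [simp]

lemma ker_cancel_null: "\<lbrakk>ker y \<cdot> x \<in> null C; y \<in> arr C; x \<in> arr C; target C x = source C (ker y)\<rbrakk>
    \<Longrightarrow> x \<in> null C"
  by (rule N_monoD[OF kernel_N_mono[OF ker_kernel]]) simp_all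

lemma ker_cancel: "\<lbrakk>ker y \<cdot> x = ker y \<cdot> x'; y \<in> arr C; x \<in> arr C; x' \<in> arr C;
    target C x = source C (ker y); target C x' = source C (ker y)\<rbrakk> \<Longrightarrow> x = x'"
  by (rule monicD[OF kernel_monic[OF ker_kernel]]) simp_all

lemma coker_cancel_null: "\<lbrakk>x \<cdot> coker y \<in> null C; y \<in> arr C; x \<in> arr C; source C x = target C (coker y)\<rbrakk>
    \<Longrightarrow> x \<in> null C"
  by (rule N_epiD[OF cokernel_N_epi[OF coker_cokernel]]) simp_all

lemma coker_cancel: "\<lbrakk>x \<cdot> coker y = x' \<cdot> coker y; y \<in> arr C; x \<in> arr C; x' \<in> arr C;
    source C x = target C (coker y); source C x' = target C (coker y)\<rbrakk> \<Longrightarrow> x = x'"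
  by (rule epicD[OF cokernel_epic[OF coker_cokernel]]) simp_all

lemma lift_ker:
  assumes "y \<in> arr C" "x \<in> arr C" "target C x = source C y" "y \<cdot> x \<in> null C"
  shows "lift (ker y) x \<in> arr C" "source C (lift (ker y) x) = source C x"
    "target C (lift (ker y) x) = source C (ker y)" "ker y \<cdot> lift (ker y) x = x"
  using lift_kernel[OF ker_kernel[OF assms(1)] assms(2-4)] by auto

lemma colift_coker:
  assumes "y \<in> arr C" "x \<in> arr C" "source C x = target C y" "x \<cdot> y \<in> null C"
  shows "colift (coker y) x \<in> arr C" "source C (colift (coker y) x) = target C (coker y)"
    "target C (colift (coker y) x) = target C x" "colift (coker y) x \<cdot> coker y = x"
  using colift_cokernel[OF coker_cokernel[OF assms(1)] assms(2-4)] by auto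

text \<open>The source of the canonical isomorphism \<open>theta\<close>: two subobjects that factor
  through each other. The dual gives \<open>theta'\<close>.\<close>

lemma monic_factor_iso:
  assumes m: "monic m" "monic m'" and x: "x \<in> arr C" "target C x = source C m" "m \<cdot> x = m'"
    and y: "y \<in> arr C" "target C y = source C m'" "m' \<cdot> y = m"
  shows "is_iso x"
proof -
  have [simp]: "m \<in> arr C" "m' \<in> arr C" using m by (auto simp: monic_def)
  note [simp] = x(1,2) y(1,2)
  have [simp]: "source C x = source C m'" using arg_cong[OF x(3), of "source C"] by simp
  have [simp]: "source C y = source C m" using arg_cong[OF y(3), of "source C"] by simp
  show ?thesis
  proof (rule isoI)
    show "y \<cdot> x = ident C (source C x)"
      by (rule monicD[OF m(2)]) (simp_all add: reassoc[OF y(3), of x] x(3))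
    show "x \<cdot> y = ident C (target C x)"
      by (rule monicD[OF m(1)]) (simp_all add: reassoc[OF x(3), of y] y(3))
  qed simp_all
qed

lemmas epic_factor_iso =
  semiexact_category.monic_factor_iso[OF opposite_semiexact, unfolded opposite_simps]

lemma iso_N_mono:
  assumes t: "is_iso t" shows "N_mono t"
  unfolding N_mono_def
proof (intro conjI ballI impI)
  note [simp] = inv_arr_props[OF t]
  fix x assume [simp]: "x \<in> arr C" and x: "target C x = source C t \<and> t \<cdot> x \<in> null C"
  have "inv_arr t \<cdot> (t \<cdot> x) \<in> null C" by (rule null_comp_left) (use x in simp_all)
  then show "x \<in> null C" using x by (simp add: inv_arr_cancel[OF t])
qed (rule inv_arr_props[OF t])

lemmas iso_N_epi = semiexact_category.iso_N_mono[OF opposite_semiexact, unfolded opposite_simps]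

lemma N_mono_comp:
  assumes x: "N_mono x" and y: "N_mono y" and c: "source C y = target C x"
  shows "N_mono (y \<cdot> x)"
  unfolding N_mono_def
proof (intro conjI ballI impI)
  have [simp]: "x \<in> arr C" "y \<in> arr C" using x y unfolding N_mono_def by blast+
  note [simp] = c
  show "y \<cdot> x \<in> arr C" by simp
  fix z assume [simp]: "z \<in> arr C" and z: "target C z = source C (y \<cdot> x) \<and> y \<cdot> x \<cdot> z \<in> null C"
  then have [simp]: "target C z = source C x" by simp
  have "x \<cdot> z \<in> null C" by (rule N_monoD[OF y]) (use z in simp_all)
  then show "z \<in> null C" by (rule N_monoD[OF x]) simp_all
qed

lemmas N_epi_comp = semiexact_category.N_mono_comp[OF opposite_semiexact, unfolded opposite_simps]

lemma kernel_cokernel_change: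
  assumes k: "is_kernel k q" and q: "is_cokernel q x" and q': "is_cokernel q' x"
  shows "is_kernel k q'"
proof -
  from cokernel_compare[OF q q'] obtain t where
    t: "is_iso t" "target C t = target C q'" "source C t = target C q" "t \<cdot> q = q'" .
  show ?thesis using kernel_comp_N_mono[OF k iso_N_mono[OF t(1)] t(3)] by (simp add: t(4))
qed

lemma kernel_change:
  assumes k: "is_kernel k x" and k': "is_kernel k y" and m: "is_kernel m x"
  shows "is_kernel m y"
proof -
  from kernel_compare[OF k m] obtain t where
    t: "is_iso t" "source C t = source C m" "target C t = source C k" "k \<cdot> t = m" .
  show ?thesis using kernel_comp_iso[OF k' t(1,3)] by (simp add: t(4))
qed

lemma kernel_im:
  assumes "is_kernel x y"
  shows "is_kernel (im x) y"
proof -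
  note [simp] = kernelD[OF assms]
  have "is_kernel x (coker x)" by (rule kernel_of_cokernel[OF assms coker_cokernel]) simp
  then show ?thesis by (rule kernel_change[OF _ assms im_props(1)]) simp
qed

lemma cokernel_im:
  assumes "is_cokernel q x"
  shows "is_kernel (im x) q"
proof -
  note [simp] = cokernelD[OF assms]
  show ?thesis by (rule kernel_cokernel_change[OF im_props(1) coker_cokernel assms]) simp_all
qed

text \<open>The identity of the target is a kernel, namely of its own null cokernel, so
  \<open>q\<close> is a cokernel followed by a kernel.\<close>

lemma normal_epi_exact:
  assumes "normal_epi q"
  shows "exact_mor q"
proof -
  note [simp] = normal_epiD(1)[OF assms]
  let ?i = "ident C (target C q)"
  have n: "coker ?i \<in> null C" using coker_typing(3)[of ?i] by simp
  have "is_kernel ?i (coker ?i)"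
  proof (rule kernelI)
    show "monic ?i" by (rule iso_monic, rule isoI[where y = ?i]) simp_all
    fix x assume "x \<in> arr C" "target C x = source C (coker ?i)"
    then show "\<exists>x' \<in> arr C. target C x' = source C ?i \<and> ?i \<cdot> x' = x" by (intro bexI[of _ x]) simp_all
  qed (simp_all add: n)
  from exact_mor_comp[OF normal_monoI[OF this] assms] show ?thesis by simp
qed

lemma lift_sharp_flat:
  assumes [simp]: "x \<in> arr C" "y \<in> arr C" "source C y = target C x" "y \<cdot> x \<in> null C"
  shows "lift (ker y) x \<in> arr C" "source C (lift (ker y) x) = source C x"
    "target C (lift (ker y) x) = source C (ker y)" "ker y \<cdot> lift (ker y) x = x"
    "colift (coker x) y \<in> arr C" "source C (colift (coker x) y) = target C (coker x)"
    "target C (colift (coker x) y) = target C y" "colift (coker x) y \<cdot> coker x = y"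
  using lift_ker[of y x] colift_coker[of x y] by simp_all

end

text \<open>This is \<open>homology_iso\<close> on the middle object of the row, with
  \<open>ker y\<close> as subobject and \<open>coker x\<close> as quotient.\<close>

lemma (in homological_category) lr_iso_props:
  assumes [simp]: "x \<in> arr C" "y \<in> arr C" "source C y = target C x" "y \<cdot> x \<in> null C"
  shows "is_iso (lr_iso x y)" "source C (lr_iso x y) = target C (lhom x y)"
    "target C (lr_iso x y) = source C (rhom x y)"
    "rhom x y \<cdot> (lr_iso x y \<cdot> lhom x y) = coker x \<cdot> ker y"
proof -
  note [simp] = lift_sharp_flat[OF assms]
  have l: "is_cokernel (lhom x y) (lift (ker y) x)" and r: "is_kernel (rhom x y) (colift (coker x) y)"
    unfolding lhom_def rhom_def by (simp_all add: coker_cokernel ker_kernel)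
  obtain m where m: "is_iso m" "source C m = target C (lhom x y)" "target C m = source C (rhom x y)"
    "rhom x y \<cdot> (m \<cdot> lhom x y) = coker x \<cdot> ker y"
    by (rule homology_iso[OF ker_kernel[of y] coker_cokernel[of x] _ _ _ _ _ _ _ l r]) simp_all
  have "lr_iso x y = m" unfolding lr_iso_def
    by (rule the_middle_eqI[OF kernel_monic[OF r] cokernel_epic[OF l] inv_arr_props(1)[OF m(1)] m(2-4)])
  then show "is_iso (lr_iso x y)" "source C (lr_iso x y) = target C (lhom x y)"
    "target C (lr_iso x y) = source C (rhom x y)"
    "rhom x y \<cdot> (lr_iso x y \<cdot> lhom x y) = coker x \<cdot> ker y"
    using m by simp_all
qed

section \<open>Nomura's sequence\<close>

text \<open>As a locale, the hypotheses can be instantiated a second time at the opposite diagram.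
  The right-hand objects are \<open>E\<close> and \<open>E'\<close>, the letter \<open>C\<close>
  being taken by the category.\<close>

locale nomura_diagram = homological_category C + nomura C D
  for C :: "('o, 'm) nullcat" (structure) and D :: "'m two_rows" +
  fixes A B E A' B' E' :: 'o
  assumes f_hom: "f \<in> hom A B" and g_hom: "g \<in> hom B E"
    and f'_hom: "f' \<in> hom A' B'" and g'_hom: "g' \<in> hom B' E'"
    and a_hom: "a \<in> hom A A'" and b_hom: "b \<in> hom B B'" and c_hom: "c \<in> hom E E'"
    and left_square: "b \<cdot> f = f' \<cdot> a" and right_square: "c \<cdot> g = g' \<cdot> b"
    and top_null: "g \<cdot> f \<in> null C" and bottom_null: "g' \<cdot> f' \<in> null C"
    and b_exact: "exact_mor b"
begin

lemmas diagram_typing [simp] = homD[OF f_hom] homD[OF g_hom] homD[OF f'_hom] homD[OF g'_hom]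
  homD[OF a_hom] homD[OF b_hom] homD[OF c_hom]

lemmas b_iso = b_exact[unfolded exact_mor_def, THEN conjunct2]

lemma b_bar_inverse [simp]:
  "inv_arr (bar b) \<in> arr C" "source C (inv_arr (bar b)) = source C (im b)"
  "target C (inv_arr (bar b)) = target C (coim b)"
  using inv_arr_props[OF b_iso] by simp_all

lemma b_check_props [simp]:
  "b_check \<in> arr C" "source C b_check = target C (coker f)" "target C b_check = target C (coker f')"
  "b_check \<cdot> coker f = coker f' \<cdot> b"
proof -
  have "coker f' \<cdot> (f' \<cdot> a) \<in> null C" by (rule null_reassoc) simp_all
  then show "b_check \<in> arr C" "source C b_check = target C (coker f)"
    "target C b_check = target C (coker f')" "b_check \<cdot> coker f = coker f' \<cdot> b"
    unfolding b_check_def using colift_coker[of f "coker f' \<cdot> b"] by (simp_all add: left_square)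
qed

lemma b_hat_props [simp]:
  "b_hat \<in> arr C" "source C b_hat = source C (ker g)" "target C b_hat = source C (ker g')"
  "ker g' \<cdot> b_hat = b \<cdot> ker g"
proof -
  have "c \<cdot> (g \<cdot> ker g) \<in> null C" by simp
  then have "g' \<cdot> (b \<cdot> ker g) \<in> null C" using reassoc[OF right_square, of "ker g"] by simp
  then show "b_hat \<in> arr C" "source C b_hat = source C (ker g)" "target C b_hat = source C (ker g')"
    "ker g' \<cdot> b_hat = b \<cdot> ker g"
    unfolding b_hat_def using lift_ker[of g' "b \<cdot> ker g"] by simp_all
qed

lemma g_flat_props [simp]:
  "g_flat \<in> arr C" "source C g_flat = target C (coker f)" "target C g_flat = E" "g_flat \<cdot> coker f = g"
  unfolding g_flat_def using lift_sharp_flat[of f g] by (simp_all add: top_null)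

lemma f_sharp_props [simp]:
  "lift (ker g) f \<in> arr C" "source C (lift (ker g) f) = A" "target C (lift (ker g) f) = source C (ker g)"
  "ker g \<cdot> lift (ker g) f = f"
  using lift_sharp_flat[of f g] by (simp_all add: top_null)

lemma f'_sharp_props [simp]:
  "f'_sharp \<in> arr C" "source C f'_sharp = A'" "target C f'_sharp = source C (ker g')"
  "ker g' \<cdot> f'_sharp = f'"
  unfolding f'_sharp_def using lift_sharp_flat[of f' g'] by (simp_all add: bottom_null)

lemma xi_props [simp]:
  "xi \<in> arr C" "source C xi = source C (ker b)" "target C xi = source C (ker b_check)"
  "ker b_check \<cdot> xi = coker f \<cdot> ker b"
proof -
  have "coker f' \<cdot> (b \<cdot> ker b) \<in> null C" by simp
  then have "b_check \<cdot> (coker f \<cdot> ker b) \<in> null C" using reassoc[OF b_check_props(4), of "ker b"] by simp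
  then show "xi \<in> arr C" "source C xi = source C (ker b)" "target C xi = source C (ker b_check)"
    "ker b_check \<cdot> xi = coker f \<cdot> ker b"
    unfolding xi_def using lift_ker[of b_check "coker f \<cdot> ker b"] by simp_all
qed

lemma eta_props [simp]:
  "eta \<in> arr C" "source C eta = source C (ker b_check)" "target C eta = source C (ker c)"
  "ker c \<cdot> eta = g_flat \<cdot> ker b_check"
proof -
  define y where "y = colift (coker f') g'"
  have [simp]: "y \<in> arr C" "source C y = target C (coker f')" "target C y = E'" and y: "y \<cdot> coker f' = g'"
    unfolding y_def using lift_sharp_flat[of f' g'] by (simp_all add: bottom_null)
  \<comment> \<open>Here \<open>y\<close> is the morphism from \<open>Coker f'\<close> induced by
    \<open>g'\<close>. Commutation with it shows that \<open>c\<close> kills the image of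
    \<open>Ker b_check\<close> in \<open>E\<close>.\<close>
  have "c \<cdot> g_flat \<cdot> coker f = y \<cdot> b_check \<cdot> coker f"
    using right_square reassoc[OF y, of b] by simp
  then have "c \<cdot> g_flat = y \<cdot> b_check" by (rule coker_cancel) simp_all
  then have "c \<cdot> (g_flat \<cdot> ker b_check) = y \<cdot> (b_check \<cdot> ker b_check)"
    using reassoc[of c g_flat "y \<cdot> b_check" "ker b_check"] by simp
  then have "c \<cdot> (g_flat \<cdot> ker b_check) \<in> null C" by simp
  then show "eta \<in> arr C" "source C eta = source C (ker b_check)" "target C eta = source C (ker c)"
    "ker c \<cdot> eta = g_flat \<cdot> ker b_check"
    unfolding eta_def using lift_ker[of c "g_flat \<cdot> ker b_check"] by simp_all
qed

lemma b_hat_sharp: "b_hat \<cdot> lift (ker g) f = f'_sharp \<cdot> a"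
  by (rule ker_cancel[of g'])
    (simp_all add: reassoc[OF b_hat_props(4)] reassoc[OF f'_sharp_props(4)] left_square)

lemma eta'_props [simp]:
  "eta' \<in> arr C" "source C eta' = target C (coker a)" "target C eta' = target C (coker b_hat)"
  "eta' \<cdot> coker a = coker b_hat \<cdot> f'_sharp"
proof -
  have "coker b_hat \<cdot> (f'_sharp \<cdot> a) \<in> null C"
    unfolding b_hat_sharp[symmetric] by (rule null_reassoc) simp_all
  then show "eta' \<in> arr C" "source C eta' = target C (coker a)" "target C eta' = target C (coker b_hat)"
    "eta' \<cdot> coker a = coker b_hat \<cdot> f'_sharp"
    unfolding eta'_def using colift_coker[of a "coker b_hat \<cdot> f'_sharp"] by simp_all
qed

lemma lhom_row: "lhom f g = coker (lift (ker g) f)" and lhom_row': "lhom f' g' = coker f'_sharp"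
  and rhom_row: "rhom f g = ker g_flat"
  by (simp_all add: lhom_def rhom_def f'_sharp_def g_flat_def)

lemma h_props [simp]:
  "h \<in> arr C" "source C h = target C (lhom f g)" "target C h = target C (lhom f' g')"
  "h \<cdot> lhom f g = lhom f' g' \<cdot> b_hat"
proof -
  have "coker f'_sharp \<cdot> (b_hat \<cdot> lift (ker g) f) \<in> null C"
    unfolding b_hat_sharp by (rule null_reassoc) simp_all
  then show "h \<in> arr C" "source C h = target C (lhom f g)" "target C h = target C (lhom f' g')"
    "h \<cdot> lhom f g = lhom f' g' \<cdot> b_hat"
    unfolding h_def lhom_row lhom_row'
    using colift_coker[of "lift (ker g) f" "coker f'_sharp \<cdot> b_hat"] by simp_all
qed

text \<open>The morphism \<open>h\<close> is defined on left homologies, while \<open>theta\<close>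
  compares subobjects of \<open>Coker f\<close>. This identifies \<open>h\<close> with the morphism
  that \<open>b_check\<close> induces on right homologies.\<close>

lemma rhom_h: "rhom f' g' \<cdot> (lr_iso f' g' \<cdot> h) = b_check \<cdot> (rhom f g \<cdot> lr_iso f g)"
proof -
  have [simp]: "rhom f g \<in> arr C" "rhom f' g' \<in> arr C" "lhom f g \<in> arr C" "lhom f' g' \<in> arr C"
    "source C (lhom f g) = source C (ker g)" "source C (lhom f' g') = source C (ker g')"
    "target C (rhom f g) = target C (coker f)" "target C (rhom f' g') = target C (coker f')"
    using lift_sharp_flat[of f' g'] by (simp_all add: lhom_def rhom_def bottom_null top_null lift_sharp_flat)
  note m = lr_iso_props[of f g, simplified top_null, simplified]
    and m' = lr_iso_props[of f' g', simplified bottom_null, simplified]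
  note [simp] = inv_arr_props(1)[OF m(1)] inv_arr_props(1)[OF m'(1)] m(2,3) m'(2,3)
  have "rhom f' g' \<cdot> (lr_iso f' g' \<cdot> h) \<cdot> lhom f g = coker f' \<cdot> (ker g' \<cdot> b_hat)"
    using reassoc3[OF m'(4), of b_hat] by simp
  also have "\<dots> = b_check \<cdot> (coker f \<cdot> ker g)"
    by (simp add: reassoc[OF b_check_props(4)])
  also have "\<dots> = b_check \<cdot> (rhom f g \<cdot> lr_iso f g) \<cdot> lhom f g"
    by (simp add: m(4))
  finally show ?thesis
    unfolding lhom_row by (rule coker_cancel) (simp_all add: lhom_row[symmetric])
qed

end

context nomura
begin

text \<open>The morphisms of the sequence without the identifications \<open>theta\<close> and \<open>theta'\<close>. As both of
  these refer to the left homologies, only the morphisms below are dual to each other.\<close>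

definition alpha0 :: 'm where
  "alpha0 = colift (lhom k (eta \<cdot> xi)) v"

definition beta0 :: 'm where
  "beta0 = inv_arr (Lambek S S1) \<cdot> Lambek_v S2 S1 \<cdot> sigma \<cdot> coker xi \<cdot> ker eta"

definition alpha0' :: 'm where
  "alpha0' = lift (rhom (xi' \<cdot> eta') l) u"

definition beta0' :: 'm where
  "beta0' = coker eta' \<cdot> ker xi' \<cdot> sigma' \<cdot> Lambek_v T1 T2 \<cdot> inv_arr (Lambek T1 T)"

end

context nomura_diagram
begin

lemma hom_typing [simp]:
  "rhom f g \<in> arr C" "rhom f' g' \<in> arr C" "lhom f g \<in> arr C" "lhom f' g' \<in> arr C"
  "source C (lhom f g) = source C (ker g)" "source C (lhom f' g') = source C (ker g')"
  "target C (rhom f g) = target C (coker f)" "target C (rhom f' g') = target C (coker f')"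
  using lift_sharp_flat[of f' g'] lift_sharp_flat[of f g]
  by (simp_all add: lhom_def rhom_def bottom_null top_null)

lemmas lr = lr_iso_props[of f g, simplified top_null, simplified]
  and lr' = lr_iso_props[of f' g', simplified bottom_null, simplified]

text \<open>Both \<open>?W\<close> and \<open>?U\<close> represent the part of
  \<open>Coker f\<close> killed by \<open>b_check\<close> and by \<open>g_flat\<close>. For
  \<open>?W\<close> this is read off \<open>rhom_h\<close>; for \<open>?U\<close> it holds because
  \<open>ker c\<close> is an N-monomorphism. Hence each factors through the other.\<close>

lemma theta_props:
  "is_iso theta" "source C theta = source C (ker h)" "target C theta = source C (ker eta)"
proof -
  note [simp] = inv_arr_props(1-4)[OF lr(1)] inv_arr_props(1-4)[OF lr'(1)] lr(2,3) lr'(2,3)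
  let ?U = "ker b_check \<cdot> ker eta" and ?W = "rhom f g \<cdot> (lr_iso f g \<cdot> ker h)"
  have rhom_N_mono: "N_mono (rhom f' g')"
    unfolding rhom_def
    by (rule kernel_N_mono[OF ker_kernel]) (simp add: lift_sharp_flat bottom_null)
  have mU: "monic ?U" by (rule monic_comp) (simp_all add: kernel_monic[OF ker_kernel])
  have mW: "monic ?W"
    by (rule monic_comp[OF monic_comp[OF kernel_monic[OF ker_kernel] iso_monic[OF lr(1)]]])
      (simp_all add: rhom_row kernel_monic[OF ker_kernel])
  have "rhom f' g' \<cdot> (lr_iso f' g' \<cdot> (h \<cdot> ker h)) \<in> null C" by simp
  then have "b_check \<cdot> ?W \<in> null C" using reassoc3[OF rhom_h, of "ker h"] by simp
  from kernel_ex[OF ker_kernel[of b_check] _ _ this] obtain x where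
    [simp]: "x \<in> arr C" "target C x = source C (ker b_check)" and x: "ker b_check \<cdot> x = ?W" by auto
  have "g_flat \<cdot> (rhom f g \<cdot> (lr_iso f g \<cdot> ker h)) \<in> null C" by (simp add: rhom_row null_reassoc)
  then have "g_flat \<cdot> (ker b_check \<cdot> x) \<in> null C" unfolding x .
  then have "ker c \<cdot> (eta \<cdot> x) \<in> null C" using reassoc[OF eta_props(4), of x] by simp
  then have "eta \<cdot> x \<in> null C" by (rule ker_cancel_null) simp_all
  from kernel_ex[OF ker_kernel[of eta] _ _ this] obtain y where
    [simp]: "y \<in> arr C" "target C y = source C (ker eta)" and y: "ker eta \<cdot> y = x" by auto
  have Uy: "?U \<cdot> y = ?W" by (simp add: y x)
  have "ker c \<cdot> (eta \<cdot> ker eta) \<in> null C" by simp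
  then have "g_flat \<cdot> ?U \<in> null C" using reassoc[OF eta_props(4), of "ker eta"] by simp
  from kernel_ex[OF ker_kernel[of g_flat] _ _ this] obtain w where
    [simp]: "w \<in> arr C" "target C w = source C (rhom f g)" and w: "rhom f g \<cdot> w = ?U"
    by (auto simp: rhom_row)
  let ?w = "inv_arr (lr_iso f g) \<cdot> w"
  have w2: "lr_iso f g \<cdot> ?w = w" using inv_arr_cancel(2)[OF lr(1), of w] by simp
  have "b_check \<cdot> ?U \<in> null C" by (rule null_reassoc) simp_all
  then have "rhom f' g' \<cdot> (lr_iso f' g' \<cdot> (h \<cdot> ?w)) \<in> null C"
    using reassoc3[OF rhom_h, of ?w] w2 w by simp
  then have "lr_iso f' g' \<cdot> (h \<cdot> ?w) \<in> null C"
    by (rule N_monoD[OF rhom_N_mono]) simp_all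
  then have "h \<cdot> ?w \<in> null C" by (rule N_monoD[OF iso_N_mono[OF lr'(1)]]) simp_all
  from kernel_ex[OF ker_kernel[of h] _ _ this] obtain z where
    [simp]: "z \<in> arr C" "target C z = source C (ker h)" and z: "ker h \<cdot> z = ?w" by auto
  have Wz: "?W \<cdot> z = ?U" using w2 by (simp add: z w)
  have "is_iso y" by (rule monic_factor_iso[OF mU mW _ _ Uy _ _ Wz]) simp_all
  moreover have "theta = y"
    unfolding theta_def by (rule lift_eqI[OF mU]) (use Uy in simp_all)
  moreover have "source C y = source C (ker h)" using arg_cong[OF Uy, of "source C"] by simp
  ultimately show "is_iso theta" "source C theta = source C (ker h)" "target C theta = source C (ker eta)"
    by simp_all
qed

text \<open>Both composites are the quotient of \<open>Ker g'\<close> by the images of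
  \<open>b_hat\<close> and \<open>f'_sharp\<close>, taken in the two orders. Left homologies are
  already quotients of \<open>Ker g'\<close>, so \<open>lr_iso\<close> does not enter.\<close>

lemma theta'_props:
  "is_iso theta'" "source C theta' = target C (coker eta')" "target C theta' = target C (coker h)"
proof -
  let ?V = "coker eta' \<cdot> coker b_hat" and ?W = "coker h \<cdot> lhom f' g'"
  have eV: "epic ?V" by (rule epic_comp) (simp_all add: cokernel_epic[OF coker_cokernel])
  have "epic (lhom f' g')" by (simp add: lhom_row' cokernel_epic[OF coker_cokernel])
  from epic_comp[OF cokernel_epic[OF coker_cokernel] this] have eW: "epic ?W" by simp
  have hl: "lhom f' g' \<cdot> b_hat = h \<cdot> lhom f g" by simp
  have "coker h \<cdot> (h \<cdot> lhom f g) \<in> null C" by (rule null_reassoc) simp_all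
  then have "?W \<cdot> b_hat \<in> null C" by simp
  from cokernel_ex[OF coker_cokernel[of b_hat] _ _ this] obtain x where
    [simp]: "x \<in> arr C" "source C x = target C (coker b_hat)" and x: "x \<cdot> coker b_hat = ?W" by auto
  have "lhom f' g' \<cdot> f'_sharp \<in> null C" by (simp add: lhom_row')
  then have "coker h \<cdot> (lhom f' g' \<cdot> f'_sharp) \<in> null C" by (rule null_comp_left) simp_all
  then have "x \<cdot> (eta' \<cdot> coker a) \<in> null C"
    using reassoc[OF x, of f'_sharp] by simp
  then have "x \<cdot> eta' \<cdot> coker a \<in> null C" by simp
  then have "x \<cdot> eta' \<in> null C" by (rule coker_cancel_null) simp_all
  from cokernel_ex[OF coker_cokernel[of eta'] _ _ this] obtain y where
    [simp]: "y \<in> arr C" "source C y = target C (coker eta')" and y: "y \<cdot> coker eta' = x" by auto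
  have Vy: "y \<cdot> ?V = ?W" using reassoc[OF y, of "coker b_hat"] by (simp add: x)
  have "coker eta' \<cdot> (eta' \<cdot> coker a) \<in> null C" by (rule null_reassoc) simp_all
  then have "?V \<cdot> f'_sharp \<in> null C" by simp
  from cokernel_ex[OF coker_cokernel[of f'_sharp] _ _ this] obtain w where
    [simp]: "w \<in> arr C" "source C w = target C (lhom f' g')" and w: "w \<cdot> lhom f' g' = ?V"
    by (auto simp: lhom_row')
  have "coker eta' \<cdot> (coker b_hat \<cdot> b_hat) \<in> null C" by simp
  then have "w \<cdot> h \<cdot> lhom f g \<in> null C" using reassoc[OF w, of b_hat] by simp
  then have "w \<cdot> h \<in> null C" unfolding lhom_row
    by (rule coker_cancel_null) (simp_all flip: lhom_row)
  from cokernel_ex[OF coker_cokernel[of h] _ _ this] obtain z where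
    [simp]: "z \<in> arr C" "source C z = target C (coker h)" and z: "z \<cdot> coker h = w" by auto
  have Wz: "z \<cdot> ?W = ?V" using reassoc[OF z, of "lhom f' g'"] by (simp add: w)
  have "is_iso y" by (rule epic_factor_iso[OF eV eW _ _ Vy _ _ Wz]) simp_all
  moreover have "theta' = y"
    unfolding theta'_def by (rule colift_eqI[OF eV]) (use Vy in simp_all)
  moreover have "target C y = target C (coker h)" using arg_cong[OF Vy, of "target C"] by simp
  ultimately show "is_iso theta'" "source C theta' = target C (coker eta')"
    "target C theta' = target C (coker h)" by simp_all
qed

section \<open>The squares of the diagram and their Lambek invariants inside
  \<open>Im b\<close>\<close>

lemma square_sel [simp]:
  "sq_top S = f" "sq_left S = a" "sq_right S = b" "sq_bottom S = f'"
  "sq_top T = g" "sq_left T = b" "sq_right T = c" "sq_bottom T = g'"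
  "sq_top S1 = coker f" "sq_left S1 = b" "sq_right S1 = b_check" "sq_bottom S1 = coker f'"
  "sq_top S2 = xi" "sq_left S2 = ker b" "sq_right S2 = ker b_check" "sq_bottom S2 = coker f"
  by (simp_all add: S_def T_def S1_def S2_def)

lemma squares_commute: "commuting S" "commuting T" "commuting S1" "commuting S2"
  by (simp_all add: commuting_def left_square right_square)

lemmas lproj_S = lproj_props[OF squares_commute(1), simplified]
  and lam_S = lam_props[OF squares_commute(1), simplified]
  and lproj_S2 = lproj_props[OF squares_commute(4), simplified]
  and lam_S2 = lam_props[OF squares_commute(4), simplified]
  and rinj_S1 = rinj_props[OF squares_commute(3), simplified]
  and rho_S1 = rho_props[OF squares_commute(3), simplified]
  and rinj_T = rinj_props[OF squares_commute(2), simplified]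
  and rho_T = rho_props[OF squares_commute(2), simplified]

lemmas square_typing [simp] = lproj_S(3-7) lam_S(1-3) lproj_S2(3-7) lam_S2(1-3) rinj_S1(3-7)
  rho_S1(1-3) rinj_T(3-7) rho_T(1-3)

text \<open>With \<open>I = Im b\<close>: the normal epimorphism \<open>B \<rightarrow> I\<close>, and the quotients of \<open>I\<close> underlying the
  pushouts of \<open>S1\<close> and of \<open>T\<close>. All the objects of the sequence are subquotients of \<open>I\<close> or \<open>B\<close>.\<close>

definition proj_b :: 'm where
  "proj_b = bar b \<cdot> coim b"

definition quot_S1 :: 'm where
  "quot_S1 = rinj S1 \<cdot> inv_arr (bar b)"

definition quot_T :: 'm where
  "quot_T = rinj T \<cdot> inv_arr (bar b)"

lemma quot_typing [simp]:
  "proj_b \<in> arr C" "source C proj_b = B" "target C proj_b = source C (im b)"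
  "quot_S1 \<in> arr C" "source C quot_S1 = source C (im b)" "target C quot_S1 = target C (rinj S1)"
  "quot_T \<in> arr C" "source C quot_T = source C (im b)" "target C quot_T = target C (rinj T)"
  by (simp_all add: proj_b_def quot_S1_def quot_T_def)

lemma im_proj_b: "im b \<cdot> proj_b = b"
  unfolding proj_b_def by (simp add: bar_props(4))

lemma proj_b_cokernel: "is_cokernel proj_b (ker b)"
  unfolding proj_b_def using exact_mor_factor(2)[OF b_exact] .

lemma quot_proj:
  "quot_S1 \<cdot> proj_b = rinj S1 \<cdot> coim b" "quot_T \<cdot> proj_b = rinj T \<cdot> coim b"
  unfolding quot_S1_def quot_T_def proj_b_def
  using inv_arr_cancel(1)[OF b_iso, of "coim b"] by simp_all

lemma rho_quot: "rho S1 \<cdot> quot_S1 = coker f' \<cdot> im b" "rho T \<cdot> quot_T = g' \<cdot> im b"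
proof -
  have "im b \<cdot> (bar b \<cdot> inv_arr (bar b)) = im b" using inv_arr_props(6)[OF b_iso] by simp
  then show "rho S1 \<cdot> quot_S1 = coker f' \<cdot> im b" "rho T \<cdot> quot_T = g' \<cdot> im b"
    unfolding quot_S1_def quot_T_def
    using reassoc[OF rho_S1(4), of "inv_arr (bar b)"] reassoc[OF rho_T(4), of "inv_arr (bar b)"]
    by simp_all
qed

text \<open>The pushout divides by the image of \<open>Ker (coker f)\<close>, that is, of
  \<open>im f\<close>. As \<open>f\<close> and \<open>im f\<close> have the same cokernel, dividing
  by \<open>f\<close> gives the same quotient.\<close>

lemma quot_S1_cokernel: "is_cokernel quot_S1 (proj_b \<cdot> f)"
proof -
  have "inv_arr (bar b) \<cdot> bar b = ident C (target C (coim b))" using inv_arr_props(5)[OF b_iso] by simp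
  then have "quot_S1 \<cdot> bar b = rinj S1" unfolding quot_S1_def by simp
  then have "is_cokernel quot_S1 (bar b \<cdot> (coim b \<cdot> ker (coker f)))"
    using rinj_S1(1) by (intro cokernel_precomp_iso[OF _ b_iso]) simp_all
  then have "is_cokernel quot_S1 (proj_b \<cdot> im f)" by (simp add: proj_b_def im_def)
  moreover have "is_cokernel (coker f) f" by (simp add: coker_cokernel)
  moreover have "is_cokernel (coker f) (im f)"
    by (rule cokernel_of_kernel[OF coker_cokernel im_props(1)]) simp_all
  ultimately show ?thesis by (intro cokernel_replace[of "coker f" "im f" f]) simp_all
qed

lemma quot_T_null: "quot_T \<cdot> proj_b \<cdot> ker g \<in> null C"
proof -
  have "coim g \<cdot> ker g \<in> null C" unfolding coim_def by simp
  then have "rinj_v T \<cdot> (coim g \<cdot> ker g) \<in> null C" by (rule null_comp_left) simp_all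
  then show ?thesis unfolding quot_proj rinj_T(8) by simp
qed

text \<open>The pushout of \<open>coim b\<close> and \<open>coim g\<close> divides
  \<open>Coim b\<close> by the image of \<open>Ker g\<close>. Moving \<open>bar b\<close> to the
  other side makes \<open>quot_T\<close> a cokernel of \<open>proj_b \<cdot> ker g\<close>.\<close>

lemma quot_T_universal:
  assumes "y \<in> arr C" "source C y = source C (im b)" "y \<cdot> proj_b \<cdot> ker g \<in> null C"
  shows "\<exists>y' \<in> arr C. source C y' = target C quot_T \<and> y' \<cdot> quot_T = y"
proof -
  have "inv_arr (bar b) \<cdot> bar b = ident C (target C (coim b))" using inv_arr_props(5)[OF b_iso] by simp
  then have "quot_T \<cdot> bar b = rinj T" unfolding quot_T_def by simp
  then have "is_cokernel quot_T (bar b \<cdot> (coim b \<cdot> ker g))"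
    using rinj_T(1) by (intro cokernel_precomp_iso[OF _ b_iso]) simp_all
  from cokernel_ex[OF this, of y] show ?thesis using assms by (simp add: proj_b_def)
qed

text \<open>On \<open>Im b\<close> the null sequence is \<open>proj_b \<cdot> f\<close> followed by
  \<open>coker f' \<cdot> im b\<close>. Its left homology is \<open>Im S\<close> and its right
  homology is \<open>Ker S1\<close>, so \<open>homology_iso\<close> applies.\<close>

lemma Lambek_S_S1:
  "is_iso (Lambek S S1)" "source C (Lambek S S1) = target C (coker (lam S))"
  "target C (Lambek S S1) = source C (ker (rho S1))"
  "ker (rho S1) \<cdot> (Lambek S S1 \<cdot> coker (lam S)) = quot_S1 \<cdot> lproj S"
proof -
  have "coker f' \<cdot> (f' \<cdot> a) \<in> null C" by (rule null_reassoc) simp_all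
  then have n: "coker f' \<cdot> im b \<cdot> (proj_b \<cdot> f) \<in> null C"
    using reassoc[OF im_proj_b, of f] by (simp add: left_square)
  obtain m where m: "is_iso m" "source C m = target C (coker (lam S))"
    "target C m = source C (ker (rho S1))" "ker (rho S1) \<cdot> (m \<cdot> coker (lam S)) = quot_S1 \<cdot> lproj S"
    by (rule homology_iso[OF lproj_S(1) quot_S1_cokernel n _ _ _ _ _ rho_quot(1)
          coker_cokernel[of "lam S"] ker_kernel])
      (simp_all add: lam_S(4) proj_b_def)
  have "Lambek S S1 = m" unfolding Lambek_def ImS_def KerS_def
    by (rule the_middle_eqI[OF kernel_monic[OF ker_kernel] cokernel_epic[OF coker_cokernel]
          inv_arr_props(1)[OF m(1)] m(2,3)])
      (simp_all add: m(4) quot_S1_def)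
  then show "is_iso (Lambek S S1)" "source C (Lambek S S1) = target C (coker (lam S))"
    "target C (Lambek S S1) = source C (ker (rho S1))"
    "ker (rho S1) \<cdot> (Lambek S S1 \<cdot> coker (lam S)) = quot_S1 \<cdot> lproj S"
    using m by simp_all
qed

lemma Lam_props:
  "Lam \<in> arr C" "source C Lam = target C (coker (lam S))" "target C Lam = source C (ker (rho T))"
  "ker (rho T) \<cdot> (Lam \<cdot> coker (lam S)) = quot_T \<cdot> lproj S"
proof -
  have y: "quot_T \<cdot> lproj S = rinj T \<cdot> inv_arr (bar (sq_right S)) \<cdot> lproj S"
    by (simp add: quot_T_def)
  have "quot_T \<cdot> (proj_b \<cdot> (ker g \<cdot> lift (ker g) f)) \<in> null C"
    using null_comp_right[OF quot_T_null, of "lift (ker g) f"] by simp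
  then have 1: "quot_T \<cdot> lproj S \<cdot> lam S \<in> null C"
    by (simp add: lam_S(4) proj_b_def)
  have "g' \<cdot> im f' \<in> null C"
  proof -
    obtain y where [simp]: "y \<in> arr C" "source C y = target C (coker f')" and y: "y \<cdot> coker f' = g'"
      using cokernel_ex[OF coker_cokernel[of f'], of g'] bottom_null by auto
    have "coker f' \<cdot> im f' \<in> null C" unfolding im_def by simp
    then have "y \<cdot> (coker f' \<cdot> im f') \<in> null C" by (rule null_comp_left) simp_all
    then show ?thesis using reassoc[OF y, of "im f'"] by simp
  qed
  then have "g' \<cdot> (im f' \<cdot> lproj_v S) \<in> null C" by (rule null_reassoc) simp_all
  then have 2: "rho T \<cdot> (quot_T \<cdot> lproj S) \<in> null C"
    using reassoc[OF rho_quot(2), of "lproj S"] by (simp add: lproj_S(8))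
  note m = the_middle_props[OF coker_cokernel[of "lam S"] ker_kernel[of "rho T"] _ _ _ _ _
      Lam_def[unfolded Lambek_def ImS_def KerS_def, folded y]]
  show "Lam \<in> arr C" "source C Lam = target C (coker (lam S))" "target C Lam = source C (ker (rho T))"
    "ker (rho T) \<cdot> (Lam \<cdot> coker (lam S)) = quot_T \<cdot> lproj S"
    by (rule m; use 1 2 in simp)+
qed

section \<open>The morphism induced by \<open>proj_b\<close> on \<open>Coker f\<close>, and the
  value of \<open>beta0\<close>\<close>

definition pbar :: 'm where
  "pbar = colift (coker f) (quot_S1 \<cdot> proj_b)"

lemma pbar_props [simp]:
  "pbar \<in> arr C" "source C pbar = target C (coker f)" "target C pbar = target C quot_S1"
  "pbar \<cdot> coker f = quot_S1 \<cdot> proj_b"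
  unfolding pbar_def using colift_coker[of f "quot_S1 \<cdot> proj_b"] cokernelD(4)[OF quot_S1_cokernel]
  by simp_all

lemma rho_pbar: "rho S1 \<cdot> pbar = b_check"
proof -
  have "rho S1 \<cdot> pbar \<cdot> coker f = b_check \<cdot> coker f"
    using reassoc[OF rho_quot(1), of proj_b] by (simp add: im_proj_b)
  then show ?thesis by (rule coker_cancel) simp_all
qed

text \<open>The quotient of \<open>B\<close> by \<open>f\<close> and \<open>Ker b\<close> can be
  formed in two orders: \<open>quot_S1 \<cdot> proj_b\<close> divides by \<open>Ker b\<close> first,
  \<open>pbar \<cdot> coker f\<close> by \<open>f\<close> first.\<close>

lemma pbar_cokernel: "is_cokernel pbar (coker f \<cdot> ker b)"
proof (rule cokernelI)
  have "epic (pbar \<cdot> coker f)" unfolding pbar_props(4)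
    by (rule epic_comp[OF cokernel_epic[OF quot_S1_cokernel] cokernel_epic[OF proj_b_cokernel]]) simp
  then show "epic pbar" by (rule epic_cancel) simp_all
  have "quot_S1 \<cdot> (proj_b \<cdot> ker b) \<in> null C" using cokernelD(4)[OF proj_b_cokernel] by simp
  then show "pbar \<cdot> (coker f \<cdot> ker b) \<in> null C"
    using reassoc[OF pbar_props(4), of "ker b"] by simp
  fix y assume [simp]: "y \<in> arr C" and y: "source C y = target C (coker f \<cdot> ker b)" "y \<cdot> (coker f \<cdot> ker b) \<in> null C"
  then have [simp]: "source C y = target C (coker f)" by simp
  obtain z where [simp]: "z \<in> arr C" "source C z = source C (im b)" and z: "z \<cdot> proj_b = y \<cdot> coker f"
    using cokernel_ex[OF proj_b_cokernel, of "y \<cdot> coker f"] y by auto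
  have "y \<cdot> (coker f \<cdot> f) \<in> null C" by simp
  then have "z \<cdot> (proj_b \<cdot> f) \<in> null C" using reassoc[OF z, of f] by simp
  then obtain w where [simp]: "w \<in> arr C" "source C w = target C quot_S1" and w: "w \<cdot> quot_S1 = z"
    using cokernel_ex[OF quot_S1_cokernel, of z] by auto
  have "w \<cdot> pbar \<cdot> coker f = y \<cdot> coker f" using reassoc[OF w, of proj_b] by (simp add: z)
  then have "w \<cdot> pbar = y" by (rule coker_cancel) simp_all
  then show "\<exists>x' \<in> arr C. source C x' = target C pbar \<and> x' \<cdot> pbar = y"
    by (intro bexI[of _ w]) simp_all
qed simp_all

text \<open>The right homology of \<open>p f\<close> and \<open>(coker f') (im b)\<close>, realizing \<open>Im S\<close> as a subobject.\<close>

definition incl_S1 :: 'm where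
  "incl_S1 = ker (rho S1) \<cdot> Lambek S S1"

lemma incl_S1_props:
  "is_kernel incl_S1 (rho S1)" "incl_S1 \<in> arr C" "source C incl_S1 = target C (coker (lam S))"
  "target C incl_S1 = target C quot_S1" "incl_S1 \<cdot> coker (lam S) = quot_S1 \<cdot> lproj S"
proof -
  note [simp] = inv_arr_props(1)[OF Lambek_S_S1(1)] Lambek_S_S1(2,3)
  show "is_kernel incl_S1 (rho S1)" unfolding incl_S1_def
    by (rule kernel_comp_iso[OF ker_kernel Lambek_S_S1(1)]) simp_all
  show "incl_S1 \<in> arr C" "source C incl_S1 = target C (coker (lam S))"
    "target C incl_S1 = target C quot_S1" "incl_S1 \<cdot> coker (lam S) = quot_S1 \<cdot> lproj S"
    using Lambek_S_S1(4) by (simp_all add: incl_S1_def)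
qed

lemma coker_f_bar:
  "is_iso (bar (coker f))"
  using normal_epi_exact[OF normal_epiI[OF coker_cokernel[of f]]] by (simp add: exact_mor_def)

text \<open>The second coprojection starts at \<open>Coim (coker f)\<close>. Once this is identified
  with \<open>Coker f\<close>, the coprojection is \<open>pbar\<close>: precomposed with the
  quotient map of \<open>B\<close>, both become \<open>quot_S1 \<cdot> proj_b\<close>.\<close>

lemma rinj_v_S1: "rinj_v S1 \<cdot> inv_arr (bar (coker f)) = pbar \<cdot> im (coker f)"
proof -
  note [simp] = inv_arr_props(1-4)[OF coker_f_bar]
  let ?q = "bar (coker f) \<cdot> coim (coker f)"
  have q: "is_cokernel ?q (ker (coker f))"
    using exact_mor_factor(2)[OF normal_epi_exact[OF normal_epiI[OF coker_cokernel[of f]]]] by simp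
  have "rinj_v S1 \<cdot> inv_arr (bar (coker f)) \<cdot> ?q = pbar \<cdot> im (coker f) \<cdot> ?q"
    using inv_arr_cancel(1)[OF coker_f_bar, of "coim (coker f)"]
    by (simp add: bar_props(4) quot_proj rinj_S1(8))
  then show ?thesis by (rule epicD[OF cokernel_epic[OF q]]) simp_all
qed

lemma Lambek_S2_S1:
  "Lambek_v S2 S1 \<in> arr C" "source C (Lambek_v S2 S1) = target C (coker (lam S2))"
  "target C (Lambek_v S2 S1) = source C (ker (rho S1))"
  "ker (rho S1) \<cdot> (Lambek_v S2 S1 \<cdot> coker (lam S2)) = pbar \<cdot> im (coker f) \<cdot> lproj_v S2"
proof -
  note [simp] = inv_arr_props(1-4)[OF coker_f_bar]
  have y: "pbar \<cdot> im (coker f) \<cdot> lproj_v S2 = rinj_v S1 \<cdot> inv_arr (bar (sq_bottom S2)) \<cdot> lproj_v S2"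
    by (simp add: rinj_v_S1[symmetric])
  have "pbar \<cdot> (im (coker f) \<cdot> (bar (coker f) \<cdot> (coim (coker f) \<cdot> ker b))) \<in> null C"
    using cokernelD(4)[OF pbar_cokernel] reassoc3[OF bar_props(4)[of "coker f"], of "ker b"] by simp
  then have 1: "pbar \<cdot> im (coker f) \<cdot> lproj_v S2 \<cdot> lam S2 \<in> null C"
    by (simp add: lam_S2(5))
  have bi: "b_check \<cdot> im (ker b_check) \<in> null C"
  proof -
    have "is_kernel (ker b_check) (coker (ker b_check))"
      by (rule kernel_of_cokernel[OF ker_kernel coker_cokernel]) simp_all
    then have "is_kernel (im (ker b_check)) b_check"
      by (rule kernel_change[OF _ ker_kernel im_props(1)]) simp_all
    then show ?thesis by (rule kernelD(4))
  qed
  then have "b_check \<cdot> (im (ker b_check) \<cdot> lproj S2) \<in> null C" by (rule null_reassoc) simp_all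
  then have 2: "rho S1 \<cdot> (pbar \<cdot> im (coker f) \<cdot> lproj_v S2) \<in> null C"
    using reassoc[OF rho_pbar, of "im (coker f) \<cdot> lproj_v S2"] by (simp add: lproj_S2(8))
  note m = the_middle_props[OF coker_cokernel[of "lam S2"] ker_kernel[of "rho S1"] _ _ _ _ _
      refl[of "Lambek_v S2 S1", unfolded Lambek_v_def[of S2 S1, unfolded ImS_def KerS_def, folded y]]]
  show "Lambek_v S2 S1 \<in> arr C" "source C (Lambek_v S2 S1) = target C (coker (lam S2))"
    "target C (Lambek_v S2 S1) = source C (ker (rho S1))"
    "ker (rho S1) \<cdot> (Lambek_v S2 S1 \<cdot> coker (lam S2)) = pbar \<cdot> im (coker f) \<cdot> lproj_v S2"
    unfolding Lambek_v_def[of S2 S1, unfolded ImS_def KerS_def, folded y]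
    by (rule m; use 1 2 in simp)+
qed

text \<open>The identification \<open>Ker b_check \<rightarrow> M\<close> used in the definition of \<open>sigma\<close>.\<close>

lemma sigma_lift:
  defines "m \<equiv> lift (im (sq_right S2) \<cdot> lproj S2) (ker b_check)"
  shows "m \<in> arr C" "source C m = source C (ker b_check)" "target C m = source C (lproj S2)"
    "im (ker b_check) \<cdot> (lproj S2 \<cdot> m) = ker b_check" "m \<cdot> xi = lam S2"
proof -
  have mono: "monic (im (ker b_check) \<cdot> lproj S2)"
    by (rule monic_comp[OF kernel_monic[OF lproj_S2(1)] kernel_monic[OF im_props(1)]]) simp_all
  have "coker (ker b_check) \<cdot> ker b_check \<in> null C" by simp
  from kernel_ex[OF im_props(1)[of "ker b_check"] _ _ this] obtain y where
    [simp]: "y \<in> arr C" "target C y = source C (im (ker b_check))"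
    and y: "im (ker b_check) \<cdot> y = ker b_check" by auto
  \<comment> \<open>Consequently \<open>lproj S2\<close> is the kernel of a null morphism, and every
    morphism into \<open>Im (ker b_check)\<close> lifts along it.\<close>
  have "coker (coker f) \<in> null C"
  proof -
    have "coker (coker f) \<cdot> coker f \<in> null C" by simp
    then show ?thesis by (rule coker_cancel_null) simp_all
  qed
  then have "coker (coker f) \<cdot> im (ker b_check) \<cdot> y \<in> null C" by simp
  from kernel_ex[OF lproj_S2(1) _ _ this] obtain z where
    [simp]: "z \<in> arr C" "target C z = source C (lproj S2)" and z: "lproj S2 \<cdot> z = y" by auto
  have "m = z" unfolding m_def square_sel by (rule lift_eqI[OF mono]) (simp_all add: z y)
  then show m [simp]: "m \<in> arr C" "target C m = source C (lproj S2)"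
    and e: "im (ker b_check) \<cdot> (lproj S2 \<cdot> m) = ker b_check" by (simp_all add: z y)
  show [simp]: "source C m = source C (ker b_check)"
    using arg_cong[OF e, of "source C"] by simp
  have "im (ker b_check) \<cdot> lproj S2 \<cdot> (m \<cdot> xi) = im (ker b_check) \<cdot> lproj S2 \<cdot> lam S2"
    using reassoc3[OF e, of xi] reassoc3[OF bar_props(4)[of "ker b_check"], of xi]
    by (simp add: lam_S2(4))
  then show "m \<cdot> xi = lam S2" by (rule monicD[OF mono]) simp_all
qed

lemma sigma_props [simp]:
  "sigma \<in> arr C" "source C sigma = target C (coker xi)" "target C sigma = target C (coker (lam S2))"
  "sigma \<cdot> coker xi = coker (lam S2) \<cdot> lift (im (sq_right S2) \<cdot> lproj S2) (ker b_check)"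
proof -
  let ?m = "lift (im (sq_right S2) \<cdot> lproj S2) (ker b_check)"
  note [simp] = sigma_lift(1-3)[simplified]
  have "coker (lam S2) \<cdot> ?m \<cdot> xi \<in> null C" using sigma_lift(5) by simp
  from colift_coker[of xi "coker (lam S2) \<cdot> ?m", OF _ _ _ this]
  show "sigma \<in> arr C" "source C sigma = target C (coker xi)"
    "target C sigma = target C (coker (lam S2))" "sigma \<cdot> coker xi = coker (lam S2) \<cdot> ?m"
    unfolding sigma_def by simp_all
qed

lemma beta0_typing [simp]:
  "beta0 \<in> arr C" "source C beta0 = source C (ker eta)" "target C beta0 = target C (coker (lam S))"
  using inv_arr_props(1-4)[OF Lambek_S_S1(1)]
  by (simp_all add: beta0_def Lambek_S2_S1 Lambek_S_S1 sigma_lift[simplified])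

text \<open>Embedding \<open>Im S\<close> by \<open>incl_S1\<close> cancels
  \<open>inv_arr (Lambek S S1)\<close>, and \<open>sigma\<close> undoes the passage to the pullback
  of \<open>S2\<close>. What remains is the restriction of \<open>pbar\<close>; all later arguments
  use \<open>beta0\<close> in this form.\<close>

lemma beta0_eq: "incl_S1 \<cdot> beta0 = pbar \<cdot> (ker b_check \<cdot> ker eta)"
proof -
  let ?m = "lift (im (ker b_check) \<cdot> lproj S2) (ker b_check)"
  note [simp] = inv_arr_props(1-4)[OF Lambek_S_S1(1)] Lambek_S_S1(2,3) Lambek_S2_S1(1-3)
    sigma_lift(1-3)[simplified]
  have im_m: "im (coker f) \<cdot> (lproj_v S2 \<cdot> ?m) = ker b_check"
    using sigma_lift(4)[simplified] reassoc[OF lproj_S2(8), of ?m] by simp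
  have "incl_S1 \<cdot> beta0
    = ker (rho S1) \<cdot> (Lambek_v S2 S1 \<cdot> (coker (lam S2) \<cdot> (?m \<cdot> ker eta)))"
    using reassoc[OF sigma_props(4), of "ker eta"]
    by (simp add: incl_S1_def beta0_def inv_arr_cancel(2)[OF Lambek_S_S1(1)])
  also have "\<dots> = pbar \<cdot> (im (coker f) \<cdot> (lproj_v S2 \<cdot> (?m \<cdot> ker eta)))"
    using reassoc3[OF Lambek_S2_S1(4), of "?m \<cdot> ker eta"] by simp
  also have "\<dots> = pbar \<cdot> (ker b_check \<cdot> ker eta)"
    using reassoc3[OF im_m, of "ker eta"] by simp
  finally show ?thesis .
qed

subsection \<open>Exactness at \<open>Ker h\<close>\<close>

lemma k_props [simp]:
  "k \<in> arr C" "source C k = source C (ker (b \<cdot> f))" "target C k = source C (ker b)"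
  "ker b \<cdot> k = f \<cdot> ker (b \<cdot> f)"
proof -
  have "b \<cdot> (f \<cdot> ker (b \<cdot> f)) \<in> null C" using ker_typing(3)[of "b \<cdot> f"] by simp
  then show "k \<in> arr C" "source C k = source C (ker (b \<cdot> f))" "target C k = source C (ker b)"
    "ker b \<cdot> k = f \<cdot> ker (b \<cdot> f)"
    unfolding k_def using lift_ker[of b "f \<cdot> ker (b \<cdot> f)"] by simp_all
qed

text \<open>As \<open>ker c\<close> is an N-monomorphism, \<open>Ker (eta \<cdot> xi)\<close> is the
  part of \<open>Ker b\<close> killed by \<open>g\<close>.\<close>

lemma eta_xi: "ker c \<cdot> (eta \<cdot> xi) = g \<cdot> ker b"
  using reassoc[OF eta_props(4), of xi] reassoc[OF g_flat_props(4), of "ker b"] by simp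

lemma v_props [simp]:
  "v \<in> arr C" "source C v = source C (ker (eta \<cdot> xi))" "target C v = source C (ker eta)"
  "ker eta \<cdot> v = xi \<cdot> ker (eta \<cdot> xi)"
proof -
  have "eta \<cdot> (xi \<cdot> ker (eta \<cdot> xi)) \<in> null C" using ker_typing(3)[of "eta \<cdot> xi"] by simp
  then show "v \<in> arr C" "source C v = source C (ker (eta \<cdot> xi))" "target C v = source C (ker eta)"
    "ker eta \<cdot> v = xi \<cdot> ker (eta \<cdot> xi)"
    unfolding v_def using lift_ker[of eta "xi \<cdot> ker (eta \<cdot> xi)"] by simp_all
qed

text \<open>Exactness of \<open>f\<close> makes \<open>Ker (b \<cdot> f) \<rightarrow> Ker (coker f \<cdot> ker b)\<close> a normal epimorphism, so
  \<open>Ker (b \<cdot> f) \<rightarrow> Ker (eta \<cdot> xi)\<close> has the same cokernel as the kernel \<open>\<kappa>\<close> of \<open>v\<close>.\<close>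

lemma alpha0_props:
  assumes f: "exact_mor f"
  obtains \<kappa> where "is_kernel \<kappa> v" "is_cokernel (lhom k (eta \<cdot> xi)) \<kappa>"
    "alpha0 \<in> arr C" "source C alpha0 = target C (lhom k (eta \<cdot> xi))"
    "target C alpha0 = source C (ker eta)" "alpha0 \<cdot> lhom k (eta \<cdot> xi) = v"
proof -
  define z where "z = ker (eta \<cdot> xi)"
  have z: "is_kernel z (eta \<cdot> xi)" unfolding z_def by (rule ker_kernel) simp
  have [simp]: "source C (ker (eta \<cdot> xi)) = source C z" by (simp add: z_def)
  note [simp] = kernelD[OF z, simplified]
  have null1: "eta \<cdot> xi \<cdot> x \<in> null C"
    if [simp]: "x \<in> arr C" "target C x = source C (ker b)" and x: "g \<cdot> (ker b \<cdot> x) \<in> null C" for x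
  proof -
    have "ker c \<cdot> (eta \<cdot> xi \<cdot> x) \<in> null C" using reassoc[OF eta_xi, of x] x by simp
    then show ?thesis by (rule ker_cancel_null) simp_all
  qed
  have "g \<cdot> (f \<cdot> ker (b \<cdot> f)) \<in> null C" using top_null by (rule null_reassoc) simp_all
  then have "eta \<cdot> xi \<cdot> k \<in> null C" by (intro null1) simp_all
  define k' where "k' = lift z k"
  have k' [simp]: "k' \<in> arr C" "source C k' = source C (ker (b \<cdot> f))" "target C k' = source C z"
    and zk: "z \<cdot> k' = k"
    unfolding k'_def using lift_kernel[OF z, of k] \<open>eta \<cdot> xi \<cdot> k \<in> null C\<close> by simp_all
  define \<kappa>0 where "\<kappa>0 = ker (coker f \<cdot> ker b)"
  have \<kappa>0: "is_kernel \<kappa>0 (coker f \<cdot> ker b)" unfolding \<kappa>0_def by (rule ker_kernel) simp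
  note [simp] = kernelD[OF \<kappa>0, simplified]
  have "g_flat \<cdot> (coker f \<cdot> (ker b \<cdot> \<kappa>0)) \<in> null C" by simp
  then have "g \<cdot> (ker b \<cdot> \<kappa>0) \<in> null C" using reassoc[OF g_flat_props(4), of "ker b \<cdot> \<kappa>0"] by simp
  then have "eta \<cdot> xi \<cdot> \<kappa>0 \<in> null C" by (intro null1) simp_all
  from kernel_ex[OF z _ _ this] obtain \<kappa> where [simp]: "\<kappa> \<in> arr C" "target C \<kappa> = source C z"
    and \<kappa>: "z \<cdot> \<kappa> = \<kappa>0" by auto
  have [simp]: "source C \<kappa> = source C \<kappa>0" using arg_cong[OF \<kappa>, of "source C"] by simp
  obtain r where r: "normal_epi r" "source C r = source C k" "target C r = source C \<kappa>0" "\<kappa>0 \<cdot> r = k"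
    by (rule exact_restrict[where b = b and k = k, OF f coker_cokernel ker_kernel _ ker_kernel _ _ _ \<kappa>0])
      simp_all
  note [simp] = normal_epiD(1)[OF r(1)] r(2,3)
  have "z \<cdot> (\<kappa> \<cdot> r) = z \<cdot> k'" using reassoc[OF \<kappa>, of r] by (simp add: r(4) zk)
  then have \<kappa>r: "\<kappa> \<cdot> r = k'" by (rule monicD[OF kernel_monic[OF z]]) simp_all
  \<comment> \<open>After embedding into \<open>Coker f\<close>, \<open>v\<close> is the restriction
    of \<open>coker f \<cdot> ker b\<close> to \<open>z\<close>. Its kernel is therefore
    \<open>\<kappa>0\<close>, regarded as a subobject of the source of \<open>z\<close>.\<close>
  have "coker f \<cdot> ker b \<cdot> z = ker b_check \<cdot> ker eta \<cdot> v"
    using reassoc[OF xi_props(4), of z] by (simp add: z_def)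
  moreover have "is_kernel \<kappa> (coker f \<cdot> ker b \<cdot> z)"
    by (rule kernel_cancel_left[OF _ kernel_monic[OF z]]) (simp_all add: \<kappa> \<kappa>0)
  moreover have "N_mono (ker b_check \<cdot> ker eta)"
    by (rule N_mono_comp[OF kernel_N_mono[OF ker_kernel] kernel_N_mono[OF ker_kernel]]) simp_all
  ultimately have kv: "is_kernel \<kappa> v"
    by (intro kernel_N_mono_cancel[of \<kappa> "ker b_check \<cdot> ker eta" v]) simp_all
  have lh: "lhom k (eta \<cdot> xi) = coker (\<kappa> \<cdot> r)" by (simp add: lhom_def \<kappa>r k'_def z_def)
  have c: "is_cokernel (lhom k (eta \<cdot> xi)) \<kappa>" unfolding lh
    by (rule cokernel_N_epi_cancel[OF coker_cokernel normal_epiD(3)[OF r(1)]]) simp_all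
  have "v \<cdot> (\<kappa> \<cdot> r) \<in> null C" using kernelD(4)[OF kv] by (rule null_reassoc) simp_all
  then show thesis
    using that[OF kv c] colift_coker[of "\<kappa> \<cdot> r" v] by (simp add: alpha0_def lh flip: z_def)
qed

lemma alpha0_N_mono:
  assumes f: "exact_mor f"
  shows "N_mono alpha0"
  using alpha0_props[OF f] N_mono_induced by metis

lemma alpha0_kernel:
  assumes f: "exact_mor f" and e: "exact_mor (coker f \<cdot> ker b)"
  shows "is_kernel alpha0 beta0"
proof -
  obtain \<kappa> where \<kappa>: "is_kernel \<kappa> v" and c: "is_cokernel (lhom k (eta \<cdot> xi)) \<kappa>"
    and al [simp]: "alpha0 \<in> arr C" "source C alpha0 = target C (lhom k (eta \<cdot> xi))"
    "target C alpha0 = source C (ker eta)" and al_eq: "alpha0 \<cdot> lhom k (eta \<cdot> xi) = v"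
    by (rule alpha0_props[OF f])
  note [simp] = kernelD[OF \<kappa>] cokernelD[OF c]
  obtain J P where J: "normal_mono J" and P: "normal_epi P" and JP [simp]: "source C J = target C P"
    and e': "coker f \<cdot> ker b = J \<cdot> P" by (rule exact_morE[OF e])
  note [simp] = normal_monoD(1)[OF J] normal_epiD(1)[OF P]
  have [simp]: "target C J = target C (coker f)" "source C P = source C (ker b)"
    using arg_cong[OF e', of "target C"] arg_cong[OF e', of "source C"] by simp_all
  define U where "U = ker b_check \<cdot> ker eta"
  have U [simp]: "U \<in> arr C" "source C U = source C (ker eta)" "target C U = target C (coker f)"
    by (simp_all add: U_def)
  have nU: "normal_mono U" unfolding U_def
    by (rule normal_mono_comp[OF normal_monoI[OF ker_kernel] normal_monoI[OF ker_kernel]]) simp_all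
  have kU: "is_kernel U (coker U)" by (rule normal_mono_kernel[OF nU coker_cokernel]) simp
  \<comment> \<open>Presenting \<open>ker eta\<close> through \<open>coker U\<close> moves the
    condition defining \<open>Ker (eta \<cdot> xi)\<close> into \<open>Coker f\<close>. This
    exhibits it as the preimage under \<open>P\<close> of \<open>J'\<close>, the part of
    \<open>J\<close> contained in \<open>U\<close>.\<close>
  have "is_kernel (ker eta) (coker U \<cdot> ker b_check)"
    by (rule kernel_cancel_left[OF _ kernel_monic[OF ker_kernel]])
      (simp_all add: kU[unfolded U_def] U_def)
  then have "is_kernel (ker (eta \<cdot> xi)) (coker U \<cdot> ker b_check \<cdot> xi)"
    by (intro kernel_replace[OF ker_kernel _ ker_kernel]) simp_all
  then have kz: "is_kernel (ker (eta \<cdot> xi)) (coker U \<cdot> J \<cdot> P)" by (simp add: e')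
  define J' where "J' = ker (coker U \<cdot> J)"
  have J': "is_kernel J' (coker U \<cdot> J)" unfolding J'_def by (rule ker_kernel) simp
  note [simp] = kernelD[OF J', simplified]
  obtain P' where P': "normal_epi P'" "source C P' = source C (ker (eta \<cdot> xi))"
    "target C P' = source C J'" "J' \<cdot> P' = P \<cdot> ker (eta \<cdot> xi)"
    by (rule normal_epi_restrict[OF P J' kz]) simp_all
  note [simp] = normal_epiD(1)[OF P'(1)] P'(2,3)
  obtain w where [simp]: "w \<in> arr C" "target C w = source C (ker eta)" and w: "U \<cdot> w = J \<cdot> J'"
    using kernel_ex[OF kU, of "J \<cdot> J'"] by auto
  have [simp]: "source C w = source C J'" using arg_cong[OF w, of "source C"] by simp
  have "U \<cdot> (w \<cdot> P') = J \<cdot> (P \<cdot> ker (eta \<cdot> xi))" using reassoc[OF w, of P'] by (simp add: P'(4))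
  also have "\<dots> = coker f \<cdot> (ker b \<cdot> ker (eta \<cdot> xi))"
    using reassoc[OF e'[symmetric], of "ker (eta \<cdot> xi)"] by simp
  also have "\<dots> = U \<cdot> v"
    using reassoc[OF xi_props(4), of "ker (eta \<cdot> xi)"] by (simp add: U_def)
  finally have wP: "w \<cdot> P' = v" by (rule monicD[OF normal_monoD(2)[OF nU]]) simp_all
  \<comment> \<open>The cokernel of \<open>J \<cdot> P\<close> is also one of \<open>J\<close>,
    because \<open>P\<close> is an N-epimorphism.\<close>
  have "is_cokernel pbar J"
    by (rule cokernel_N_epi_cancel[OF pbar_cokernel[unfolded e'] normal_epiD(3)[OF P]]) simp_all
  then have kJ: "is_kernel J pbar" by (rule normal_mono_kernel[OF J])
  \<comment> \<open>The intersection of \<open>J\<close> and \<open>U\<close>, seen inside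
    \<open>U\<close>, consists of what \<open>pbar \<cdot> U\<close> kills, since \<open>J\<close>
    is the kernel of \<open>pbar\<close>.\<close>
  have kw: "is_kernel w (pbar \<cdot> U)"
  proof (rule kernelI)
    have "monic (U \<cdot> w)" unfolding w by (rule monic_comp[OF kernel_monic[OF J'] normal_monoD(2)[OF J]]) simp
    then show "monic w" by (rule monic_cancel) simp_all
    have "pbar \<cdot> (J \<cdot> J') \<in> null C" using kernelD(4)[OF kJ] by (rule null_reassoc) simp_all
    then show "pbar \<cdot> U \<cdot> w \<in> null C" by (simp add: w)
    fix x assume [simp]: "x \<in> arr C" and x: "target C x = source C (pbar \<cdot> U)" "pbar \<cdot> U \<cdot> x \<in> null C"
    then have [simp]: "target C x = source C (ker eta)" by simp
    obtain y where [simp]: "y \<in> arr C" "target C y = target C P" and y: "J \<cdot> y = U \<cdot> x"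
      using kernel_ex[OF kJ, of "U \<cdot> x"] x by auto
    have "coker U \<cdot> (U \<cdot> x) \<in> null C" by (rule null_reassoc) simp_all
    then have "coker U \<cdot> J \<cdot> y \<in> null C" by (simp add: y)
    from kernel_ex[OF J' _ _ this] obtain t where [simp]: "t \<in> arr C" "target C t = source C J'"
      and t: "J' \<cdot> t = y" by auto
    have "U \<cdot> (w \<cdot> t) = U \<cdot> x" using reassoc[OF w, of t] by (simp add: t y)
    then have "w \<cdot> t = x" by (rule monicD[OF normal_monoD(2)[OF nU]]) simp_all
    then show "\<exists>x' \<in> arr C. target C x' = source C w \<and> w \<cdot> x' = x" by (intro bexI[of _ t]) simp_all
  qed simp_all
  then have kw': "is_kernel w beta0"
    by - (rule kernel_N_mono_cancel[OF _ kernel_N_mono[OF incl_S1_props(1)]],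
      simp_all add: beta0_eq U_def incl_S1_props)
  \<comment> \<open>From \<open>w \<cdot> P' = v\<close> the kernels of \<open>P'\<close> and
    \<open>v\<close> agree. So \<open>P'\<close> and the projection onto the homology are two
    cokernels of \<open>\<kappa>\<close>, and \<open>alpha0\<close> is \<open>w\<close> up to an
    isomorphism.\<close>
  have "is_kernel \<kappa> P'"
    by (rule kernel_N_mono_cancel[OF _ kernel_N_mono[OF kw]]) (simp_all add: wP \<kappa>)
  then have "is_cokernel P' \<kappa>" by (rule normal_epi_cokernel[OF P'(1)])
  from cokernel_compare[OF c this] obtain t where
    t: "is_iso t" "target C t = target C P'" "source C t = target C (lhom k (eta \<cdot> xi))"
    "t \<cdot> lhom k (eta \<cdot> xi) = P'" .
  note [simp] = inv_arr_props(1)[OF t(1)] t(2,3)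
  have "alpha0 \<cdot> lhom k (eta \<cdot> xi) = w \<cdot> t \<cdot> lhom k (eta \<cdot> xi)" by (simp add: al_eq t(4) wP)
  then have "alpha0 = w \<cdot> t" by (rule epicD[OF cokernel_epic[OF c]]) simp_all
  then show ?thesis using kernel_comp_iso[OF kw' t(1)] by simp
qed

subsection \<open>Exactness at \<open>Im S\<close>\<close>

text \<open>As \<open>f\<close> factors through \<open>ker g\<close>, dividing \<open>Im b\<close>
  by the image of \<open>Ker g\<close> also divides by the image of \<open>f\<close>.\<close>

lemma quot_T_factor:
  obtains n where "n \<in> arr C" "source C n = target C quot_S1" "n \<cdot> quot_S1 = quot_T"
proof -
  have "quot_T \<cdot> (proj_b \<cdot> (ker g \<cdot> lift (ker g) f)) \<in> null C"
    using null_comp_right[OF quot_T_null, of "lift (ker g) f"] by simp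
  then show thesis using cokernel_ex[OF quot_S1_cokernel, of quot_T] that by auto
qed

text \<open>A self-dual form of exactness at \<open>Im S\<close> together with exactness of \<open>Lam\<close>.\<close>

lemma Lam_factor:
  assumes g: "exact_mor g" and eta: "exact_mor eta"
  obtains j q where "normal_mono j" "is_cokernel q beta0" "source C j = target C q" "Lam = j \<cdot> q"
proof -
  obtain n where [simp]: "n \<in> arr C" "source C n = target C quot_S1" and n: "n \<cdot> quot_S1 = quot_T"
    by (rule quot_T_factor)
  have [simp]: "target C n = target C (rinj T)" using arg_cong[OF n, of "target C"] by simp
  note [simp] = Lam_props(1-3) incl_S1_props(2-4)
  \<comment> \<open>Inside the quotients of \<open>Im b\<close>, \<open>Lam\<close> is the
    restriction of the projection \<open>n\<close>.\<close>
  have "ker (rho T) \<cdot> Lam \<cdot> coker (lam S) = n \<cdot> incl_S1 \<cdot> coker (lam S)"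
    using reassoc[OF n, of "lproj S"] by (simp add: Lam_props(4) incl_S1_props(5))
  then have kL: "ker (rho T) \<cdot> Lam = n \<cdot> incl_S1" by (rule coker_cancel) simp_all
  have npb: "normal_epi pbar" by (rule normal_epiI[OF pbar_cokernel])
  have kb: "is_kernel (ker b_check) (rho S1 \<cdot> pbar)" unfolding rho_pbar by (rule ker_kernel) simp
  \<comment> \<open>By \<open>rho_pbar\<close>, \<open>Ker b_check\<close> is the preimage of
    \<open>Im S\<close> under \<open>pbar\<close>, so \<open>pbar\<close> restricts to a cokernel
    onto \<open>Im S\<close>. Then \<open>beta0\<close> is \<open>p\<close> restricted to
    \<open>Ker eta\<close>.\<close>
  obtain p where p: "normal_epi p" "source C p = source C (ker b_check)"
    "target C p = source C incl_S1" "incl_S1 \<cdot> p = pbar \<cdot> ker b_check"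
    by (rule normal_epi_restrict[OF npb incl_S1_props(1) kb]) simp_all
  note [simp] = normal_epiD(1)[OF p(1)] p(2,3)[simplified]
  have mono: "monic incl_S1" by (rule kernel_monic[OF incl_S1_props(1)])
  have "incl_S1 \<cdot> beta0 = incl_S1 \<cdot> (p \<cdot> ker eta)"
    using reassoc[OF p(4), of "ker eta"] by (simp add: beta0_eq)
  then have beta0: "beta0 = p \<cdot> ker eta" by (rule monicD[OF mono]) simp_all
  have "incl_S1 \<cdot> (p \<cdot> xi) = pbar \<cdot> (coker f \<cdot> ker b)" using reassoc[OF p(4), of xi] by simp
  then have "incl_S1 \<cdot> (p \<cdot> xi) \<in> null C" using cokernelD(4)[OF pbar_cokernel] by simp
  then have pxi: "p \<cdot> xi \<in> null C" by (rule N_monoD[OF kernel_N_mono[OF incl_S1_props(1)]]) simp_all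

  define J where "J = im eta"
  define P where "P = bar eta \<cdot> coim eta"
  have J: "is_kernel J (coker eta)" and P: "is_cokernel P (ker eta)" and eta_JP: "J \<cdot> P = eta"
    using exact_mor_factor[OF eta] by (simp_all add: J_def P_def)
  have [simp]: "J \<in> arr C" "P \<in> arr C" "source C J = target C P" "target C J = source C (ker c)"
    "source C P = source C (ker b_check)" by (simp_all add: J_def P_def)
  define i where "i = im g"
  define q where "q = bar g \<cdot> coim g"
  have i: "is_kernel i (coker g)" and q: "is_cokernel q (ker g)" and g_iq: "i \<cdot> q = g"
    using exact_mor_factor[OF g] by (simp_all add: i_def q_def)
  have [simp]: "i \<in> arr C" "q \<in> arr C" "source C i = target C q" "target C i = E" "source C q = B"
    by (simp_all add: i_def q_def)
  have "i \<cdot> (q \<cdot> f) \<in> null C" using reassoc[OF g_iq, of f] top_null by simp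
  then have "q \<cdot> f \<in> null C" by (rule N_monoD[OF kernel_N_mono[OF i]]) simp_all
  then obtain qf where [simp]: "qf \<in> arr C" "source C qf = target C (coker f)" and qf: "qf \<cdot> coker f = q"
    using cokernel_ex[OF coker_cokernel[of f], of q] by auto
  have [simp]: "target C qf = target C q" using arg_cong[OF qf, of "target C"] by simp
  have "i \<cdot> qf \<cdot> coker f = g_flat \<cdot> coker f" by (simp add: qf g_iq)
  then have iqf: "i \<cdot> qf = g_flat" by (rule coker_cancel) simp_all

  have nJ: "normal_mono (ker c \<cdot> J)"
    by (rule normal_mono_comp[OF normal_monoI[OF J] normal_monoI[OF ker_kernel]]) simp_all
  have JP: "ker c \<cdot> (J \<cdot> P) = i \<cdot> (qf \<cdot> ker b_check)"
    using reassoc[OF iqf, of "ker b_check"] by (simp add: eta_JP)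
  \<comment> \<open>The image of \<open>Ker b_check\<close> in \<open>E\<close> lies in
    \<open>Im g\<close>: \<open>coker g\<close> kills it after the N-epimorphism
    \<open>P\<close>.\<close>
  have "coker g \<cdot> (i \<cdot> (qf \<cdot> ker b_check)) \<in> null C"
    using kernelD(4)[OF i] by (rule null_reassoc) simp_all
  then have "coker g \<cdot> (ker c \<cdot> J) \<cdot> P \<in> null C" using JP by simp
  then have "coker g \<cdot> (ker c \<cdot> J) \<in> null C" by (rule N_epiD[OF cokernel_N_epi[OF P]]) simp_all
  then obtain J3 where [simp]: "J3 \<in> arr C" "target C J3 = target C q" and J3: "i \<cdot> J3 = ker c \<cdot> J"
    using kernel_ex[OF i, of "ker c \<cdot> J"] by auto
  have [simp]: "source C J3 = target C P" using arg_cong[OF J3, of "source C"] by simp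
  have nJ3: "normal_mono J3"
    by (rule normal_mono_cancel_left[OF _ kernel_monic[OF i]]) (simp_all add: J3 nJ)
  have "i \<cdot> (J3 \<cdot> P) = i \<cdot> (qf \<cdot> ker b_check)" using reassoc[OF J3, of P] JP by simp
  then have J3P: "J3 \<cdot> P = qf \<cdot> ker b_check" by (rule monicD[OF kernel_monic[OF i]]) simp_all

  obtain n2 where [simp]: "n2 \<in> arr C" "source C n2 = target C q" and n2: "n2 \<cdot> q = quot_T \<cdot> proj_b"
    using cokernel_ex[OF q, of "quot_T \<cdot> proj_b"] quot_T_null by auto
  have [simp]: "target C n2 = target C (rinj T)" using arg_cong[OF n2, of "target C"] by simp
  have "n \<cdot> pbar \<cdot> coker f = n2 \<cdot> qf \<cdot> coker f"
    using reassoc[OF n, of proj_b] by (simp add: qf n2)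
  then have npbar: "n \<cdot> pbar = n2 \<cdot> qf" by (rule coker_cancel) simp_all
  \<comment> \<open>The image of \<open>Ker b\<close> in \<open>Coim g\<close> lies inside
    \<open>J3\<close>. This provides the null composite that \<open>homology_iso\<close> needs
    below.\<close>
  have qb: "q \<cdot> ker b = J3 \<cdot> (P \<cdot> xi)"
    using reassoc[OF J3P, of xi] reassoc[OF qf, of "ker b"] by simp
  \<comment> \<open>The quotient of \<open>B\<close> by \<open>Ker g\<close> and
    \<open>Ker b\<close>, now dividing by \<open>Ker g\<close> first, with the same target as
    \<open>quot_T \<cdot> proj_b\<close>.\<close>
  have n2_cok: "is_cokernel n2 (J3 \<cdot> (P \<cdot> xi))"
    unfolding qb[symmetric]
  proof (rule cokernelI)
    have "epic (rinj T \<cdot> coim b)"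
      by (rule epic_comp[OF cokernel_epic[OF rinj_T(1)] cokernel_epic[OF coim_props(1)]]) simp_all
    then have "epic (n2 \<cdot> q)" by (simp add: n2 quot_proj)
    then show "epic n2" by (rule epic_cancel) simp_all
    have "quot_T \<cdot> (proj_b \<cdot> ker b) \<in> null C" using cokernelD(4)[OF proj_b_cokernel] by simp
    then show "n2 \<cdot> (q \<cdot> ker b) \<in> null C" using reassoc[OF n2, of "ker b"] by simp
    fix y assume [simp]: "y \<in> arr C" and y: "source C y = target C (q \<cdot> ker b)" "y \<cdot> (q \<cdot> ker b) \<in> null C"
    then have [simp]: "source C y = target C q" by simp
    obtain z where [simp]: "z \<in> arr C" "source C z = source C (im b)" and z: "z \<cdot> proj_b = y \<cdot> q"
      using cokernel_ex[OF proj_b_cokernel, of "y \<cdot> q"] y by auto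
    have "y \<cdot> (q \<cdot> ker g) \<in> null C" using cokernelD(4)[OF q] by simp
    then have "z \<cdot> proj_b \<cdot> ker g \<in> null C" by (simp add: z)
    then obtain t where [simp]: "t \<in> arr C" "source C t = target C (rinj T)" and t: "t \<cdot> quot_T = z"
      using quot_T_universal[of z] by auto
    have "t \<cdot> n2 \<cdot> q = y \<cdot> q" using reassoc[OF t, of proj_b] by (simp add: n2 z)
    then have "t \<cdot> n2 = y" by (rule epicD[OF cokernel_epic[OF q]]) simp_all
    then show "\<exists>x' \<in> arr C. source C x' = target C n2 \<and> x' \<cdot> n2 = y" by (intro bexI[of _ t]) simp_all
  qed simp_all

  define s where "s = coker J3"
  have s: "is_kernel J3 s" unfolding s_def by (rule normal_mono_kernel[OF nJ3 coker_cokernel]) simp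
  note [simp] = kernelD[OF s]
  have sn: "s \<cdot> (J3 \<cdot> (P \<cdot> xi)) \<in> null C" by (rule null_reassoc) (simp_all add: s_def)
  from cokernel_ex[OF n2_cok, of s] sn obtain s' where [simp]: "s' \<in> arr C" "source C s' = target C (rinj T)"
    and s': "s' \<cdot> n2 = s" by (auto simp: s_def)
  \<comment> \<open>The subobject \<open>J3\<close> followed by the quotient \<open>n2\<close> is
    rewritten as a cokernel followed by a kernel, with \<open>t' = P \<cdot> xi\<close>.\<close>
  obtain m where m: "is_iso m" "source C m = target C (coker (P \<cdot> xi))" "target C m = source C (ker s')"
    "ker s' \<cdot> (m \<cdot> coker (P \<cdot> xi)) = n2 \<cdot> J3"
    by (rule homology_iso[OF s n2_cok sn _ _ refl _ _ s' coker_cokernel ker_kernel]) simp_all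
  note [simp] = inv_arr_props(1)[OF m(1)] m(2,3)
  define P4 where "P4 = m \<cdot> coker (P \<cdot> xi)"
  have P4: "is_cokernel P4 (P \<cdot> xi)" unfolding P4_def
    by (rule cokernel_comp_iso[OF coker_cokernel m(1)]) simp_all
  define J4 where "J4 = ker s'"
  have J4: "is_kernel J4 s'" unfolding J4_def by (rule ker_kernel) simp
  have [simp]: "P4 \<in> arr C" "source C P4 = target C P" "target C P4 = source C J4" "J4 \<in> arr C"
    "target C J4 = target C (rinj T)" by (simp_all add: P4_def J4_def)
  have J4P4: "J4 \<cdot> P4 = n2 \<cdot> J3" using m(4) by (simp add: J4_def P4_def)

  have eq1: "ker (rho T) \<cdot> (Lam \<cdot> p) = J4 \<cdot> (P4 \<cdot> P)"
  proof -
    have "ker (rho T) \<cdot> (Lam \<cdot> p) = n \<cdot> (pbar \<cdot> ker b_check)"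
      using reassoc[OF kL, of p] by (simp add: p(4))
    also have "\<dots> = n2 \<cdot> (qf \<cdot> ker b_check)" using reassoc[OF npbar, of "ker b_check"] by simp
    also have "\<dots> = J4 \<cdot> (P4 \<cdot> P)" using reassoc[OF J4P4, of P] by (simp add: J3P)
    finally show ?thesis .
  qed
  have nPP: "normal_epi (P4 \<cdot> P)" by (rule normal_epi_comp[OF normal_epiI[OF P] normal_epiI[OF P4]]) simp
  \<comment> \<open>The kernel \<open>J4\<close> lands in \<open>Ker T\<close>, since
    \<open>rho T\<close> kills it after the N-epimorphism \<open>P4 \<cdot> P\<close>. This gives
    the kernel part \<open>J5\<close> of \<open>Lam\<close>.\<close>
  have "rho T \<cdot> (ker (rho T) \<cdot> (Lam \<cdot> p)) \<in> null C" by (rule null_reassoc) simp_all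
  then have "rho T \<cdot> J4 \<cdot> (P4 \<cdot> P) \<in> null C" by (simp add: eq1)
  then have "rho T \<cdot> J4 \<in> null C" by (rule N_epiD[OF normal_epiD(3)[OF nPP]]) simp_all
  from kernel_ex[OF ker_kernel[of "rho T"] _ _ this] obtain J5 where
    [simp]: "J5 \<in> arr C" "target C J5 = source C (ker (rho T))" and J5: "ker (rho T) \<cdot> J5 = J4" by auto
  have [simp]: "source C J5 = source C J4" using arg_cong[OF J5, of "source C"] by simp
  have nJ5: "normal_mono J5"
    by (rule normal_mono_cancel_left[OF _ kernel_monic[OF ker_kernel[of "rho T"]]])
      (simp_all add: J5 normal_monoI[OF J4])
  have "ker (rho T) \<cdot> (Lam \<cdot> p) = ker (rho T) \<cdot> (J5 \<cdot> (P4 \<cdot> P))"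
    using reassoc[OF J5, of "P4 \<cdot> P"] by (simp add: eq1)
  then have Lp: "Lam \<cdot> p = J5 \<cdot> (P4 \<cdot> P)" by (rule ker_cancel) simp_all

  have pc: "is_cokernel p (ker p)" by (rule normal_epi_cokernel[OF p(1) ker_kernel]) simp
  \<comment> \<open>To pass from a factorization of \<open>Lam \<cdot> p\<close> to one of
    \<open>Lam\<close>, the cokernel part must kill \<open>ker p\<close>. The N-monomorphism
    \<open>J5\<close> reflects this from \<open>Lam \<cdot> p\<close>.\<close>
  have "J5 \<cdot> (P4 \<cdot> P \<cdot> ker p) \<in> null C"
  proof -
    have "Lam \<cdot> (p \<cdot> ker p) \<in> null C" by simp
    then show ?thesis using reassoc[OF Lp, of "ker p"] by simp
  qed
  then have "P4 \<cdot> P \<cdot> ker p \<in> null C" by (rule N_monoD[OF normal_monoD(3)[OF nJ5]]) simp_all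
  from cokernel_ex[OF pc _ _ this] obtain P5 where
    [simp]: "P5 \<in> arr C" "source C P5 = target C (coker (lam S))" and P5: "P5 \<cdot> p = P4 \<cdot> P" by auto
  have [simp]: "target C P5 = source C J4" using arg_cong[OF P5, of "target C"] by simp
  have "Lam \<cdot> p = J5 \<cdot> P5 \<cdot> p" by (simp add: Lp P5)
  then have L: "Lam = J5 \<cdot> P5" by (rule epicD[OF normal_epiD(2)[OF p(1)]]) simp_all
  \<comment> \<open>A morphism \<open>y\<close> that kills \<open>beta0\<close> gives
    \<open>y \<cdot> p\<close>, which kills \<open>ker eta\<close> and descends along
    \<open>P\<close>. The result kills \<open>P \<cdot> xi\<close>, because \<open>p\<close> kills
    \<open>xi\<close>, and so descends along \<open>P4\<close>.\<close>
  have "is_cokernel P5 beta0"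
  proof (rule cokernelI)
    have "epic (P5 \<cdot> p)" unfolding P5 by (rule normal_epiD(2)[OF nPP])
    then show "epic P5" by (rule epic_cancel) simp_all
    have "P4 \<cdot> (P \<cdot> ker eta) \<in> null C" using cokernelD(4)[OF P] by simp
    then show "P5 \<cdot> beta0 \<in> null C" unfolding beta0 using reassoc[OF P5, of "ker eta"] by simp
    fix y assume [simp]: "y \<in> arr C" and y: "source C y = target C beta0" "y \<cdot> beta0 \<in> null C"
    then have [simp]: "source C y = target C (coker (lam S))" by simp
    have "y \<cdot> p \<cdot> ker eta \<in> null C" using y(2) by (simp add: beta0)
    from cokernel_ex[OF P _ _ this] obtain y1 where [simp]: "y1 \<in> arr C" "source C y1 = target C P"
      and y1: "y1 \<cdot> P = y \<cdot> p" by auto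
    have "y \<cdot> (p \<cdot> xi) \<in> null C" using pxi by simp
    then have "y1 \<cdot> (P \<cdot> xi) \<in> null C" using reassoc[OF y1, of xi] by simp
    then obtain y2 where [simp]: "y2 \<in> arr C" "source C y2 = source C J4" and y2: "y2 \<cdot> P4 = y1"
      using cokernel_ex[OF P4, of y1] by auto
    have "y2 \<cdot> P5 \<cdot> p = y \<cdot> p" using reassoc[OF y2, of P] by (simp add: P5 y1)
    then have "y2 \<cdot> P5 = y" by (rule epicD[OF normal_epiD(2)[OF p(1)]]) simp_all
    then show "\<exists>x' \<in> arr C. source C x' = target C P5 \<and> x' \<cdot> P5 = y" by (intro bexI[of _ y2]) simp_all
  qed simp_all
  then show thesis using that[OF nJ5 _ _ L] by simp
qed

end

section \<open>Duality\<close>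

text \<open>Reversed arrows run upwards and to the left. Turning the diagram by half a turn restores
  its shape, exchanges \<open>S\<close> with \<open>T\<close>, and makes (i') and (ii') instances of
  (i) and (ii).\<close>

definition opposite_rows :: "'m two_rows \<Rightarrow> 'm two_rows" where
  "opposite_rows D = \<lparr>row_f = row_g' D, row_g = row_f' D, row_f' = row_g D, row_g' = row_f D,
     col_a = col_c D, col_b = col_b D, col_c = col_a D\<rparr>"

lemma opposite_rows_sel [simp]:
  "row_f (opposite_rows D) = row_g' D" "row_g (opposite_rows D) = row_f' D"
  "row_f' (opposite_rows D) = row_g D" "row_g' (opposite_rows D) = row_f D"
  "col_a (opposite_rows D) = col_c D" "col_b (opposite_rows D) = col_b D"
  "col_c (opposite_rows D) = col_a D"
  by (simp_all add: opposite_rows_def)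

context nomura
begin

lemma opposite_b_check: "nomura.b_check (opposite C) (opposite_rows D) = b_hat"
  by (simp add: nomura.b_check_def b_hat_def opposite_simps)

lemma opposite_g_flat: "nomura.g_flat (opposite C) (opposite_rows D) = f'_sharp"
  by (simp add: nomura.g_flat_def f'_sharp_def opposite_simps)

lemma opposite_xi: "nomura.xi (opposite C) (opposite_rows D) = xi'"
  by (simp add: nomura.xi_def xi'_def opposite_simps opposite_b_check)

lemma opposite_eta: "nomura.eta (opposite C) (opposite_rows D) = eta'"
  by (simp add: nomura.eta_def eta'_def opposite_simps opposite_b_check opposite_g_flat)

lemma opposite_k: "nomura.k (opposite C) (opposite_rows D) = l"
  by (simp add: nomura.k_def l_def opposite_simps)

lemma opposite_v: "nomura.v (opposite C) (opposite_rows D) = u"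
  by (simp add: nomura.v_def u_def opposite_simps opposite_xi opposite_eta)

lemma opposite_alpha0: "nomura.alpha0 (opposite C) (opposite_rows D) = alpha0'"
  by (simp add: nomura.alpha0_def alpha0'_def opposite_simps opposite_xi opposite_eta opposite_k opposite_v)

lemma opposite_squares:
  "nomura.S (opposite_rows D) = opposite_square T"
  "nomura.T (opposite_rows D) = opposite_square S"
  "nomura.S1 (opposite C) (opposite_rows D) = opposite_square T1"
  "nomura.S2 (opposite C) (opposite_rows D) = opposite_square T2"
  by (simp_all add: nomura.S_def nomura.T_def nomura.S1_def nomura.S2_def T_def S_def T1_def T2_def
      opposite_square_def opposite_simps opposite_xi opposite_b_check)

end

context nomura_diagram
begin

lemma opposite_diagram: "nomura_diagram (opposite C) (opposite_rows D) E' B' A' E B A"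
proof -
  interpret op: homological_category "opposite C" by (rule opposite_homological)
  show ?thesis
    by unfold_locales
      (simp_all add: opposite_simps opposite_exact_mor f_hom g_hom f'_hom g'_hom a_hom b_hom c_hom
        left_square right_square top_null bottom_null b_exact)
qed

lemma dual_squares_commute: "commuting T1" "commuting T2"
  using nomura_diagram.squares_commute(3,4)[OF opposite_diagram]
  by (simp_all add: opposite_squares opposite_commuting)

lemma opposite_Lam: "nomura.Lam (opposite C) (opposite_rows D) = Lam"
  unfolding nomura.Lam_def opposite_squares
  by (rule opposite_Lambek[OF squares_commute(1,2)]) (simp_all add: b_exact)

lemma opposite_sigma: "nomura.sigma (opposite C) (opposite_rows D) = sigma'"
  by (simp add: nomura.sigma_def sigma'_def opposite_simps opposite_squares opposite_xi opposite_b_check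
      opposite_lam[OF dual_squares_commute(2)] opposite_lproj)

lemma opposite_Lambek_T1_T:
  "nullcat.Lambek (opposite C) (opposite_square T) (opposite_square T1) = Lambek T1 T"
  by (rule opposite_Lambek[OF dual_squares_commute(1) squares_commute(2)]) (simp_all add: T1_def b_exact)

lemma opposite_Lambek_T1_T2:
  "nullcat.Lambek_v (opposite C) (opposite_square T2) (opposite_square T1) = Lambek_v T1 T2"
proof (rule opposite_Lambek_v[OF dual_squares_commute(1,2)])
  \<comment> \<open>The dual of the fact that cokernels are exact; it makes the common side of
    \<open>T1\<close> and \<open>T2\<close> admissible.\<close>
  have "exact_mor (ker g')"
    using normal_epi_exact[of "coker g'"]
      semiexact_category.normal_epi_exact[OF opposite_semiexact, of "ker g'"]
    by (simp add: opposite_simps opposite_exact_mor normal_monoI[OF ker_kernel])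
  then show "exact_mor (sq_bottom T1)" by (simp add: T1_def)
qed (simp add: T1_def T2_def)

lemma ker_xi'_typing: "ker xi' \<in> arr C" "source C (coker eta') = target C (ker xi')"
  using nomura_diagram.xi_props[OF opposite_diagram] by (simp_all add: opposite_simps opposite_xi opposite_b_check)

lemmas opposite_typing =
  nomura_diagram.sigma_props(1-3)[OF opposite_diagram]
  nomura_diagram.Lambek_S2_S1(1-3)[OF opposite_diagram]
  nomura_diagram.Lambek_S_S1(1-3)[OF opposite_diagram]

lemmas dual_typing = opposite_typing[unfolded opposite_squares opposite_simps opposite_sigma opposite_xi
  opposite_eta opposite_Lambek_T1_T opposite_Lambek_T1_T2 opposite_lam[OF dual_squares_commute(2)]
  opposite_rho[OF dual_squares_commute(1)] opposite_lam[OF squares_commute(2)]]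

lemma beta0'_typing:
  "beta0' \<in> arr C" "source C beta0' = source C (ker (rho T))" "target C beta0' = target C (coker eta')"
  "nomura.beta0 (opposite C) (opposite_rows D) = beta0'"
proof -
  note [simp] = ker_xi'_typing dual_typing inv_arr_props(1-4)[of "Lambek T1 T"]
  show "nomura.beta0 (opposite C) (opposite_rows D) = beta0'"
    by (simp add: nomura.beta0_def beta0'_def opposite_squares opposite_simps opposite_sigma
        opposite_xi opposite_eta opposite_Lambek_T1_T opposite_Lambek_T1_T2)
  show "beta0' \<in> arr C" "source C beta0' = source C (ker (rho T))" "target C beta0' = target C (coker eta')"
    by (simp_all add: beta0'_def)
qed

lemma beta_eq: "beta = beta0 \<cdot> theta" and alpha_eq: "alpha = inv_arr theta \<cdot> alpha0"
  and alpha'_eq: "alpha' = alpha0' \<cdot> inv_arr theta'"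
  by (simp_all only: beta_def beta0_def alpha_def alpha0_def alpha'_def alpha0'_def)

text \<open>Composites bracket to the left, so \<open>theta\<close> splits off the end of
  \<open>beta\<close> by unfolding. Here \<open>theta'\<close> is the innermost factor, and moving
  it out takes associativity with the types of all factors, which duality supplies.\<close>

lemma beta'_eq: "beta' = theta' \<cdot> beta0'"
proof -
  note [simp] = ker_xi'_typing theta'_props(2) inv_arr_props(1)[OF theta'_props(1)] dual_typing
    inv_arr_props(1-4)[of "Lambek T1 T"]
  show ?thesis by (simp add: beta'_def beta0'_def)
qed

section \<open>The four exactness claims, transferred along \<open>theta\<close> and
  \<open>theta'\<close>\<close>

lemma exactness_at_Ker_h:
  assumes f: "exact_mor f"
  shows "N_mono alpha"
    "exact_mor (coker f \<cdot> ker b) \<Longrightarrow> is_kernel alpha beta \<and> exact_at alpha beta"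
proof -
  note th = inv_arr_props(1-4)[OF theta_props(1)] theta_props(2,3)
  note [simp] = th
  have al: "alpha0 \<in> arr C" "target C alpha0 = source C (ker eta)"
    using alpha0_props[OF f] by metis+
  note [simp] = al
  show "N_mono alpha" unfolding alpha_eq
    by (rule N_mono_comp[OF alpha0_N_mono[OF f] iso_N_mono[OF iso_inv_arr[OF theta_props(1)]]]) simp
  assume "exact_mor (coker f \<cdot> ker b)"
  from alpha0_kernel[OF f this] have "is_kernel (theta \<cdot> alpha) beta0"
    using inv_arr_cancel(2)[OF theta_props(1), of alpha0] by (simp add: alpha_eq)
  then have kab: "is_kernel alpha beta" unfolding beta_eq
    by (rule kernel_precomp_iso[OF _ theta_props(1)]) (simp_all add: alpha_eq)
  then show "is_kernel alpha beta \<and> exact_at alpha beta"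
    using kernel_im[OF kab] kernelD[OF kab] by (simp add: exact_at_def)
qed

text \<open>With \<open>Lam = j \<cdot> q\<close>, where \<open>q\<close> is a cokernel of
  \<open>beta\<close>, the image of \<open>beta\<close> is the kernel of \<open>q\<close>; the
  N-monomorphism \<open>j\<close> does not change this kernel.\<close>

lemma exactness_at_Im_S:
  assumes g: "exact_mor g" and eta: "exact_mor eta"
  shows "exact_at beta Lam" "exact_mor Lam"
proof -
  obtain j q where j: "normal_mono j" and q: "is_cokernel q beta0" and c: "source C j = target C q"
    and L: "Lam = j \<cdot> q" by (rule Lam_factor[OF g eta])
  show "exact_mor Lam" unfolding L by (rule exact_mor_comp[OF j normal_epiI[OF q] c])
  note [simp] = inv_arr_props(1-4)[OF theta_props(1)] theta_props(2,3)
  have "is_cokernel q beta" unfolding beta_eq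
    by (rule cokernel_comp_N_epi[OF q iso_N_epi[OF theta_props(1)]]) simp
  then have "is_kernel (im beta) Lam" unfolding L
    by (intro kernel_comp_N_mono[OF cokernel_im normal_monoD(3)[OF j]]) (simp_all add: c)
  then show "exact_at beta Lam"
    by (simp add: exact_at_def beta_eq Lam_props)
qed

lemma exactness_at_Coker_h:
  assumes g': "exact_mor g'"
  shows "N_epi alpha'"
    "exact_mor (coker b \<cdot> ker g') \<Longrightarrow> is_cokernel alpha' beta' \<and> exact_at beta' alpha'"
proof -
  have f: "nullcat.exact_mor (opposite C) (row_f (opposite_rows D))"
    using g' by (simp add: opposite_exact_mor)
  note [simp] = inv_arr_props(1-4)[OF theta'_props(1)] theta'_props(2,3)
  have al [simp]: "alpha0' \<in> arr C" "source C alpha0' = target C (coker eta')"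
    using nomura_diagram.alpha0_props[OF opposite_diagram f]
    unfolding opposite_simps opposite_alpha0 opposite_eta by metis+
  have "N_epi alpha0'"
    using nomura_diagram.alpha0_N_mono[OF opposite_diagram f] by (simp add: opposite_simps opposite_alpha0)
  from N_epi_comp[OF this iso_N_epi[OF iso_inv_arr[OF theta'_props(1)]]]
  show "N_epi alpha'" unfolding alpha'_eq by simp
  assume e: "exact_mor (coker b \<cdot> ker g')"
  have "is_cokernel alpha0' beta0'"
    using nomura_diagram.alpha0_kernel[OF opposite_diagram f] e
    by (simp add: opposite_simps opposite_exact_mor opposite_alpha0 beta0'_typing(4))
  then have "is_cokernel (alpha' \<cdot> theta') beta0'"
    using inv_arr_props(5)[OF theta'_props(1)] by (simp add: alpha'_eq)
  then have cab: "is_cokernel alpha' beta'" unfolding beta'_eq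
    by (rule cokernel_precomp_iso[OF _ theta'_props(1)]) (simp_all add: alpha'_eq)
  then show "is_cokernel alpha' beta' \<and> exact_at beta' alpha'"
    using cokernel_im[OF cab] cokernelD[OF cab] by (simp add: exact_at_def)
qed

text \<open>The definition of \<open>exact_at\<close> through images is not literally self-dual, so
  what is dualized is the factorization of \<open>Lam\<close>. Its kernel part \<open>j\<close> is a
  kernel of \<open>beta0'\<close> and also of \<open>coker Lam\<close>, hence it represents
  \<open>im Lam\<close>.\<close>

lemma exactness_at_Ker_T:
  assumes f': "exact_mor f'" and eta': "exact_mor eta'"
  shows "exact_at Lam beta'" "exact_mor Lam"
proof -
  have g: "nullcat.exact_mor (opposite C) (row_g (opposite_rows D))"
    "nullcat.exact_mor (opposite C) (nomura.eta (opposite C) (opposite_rows D))"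
    using f' eta' by (simp_all add: opposite_exact_mor opposite_eta)
  obtain q j where q: "normal_epi q" and j: "is_kernel j beta0'" and c: "target C q = source C j"
    and L: "Lam = j \<cdot> q"
    using nomura_diagram.Lam_factor[OF opposite_diagram g]
    unfolding opposite_simps opposite_Lam beta0'_typing(4) by metis
  show "exact_mor Lam" unfolding L by (rule exact_mor_comp[OF normal_monoI[OF j] q]) (simp add: c)
  note [simp] = inv_arr_props(1-4)[OF theta'_props(1)] theta'_props(2,3) normal_epiD(1)[OF q]
    beta0'_typing(1-3) kernelD(2)[OF j] Lam_props(1-3)
  have "is_cokernel (coker Lam) j"
    by (rule cokernel_N_epi_cancel[OF _ normal_epiD(3)[OF q]])
      (simp_all add: L[symmetric] coker_cokernel c)
  then have "is_kernel j (coker Lam)" by (rule kernel_of_cokernel[OF j])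
  then have "is_kernel (im Lam) beta0'" by (rule kernel_change[OF _ j im_props(1)]) simp
  then have "is_kernel (im Lam) beta'" unfolding beta'_eq
    by (rule kernel_comp_N_mono[OF _ iso_N_mono[OF theta'_props(1)]]) simp
  then show "exact_at Lam beta'" by (simp add: exact_at_def beta'_eq)
qed

end

theorem theorem4:
  fixes C :: "('o, 'm) nullcat" (structure)
    and D :: "'m two_rows"
    and A B E A' B' E' :: 'o
  assumes "homological_category C"
    and "row_f D \<in> nullcat.hom C A B" and "row_g D \<in> nullcat.hom C B E"
    and "row_f' D \<in> nullcat.hom C A' B'" and "row_g' D \<in> nullcat.hom C B' E'"
    and "col_a D \<in> nullcat.hom C A A'" and "col_b D \<in> nullcat.hom C B B'"
    and "col_c D \<in> nullcat.hom C E E'"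
    and "col_b D \<cdot> row_f D = row_f' D \<cdot> col_a D"
    and "col_c D \<cdot> row_g D = row_g' D \<cdot> col_b D"
    and "row_g D \<cdot> row_f D \<in> null C" and "row_g' D \<cdot> row_f' D \<in> null C"
    and "nullcat.exact_mor C (col_b D)"
  shows
    "(nullcat.exact_mor C (row_f D) \<longrightarrow>
        nullcat.N_mono C (nomura.alpha C D) \<and>
        (nullcat.exact_mor C (nullcat.coker C (row_f D) \<cdot> nullcat.ker C (col_b D)) \<longrightarrow>
           nullcat.is_kernel C (nomura.alpha C D) (nomura.beta C D) \<and>
           nullcat.exact_at C (nomura.alpha C D) (nomura.beta C D))) \<and>
     (nullcat.exact_mor C (row_g D) \<and> nullcat.exact_mor C (nomura.eta C D) \<longrightarrow>
        nullcat.exact_at C (nomura.beta C D) (nomura.Lam C D) \<and>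
        nullcat.exact_mor C (nomura.Lam C D)) \<and>
     (nullcat.exact_mor C (row_g' D) \<longrightarrow>
        nullcat.N_epi C (nomura.alpha' C D) \<and>
        (nullcat.exact_mor C (nullcat.coker C (col_b D) \<cdot> nullcat.ker C (row_g' D)) \<longrightarrow>
           nullcat.is_cokernel C (nomura.alpha' C D) (nomura.beta' C D) \<and>
           nullcat.exact_at C (nomura.beta' C D) (nomura.alpha' C D))) \<and>
     (nullcat.exact_mor C (row_f' D) \<and> nullcat.exact_mor C (nomura.eta' C D) \<longrightarrow>
        nullcat.exact_at C (nomura.Lam C D) (nomura.beta' C D) \<and>
        nullcat.exact_mor C (nomura.Lam C D))"
proof -
  interpret homological_category C by fact
  interpret nomura_diagram C D A B E A' B' E'
    by unfold_locales (use assms in simp_all)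
  show ?thesis
    using exactness_at_Ker_h exactness_at_Im_S exactness_at_Coker_h exactness_at_Ker_T by blast
qed

end
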